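(* Let $f$ be an $E$-convex tracial $\mathrm{W}^*$-function (of $m$-tuples). For $s,t\in[0,1]$ define $f_{t,s}=(f_{t,s}^{\mathcal A})_{\mathcal A\in\mathbb{W}}$ as follows. Set $$f_{t,0}=(1-t)q_1+tf,\qquad f_{0,t}=\mathcal{L}f_{t,0}.$$ If $s>0$ and $s\leq t$, set $$f_{t,s}^{\mathcal A}(X)=\inf_{Y\in L^2(\mathcal A)_{\mathrm{sa}}^m}\left(\frac{t}{2s}\|X\|^2-\frac{t-s}{s}\langle X,Y\rangle+\frac{(t-s)(1-s)}{2s}\|Y\|^2+(t-s)f^{\mathcal A}(Y)\right),$$ and if $s>0$ and $s\geq t$, set $$f_{t,s}^{\mathcal A}(X)=\sup_{Y\in L^2(\mathcal A)_{\mathrm{sa}}^m}\left(\frac{t}{2s}\|X\|^2-\frac{t-s}{s}\langle X,Y\rangle+\frac{(t-s)(1-s)}{2s}\|Y\|^2+(t-s)f^{\mathcal A}(Y)\right),$$ with norms and inner products in $L^2(\mathcal A)_{\mathrm{sa}}^m$. (In particular $f_{t,t}=q_1$ for all $t\in[0,1]$.) Then: (1) $f_{t,s}$ is $E$-convex and $f_{s,t}=\mathcal{L}f_{t,s}$. (2) If $s\leq t$, then $f_{t,s}-\frac{1-t}{1-s}q_1$ is $E$-convex for $s<1$, and $\frac{t}{s}q_1-f_{t,s}$ is $E$-convex for $s>0$. (3) If $t\leq s$, then $f_{t,s}-\frac{t}{s}q_1$ is $E$-convex for $s>0$, and $\frac{1-t}{1-s}q_1-f_{t,s}$ is $E$-convex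 for $s<1$. (4) In particular, if $s\in(0,1)$ and $X\in L^2(\mathcal A)_{\mathrm{sa}}^m$, then $\eth f_{t,s}^{\mathcal A}(X)$ consists of a unique point $\nabla f_{t,s}^{\mathcal A}(X)$, and $\nabla f_{t,s}^{\mathcal A}$ is Lipschitz. (5) Suppose $0\leq s<t\leq 1$. If $u\in(s,t)$, then $$f_{u,s}=\frac{t-u}{t-s}q_1+\frac{u-s}{t-s}f_{t,s}\quad\text{and}\quad f_{t,u}=\left(\frac{t-s}{u-s}q_1\right)\square\left(\frac{t-u}{t-s}f_{t,s}\left(\frac{t-s}{t-u}(\cdot)\right)\right).$$ (6) Suppose $0\leq s<t\leq1$ and $X,Y\in L^2(\mathcal A)_{\mathrm{sa}}^m$ with $Y\in\eth f_{t,s}^{\mathcal A}(X)$. For $u\in[s,t]$ let $X_u=\frac{t-u}{t-s}X+\frac{u-s}{t-s}Y$. Then $X_u\in\eth f_{u,s}^{\mathcal A}(X)$ and $Y\in\eth f_{t,u}^{\mathcal A}(X_u)$. (7) For $s,t,u\in(0,1)$, we have $\nabla f_{u,t}\circ\nabla f_{t,s}=\nabla f_{u,s}$ (i.e. $\nabla f^{\mathcal A}_{u,t}\circ\nabla f^{\mathcal A}_{t,s}=\nabla f^{\mathcal A}_{u,s}$ for each $\mathcal A\in\mathbb{W}$).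
   Context: A tracial $\mathrm{W}^*$-algebra $\mathcal A$ is a von Neumann algebra $L^\infty(\mathcal A)$ with a faithful normal tracial state $\tau_{\mathcal A}$. $L^2(\mathcal A)$ is the completion of $L^\infty(\mathcal A)$ under $\langle a,b\rangle=\tau_{\mathcal A}(a^*b)$; $L^2(\mathcal A)_{\mathrm{sa}}$ is the real Hilbert space of self-adjoint elements; on $L^2(\mathcal A)_{\mathrm{sa}}^m$, $\langle X,Y\rangle=\sum_j\langle X_j,Y_j\rangle$. $\mathbb{W}$ is a fixed set of representatives of the isomorphism classes of tracial $\mathrm{W}^*$-algebras with separable predual. A tracial $\mathrm{W}^*$-embedding $\iota:\mathcal A\to\mathcal B$ is a unital trace-preserving $*$-homomorphism; it extends to an isometry $L^2(\mathcal A)\to L^2(\mathcal B)$ whose adjoint is the trace-preserving conditional expectation $E:L^2(\mathcal B)\to L^2(\mathcal A)$; both act entrywise on tuples. A tracial $\mathrm{W}^*$-function is a tuple $f=(f^{\mathcal A})_{\mathcal A\in\mathbb{W}}$, $f^{\mathcal A}:L^2(\mathcal A)_{\mathrm{sa}}^m\to[-\infty,\infty]$, with $f^{\mathcal A}=f^{\mathcal B}\circ\iota$ for every tracial $\mathrm{W}^*$-embedding $\iota:\mathcal A\to\mathcal B$. It is $E$-convex if either it is identically $-\infty$, or each $f^{\mathcal A}$ is convex, lower semi-continuous with values in $(-\infty,\infty]$, and $f^{\mathcal A}(E[X])\leq f^{\mathcal B}(X)$ for every $\iota:\mathcal A\to\mathcal B$ with conditional expectation $E$ and every $X\in L^2(\mathcal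 B)_{\mathrm{sa}}^m$. Notation: $q_1^{\mathcal A}(X)=\frac12\|X\|_{L^2(\mathcal A)_{\mathrm{sa}}^m}^2$. Legendre transform: $\mathcal{L}f^{\mathcal A}(X)=\sup\{\langle\iota(X),Y\rangle-f^{\mathcal B}(Y)\}$, the supremum over $\mathcal B\in\mathbb{W}$, tracial $\mathrm{W}^*$-embeddings $\iota:\mathcal A\to\mathcal B$, and $Y\in L^2(\mathcal B)_{\mathrm{sa}}^m$. Inf-convolution: $(f\,\square\,g)^{\mathcal A}(X)=\inf\{f^{\mathcal B}(\iota(X)-Y)+g^{\mathcal B}(Y)\}$, the infimum over the same data. Subdifferential of $\varphi:H\to(-\infty,\infty]$ on a real Hilbert space: $\eth\varphi(x)=\{y\in H:\varphi(x')\geq\varphi(x)+\langle y,x'-x\rangle\ \forall x'\in H\}$. For $c>0$, $f(c(\cdot))$ denotes $X\mapsto f^{\mathcal A}(cX)$. Convention: $0\cdot(\pm\infty)=0$. For a function with single-valued subdifferential, $\nabla$ denotes the unique subgradient.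
   Formalization: Parts (4) and (7) are stated only for f not identically +∞ and not identically −∞; for these two E-convex functions f_{t,s} with s≠t is identically ±∞, so its subdifferential is the whole space (or undefined) and there is no unique subgradient. *)

theory Defs
  imports "HOL-Analysis.Analysis"
begin

section \<open>The separable Hilbert space of square-summable sequences\<close>

typedef ell2 = "{x :: nat \<Rightarrow> complex. summable (\<lambda>n. (cmod (x n))\<^sup>2)}"
  morphisms coeff Abs_ell2
  by (rule exI[of _ "\<lambda>_. 0"]) simp

setup_lifting type_definition_ell2

lemma summable_coeff: "summable (\<lambda>n. (cmod (coeff x n))\<^sup>2)"
  using coeff[of x] by simp

lemma summable_coeff_mult: "summable (\<lambda>n. cnj (coeff x n) * coeff y n)"
proof (rule summable_comparison_test')
  show "summable (\<lambda>n. (cmod (coeff x n))\<^sup>2 + (cmod (coeff y n))\<^sup>2)"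
    by (intro summable_add summable_coeff)
  fix n :: nat
  have "2 * cmod (coeff x n) * cmod (coeff y n) \<le> (cmod (coeff x n))\<^sup>2 + (cmod (coeff y n))\<^sup>2"
    by (rule sum_squares_bound)
  moreover have "0 \<le> cmod (coeff x n) * cmod (coeff y n)" by simp
  ultimately show "norm (cnj (coeff x n) * coeff y n) \<le> (cmod (coeff x n))\<^sup>2 + (cmod (coeff y n))\<^sup>2"
    unfolding norm_mult complex_mod_cnj by linarith
qed

lemma ell2_add_closed:
  assumes "summable (\<lambda>n. (cmod (x n))\<^sup>2)" and "summable (\<lambda>n. (cmod (y n))\<^sup>2)"
  shows "summable (\<lambda>n. (cmod (x n + y n))\<^sup>2)"
proof (rule summable_comparison_test')
  show "summable (\<lambda>n. 2 * (cmod (x n))\<^sup>2 + 2 * (cmod (y n))\<^sup>2)"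
    by (intro summable_add summable_mult assms)
  fix n :: nat
  have "(cmod (x n + y n))\<^sup>2 \<le> (cmod (x n) + cmod (y n))\<^sup>2"
    by (intro power_mono norm_triangle_ineq) simp
  also have "\<dots> \<le> 2 * (cmod (x n))\<^sup>2 + 2 * (cmod (y n))\<^sup>2"
    using sum_squares_bound[of "cmod (x n)" "cmod (y n)"] by (simp add: power2_sum)
  finally show "norm ((cmod (x n + y n))\<^sup>2) \<le> 2 * (cmod (x n))\<^sup>2 + 2 * (cmod (y n))\<^sup>2" by simp
qed

lemma ell2_scale_closed:
  assumes "summable (\<lambda>n. (cmod (x n))\<^sup>2)"
  shows "summable (\<lambda>n. (cmod (c * x n))\<^sup>2)"
  using summable_mult[OF assms, of "(cmod c)\<^sup>2"] by (simp add: norm_mult power_mult_distrib)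

lift_definition scaleC :: "complex \<Rightarrow> ell2 \<Rightarrow> ell2" is "\<lambda>c x n. c * x n"
  by (rule ell2_scale_closed)

definition cinner :: "ell2 \<Rightarrow> ell2 \<Rightarrow> complex" where
  "cinner x y = (\<Sum>n. cnj (coeff x n) * coeff y n)"

instantiation ell2 :: real_vector
begin

lift_definition zero_ell2 :: ell2 is "\<lambda>_. 0" by simp
lift_definition plus_ell2 :: "ell2 \<Rightarrow> ell2 \<Rightarrow> ell2" is "\<lambda>x y n. x n + y n"
  by (rule ell2_add_closed)
lift_definition uminus_ell2 :: "ell2 \<Rightarrow> ell2" is "\<lambda>x n. - x n" by simp
lift_definition minus_ell2 :: "ell2 \<Rightarrow> ell2 \<Rightarrow> ell2" is "\<lambda>x y n. x n - y n"
proof -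
  fix x y :: "nat \<Rightarrow> complex"
  assume "summable (\<lambda>n. (cmod (x n))\<^sup>2)" "summable (\<lambda>n. (cmod (y n))\<^sup>2)"
  then show "summable (\<lambda>n. (cmod (x n - y n))\<^sup>2)"
    using ell2_add_closed[of x "\<lambda>n. - y n"] by simp
qed
lift_definition scaleR_ell2 :: "real \<Rightarrow> ell2 \<Rightarrow> ell2" is "\<lambda>r x n. complex_of_real r * x n"
  by (rule ell2_scale_closed)

instance
proof
  fix x y z :: ell2 and r s :: real
  show "x + y + z = x + (y + z)" "x + y = y + x" "0 + x = x" "- x + x = 0" "x - y = x + - y"
    by (transfer, simp add: add_ac)+
  show "r *\<^sub>R (x + y) = r *\<^sub>R x + r *\<^sub>R y" "(r + s) *\<^sub>R x = r *\<^sub>R x + s *\<^sub>R x"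
    "r *\<^sub>R s *\<^sub>R x = (r * s) *\<^sub>R x" "1 *\<^sub>R x = x"
    by (transfer, simp add: algebra_simps)+
qed

end

instantiation ell2 :: real_inner
begin

definition inner_ell2 :: "ell2 \<Rightarrow> ell2 \<Rightarrow> real" where
  "inner_ell2 x y = Re (cinner x y)"
definition norm_ell2 :: "ell2 \<Rightarrow> real" where
  "norm_ell2 x = sqrt (inner x x)"
definition dist_ell2 :: "ell2 \<Rightarrow> ell2 \<Rightarrow> real" where
  "dist_ell2 x y = norm (x - y)"
definition sgn_ell2 :: "ell2 \<Rightarrow> ell2" where
  "sgn_ell2 x = x /\<^sub>R norm x"
definition uniformity_ell2 :: "(ell2 \<times> ell2) filter" where
  "uniformity_ell2 = (INF e\<in>{0<..}. principal {(x, y). dist x y < e})"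
definition open_ell2 :: "ell2 set \<Rightarrow> bool" where
  "open_ell2 U \<longleftrightarrow> (\<forall>x\<in>U. \<forall>\<^sub>F (x', y) in uniformity. x' = x \<longrightarrow> y \<in> U)"

lemma inner_ell2_sum: "inner x (y::ell2) = (\<Sum>n. Re (cnj (coeff x n) * coeff y n))"
  unfolding inner_ell2_def cinner_def by (rule Re_suminf) (rule summable_coeff_mult)

lemma inner_ell2_self: "inner x (x::ell2) = (\<Sum>n. (cmod (coeff x n))\<^sup>2)"
  unfolding inner_ell2_sum
  by (rule arg_cong[where f = suminf]) (simp add: fun_eq_iff cmod_power2, simp add: power2_eq_square)

instance
proof
  fix x y z :: ell2 and r :: real
  show "dist x y = norm (x - y)" by (rule dist_ell2_def)
  show "sgn x = x /\<^sub>R norm x" by (rule sgn_ell2_def)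
  show "uniformity = (INF e\<in>{0<..}. principal {(x, y :: ell2). dist x y < e})"
    by (rule uniformity_ell2_def)
  show "open U \<longleftrightarrow> (\<forall>x\<in>U. \<forall>\<^sub>F (x', y) in uniformity. x' = x \<longrightarrow> y \<in> U)" for U :: "ell2 set"
    by (rule open_ell2_def)
  show "norm x = sqrt (inner x x)" by (rule norm_ell2_def)
  have sm: "summable (\<lambda>n. Re (cnj (coeff u n) * coeff v n))" for u v
    by (rule summable_Re) (rule summable_coeff_mult)
  show "inner x y = inner y x"
    unfolding inner_ell2_sum by (rule arg_cong[where f = suminf]) (auto simp: fun_eq_iff)
  show "inner (x + y) z = inner x z + inner y z"
    unfolding inner_ell2_sum suminf_add[OF sm sm] plus_ell2.rep_eq
    by (rule arg_cong[where f = suminf]) (auto simp: fun_eq_iff algebra_simps)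
  show "inner (r *\<^sub>R x) y = r * inner x y"
    unfolding inner_ell2_sum suminf_mult[OF sm, symmetric] scaleR_ell2.rep_eq
    by (rule arg_cong[where f = suminf]) (auto simp: fun_eq_iff algebra_simps)
  show "0 \<le> inner x x"
    unfolding inner_ell2_self by (rule suminf_nonneg[OF summable_coeff]) simp
  show "inner x x = 0 \<longleftrightarrow> x = 0"
  proof -
    have "(\<Sum>n. (cmod (coeff x n))\<^sup>2) = 0 \<longleftrightarrow> (\<forall>n. (cmod (coeff x n))\<^sup>2 = 0)"
      by (rule suminf_eq_zero_iff[OF summable_coeff]) simp
    then show ?thesis
      unfolding inner_ell2_self by (auto simp: coeff_inject[symmetric] zero_ell2.rep_eq fun_eq_iff)
  qed
qed

end

lemma norm_ell2_sq: "(norm (x::ell2))\<^sup>2 = (\<Sum>n. (cmod (coeff x n))\<^sup>2)"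
  by (simp add: power2_norm_eq_inner inner_ell2_self)

lemma sum_coeff_le: "(\<Sum>n<k. (cmod (coeff x n))\<^sup>2) \<le> (norm x)\<^sup>2"
  unfolding norm_ell2_sq by (rule sum_le_suminf[OF summable_coeff]) auto

instance ell2 :: complete_space
proof
  fix X :: "nat \<Rightarrow> ell2"
  assume X: "Cauchy X"
  have coeff_le: "cmod (coeff x n) \<le> norm x" for x n
  proof -
    have "(cmod (coeff x n))\<^sup>2 \<le> (\<Sum>k<Suc n. (cmod (coeff x k))\<^sup>2)"
      by (rule member_le_sum) auto
    also have "\<dots> \<le> (norm x)\<^sup>2" by (rule sum_coeff_le)
    finally show ?thesis by (rule power2_le_imp_le) simp
  qed
  have "Cauchy (\<lambda>i. coeff (X i) n)" for n
  proof (rule metric_CauchyI)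
    fix e :: real assume "0 < e"
    then obtain M where M: "\<And>i j. i \<ge> M \<Longrightarrow> j \<ge> M \<Longrightarrow> dist (X i) (X j) < e"
      using metric_CauchyD[OF X] by blast
    have "dist (coeff (X i) n) (coeff (X j) n) \<le> dist (X i) (X j)" for i j
      using coeff_le[of "X i - X j" n] by (simp add: dist_norm minus_ell2.rep_eq)
    then show "\<exists>M. \<forall>i\<ge>M. \<forall>j\<ge>M. dist (coeff (X i) n) (coeff (X j) n) < e"
      using M by (meson le_less_trans)
  qed
  then have "\<forall>n. \<exists>l. (\<lambda>i. coeff (X i) n) \<longlonglongrightarrow> l"
    by (simp add: Cauchy_convergent_iff convergent_def)
  then obtain L where L: "\<And>n. (\<lambda>i. coeff (X i) n) \<longlonglongrightarrow> L n" by metis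
  have bound: "(\<Sum>n<k. (cmod (coeff (X i) n - L n))\<^sup>2) \<le> e\<^sup>2"
    if M: "\<forall>i\<ge>M. \<forall>j\<ge>M. dist (X i) (X j) < e" and i: "i \<ge> M" for M e i k
  proof (rule LIMSEQ_le_const2)
    show "(\<lambda>j. \<Sum>n<k. (cmod (coeff (X i) n - coeff (X j) n))\<^sup>2)
        \<longlonglongrightarrow> (\<Sum>n<k. (cmod (coeff (X i) n - L n))\<^sup>2)"
      by (intro tendsto_intros L)
    have "(\<Sum>n<k. (cmod (coeff (X i) n - coeff (X j) n))\<^sup>2) \<le> e\<^sup>2" if "j \<ge> M" for j
    proof -
      have "(\<Sum>n<k. (cmod (coeff (X i) n - coeff (X j) n))\<^sup>2) \<le> (norm (X i - X j))\<^sup>2"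
        using sum_coeff_le[of "X i - X j" k] by (simp add: minus_ell2.rep_eq)
      also have "\<dots> \<le> e\<^sup>2"
        using M i that by (intro power_mono) (auto simp: dist_norm intro: less_imp_le)
      finally show ?thesis .
    qed
    then show "\<exists>N. \<forall>j\<ge>N. (\<Sum>n<k. (cmod (coeff (X i) n - coeff (X j) n))\<^sup>2) \<le> e\<^sup>2" by blast
  qed
  have sm: "summable (\<lambda>n. (cmod (coeff (X i) n - L n))\<^sup>2)"
    if "\<forall>i\<ge>M. \<forall>j\<ge>M. dist (X i) (X j) < e" "i \<ge> M" for M e i
    by (rule summableI_nonneg_bounded[where x = "e\<^sup>2"]) (use bound[OF that] in auto)
  obtain M1 where M1: "\<forall>i\<ge>M1. \<forall>j\<ge>M1. dist (X i) (X j) < 1"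
    using metric_CauchyD[OF X, of 1] by auto
  have "summable (\<lambda>n. (cmod (coeff (X M1) n + - (coeff (X M1) n - L n)))\<^sup>2)"
    using sm[OF M1, of M1] by (intro ell2_add_closed summable_coeff) (simp add: norm_minus_commute)
  then have Lsum: "summable (\<lambda>n. (cmod (L n))\<^sup>2)" by simp
  have "X \<longlonglongrightarrow> Abs_ell2 L"
  proof (rule metric_LIMSEQ_I)
    fix r :: real assume "0 < r"
    then obtain M where M: "\<forall>i\<ge>M. \<forall>j\<ge>M. dist (X i) (X j) < r / 2"
      using metric_CauchyD[OF X, of "r / 2"] by auto
    have "dist (X i) (Abs_ell2 L) < r" if i: "i \<ge> M" for i
    proof -
      have "(norm (X i - Abs_ell2 L))\<^sup>2 \<le> (r / 2)\<^sup>2"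
        unfolding norm_ell2_sq
        using suminf_le_const[OF sm[OF M i] bound[OF M i]] Lsum
        by (simp add: minus_ell2.rep_eq Abs_ell2_inverse)
      then have "norm (X i - Abs_ell2 L) \<le> r / 2"
        by (rule power2_le_imp_le) (use \<open>0 < r\<close> in simp)
      then show ?thesis using \<open>0 < r\<close> by (simp add: dist_norm)
    qed
    then show "\<exists>M. \<forall>i\<ge>M. dist (X i) (Abs_ell2 L) < r" by blast
  qed
  then show "convergent X" by (auto simp: convergent_def)
qed

lemma norm_scaleC: "norm (scaleC c x) = cmod c * norm x"
proof -
  have "(norm (scaleC c x))\<^sup>2 = (cmod c)\<^sup>2 * (norm x)\<^sup>2"
    unfolding norm_ell2_sq
    by (simp add: scaleC.rep_eq norm_mult power_mult_distrib suminf_mult[OF summable_coeff])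
  then show ?thesis
    by (metis norm_ge_zero mult_nonneg_nonneg power2_eq_imp_eq power_mult_distrib)
qed

lemma bounded_linear_scaleC: "bounded_linear (scaleC c)"
proof (rule bounded_linear_intro)
  show "scaleC c (x + y) = scaleC c x + scaleC c y" for x y
    by transfer (simp add: algebra_simps)
  show "scaleC c (r *\<^sub>R x) = r *\<^sub>R scaleC c x" for r x
    by transfer (simp add: algebra_simps)
  show "norm (scaleC c x) \<le> norm x * cmod c" for x
    by (simp add: norm_scaleC)
qed


section \<open>Von Neumann algebras and tracial W*-algebras\<close>

text \<open>The type \<open>ell2 \<Rightarrow>\<^sub>L ell2\<close> consists of the bounded \<^emph>\<open>real\<close>-linear maps; the operators
  of \<open>B(\<ell>\<^sup>2)\<close> are those that are also complex-linear.\<close>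

type_synonym op = "ell2 \<Rightarrow>\<^sub>L ell2"

definition complex_linear_op :: "op \<Rightarrow> bool" where
  "complex_linear_op T \<longleftrightarrow> (\<forall>c x. T (scaleC c x) = scaleC c (T x))"

definition op_scaleC :: "complex \<Rightarrow> op \<Rightarrow> op" where
  "op_scaleC c T = Blinfun (scaleC c) o\<^sub>L T"

lemma op_scaleC_apply: "op_scaleC c T x = scaleC c (T x)"
  by (simp add: op_scaleC_def bounded_linear_Blinfun_apply bounded_linear_scaleC)

definition op_adj :: "op \<Rightarrow> op" where
  "op_adj T = (THE S :: op. \<forall>x y. cinner (S x) y = cinner x (T y))"

definition weak_operator_topology :: "op topology" where
  "weak_operator_topology =
     topology_generated_by {{T. cinner x (blinfun_apply T y) \<in> U} | x y U. open U}"

definition sigma_weak_topology :: "op topology" where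
  "sigma_weak_topology =
     topology_generated_by {{T. (\<Sum>n. cinner (x n) (blinfun_apply T (y n))) \<in> U} | x y U.
       summable (\<lambda>n. (norm (x n :: ell2))\<^sup>2) \<and> summable (\<lambda>n. (norm (y n :: ell2))\<^sup>2) \<and> open U}"

definition von_neumann_algebra :: "op set \<Rightarrow> bool" where
  "von_neumann_algebra M \<longleftrightarrow>
     (\<forall>a\<in>M. complex_linear_op a) \<and>
     id_blinfun \<in> M \<and>
     (\<forall>a\<in>M. \<forall>b\<in>M. a + b \<in> M \<and> a o\<^sub>L b \<in> M) \<and>
     (\<forall>c. \<forall>a\<in>M. op_scaleC c a \<in> M) \<and>
     (\<forall>a\<in>M. op_adj a \<in> M) \<and>
     closedin weak_operator_topology M"

definition complex_linear_functional :: "op set \<Rightarrow> (op \<Rightarrow> complex) \<Rightarrow> bool" where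
  "complex_linear_functional M \<phi> \<longleftrightarrow>
     (\<forall>a\<in>M. \<forall>b\<in>M. \<phi> (a + b) = \<phi> a + \<phi> b) \<and> (\<forall>c. \<forall>a\<in>M. \<phi> (op_scaleC c a) = c * \<phi> a)"

text \<open>Functionals are only considered on \<open>M\<close>; their values elsewhere are irrelevant.\<close>

definition predual :: "op set \<Rightarrow> (op \<Rightarrow> complex) set" where
  "predual M = {\<phi>. complex_linear_functional M \<phi> \<and>
                   continuous_map (subtopology sigma_weak_topology M) euclidean \<phi>}"

definition separable_predual :: "op set \<Rightarrow> bool" where
  "separable_predual M \<longleftrightarrow>
     (\<exists>D. countable D \<and> D \<subseteq> predual M \<and>
        (\<forall>\<phi>\<in>predual M. \<forall>\<epsilon>>0. \<exists>\<psi>\<in>D. \<forall>a\<in>M. norm a \<le> 1 \<longrightarrow> cmod (\<phi> a - \<psi> a) \<le> \<epsilon>))"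

definition faithful_normal_tracial_state :: "op set \<Rightarrow> (op \<Rightarrow> complex) \<Rightarrow> bool" where
  "faithful_normal_tracial_state M \<tau> \<longleftrightarrow>
     \<tau> \<in> predual M \<and>
     (\<forall>a\<in>M. \<tau> (op_adj a o\<^sub>L a) \<in> \<real> \<and> 0 \<le> Re (\<tau> (op_adj a o\<^sub>L a))) \<and>
     \<tau> id_blinfun = 1 \<and>
     (\<forall>a\<in>M. \<forall>b\<in>M. \<tau> (a o\<^sub>L b) = \<tau> (b o\<^sub>L a)) \<and>
     (\<forall>a\<in>M. \<tau> (op_adj a o\<^sub>L a) = 0 \<longrightarrow> a = 0)"

text \<open>A tracial W*-algebra comes with a chosen model of the completion of \<open>L\<^sup>\<infinity>\<close> under
  \<open>\<langle>a, b\<rangle> = \<tau>(a\<^sup>* b)\<close>: an isometric linear map \<open>l2\<close> into the complete space \<^typ>\<open>ell2\<close>, the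
  completion being the closure of its range.  Completions are unique up to a unique unitary
  compatible with \<open>l2\<close>, and the isomorphism relation below does not depend on \<open>l2\<close>.
  Every von Neumann algebra with separable predual has a faithful normal unital representation
  on \<^typ>\<open>ell2\<close>, and then its \<open>L\<^sup>2\<close>-space is separable and hence embeds isometrically into
  \<^typ>\<open>ell2\<close>; so up to isomorphism all of them occur here.\<close>

record tracial_algebra =
  Linf :: "op set"
  trace :: "op \<Rightarrow> complex"
  l2 :: "op \<Rightarrow> ell2"

definition tracial_wstar_algebra :: "tracial_algebra \<Rightarrow> bool" where
  "tracial_wstar_algebra A \<longleftrightarrow>
     von_neumann_algebra (Linf A) \<and>
     faithful_normal_tracial_state (Linf A) (trace A) \<and>
     (\<forall>a\<in>Linf A. \<forall>b\<in>Linf A. l2 A (a + b) = l2 A a + l2 A b) \<and>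
     (\<forall>c. \<forall>a\<in>Linf A. l2 A (op_scaleC c a) = scaleC c (l2 A a)) \<and>
     (\<forall>a\<in>Linf A. \<forall>b\<in>Linf A. cinner (l2 A a) (l2 A b) = trace A (op_adj a o\<^sub>L b))"

definition L2 :: "tracial_algebra \<Rightarrow> ell2 set" where
  "L2 A = closure (l2 A ` Linf A)"

text \<open>\<open>l2_extend A B \<phi>\<close> is the extension by continuity of a \<open>2\<close>-norm isometric map
  \<open>\<phi> : L\<^sup>\<infinity>(A) \<rightarrow> L\<^sup>\<infinity>(B)\<close> to a map \<open>L\<^sup>2(A) \<rightarrow> L\<^sup>2(B)\<close>.\<close>

definition l2_extend :: "tracial_algebra \<Rightarrow> tracial_algebra \<Rightarrow> (op \<Rightarrow> op) \<Rightarrow> ell2 \<Rightarrow> ell2" where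
  "l2_extend A B \<phi> \<xi> = (THE \<eta>. \<exists>a. (\<forall>n::nat. a n \<in> Linf A) \<and>
      (\<lambda>n. l2 A (a n)) \<longlonglongrightarrow> \<xi> \<and> (\<lambda>n. l2 B (\<phi> (a n))) \<longlonglongrightarrow> \<eta>)"

definition L2_sa :: "tracial_algebra \<Rightarrow> ell2 set" where
  "L2_sa A = {\<xi> \<in> L2 A. l2_extend A A op_adj \<xi> = \<xi>}"

text \<open>An \<open>m\<close>-tuple is a vector \<^typ>\<open>ell2 ^ 'n\<close> with \<^term>\<open>CARD('n)\<close> equal to \<open>m\<close>.  The real inner
  product of this type is the sum over the entries of the real part of \<^const>\<open>cinner\<close>, and
  \<^const>\<open>cinner\<close> is already real-valued on \<^const>\<open>L2_sa\<close>.\<close>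

definition tuples :: "tracial_algebra \<Rightarrow> (ell2 ^ 'n) set" where
  "tuples A = {X. \<forall>j. X $ j \<in> L2_sa A}"

definition tracial_embedding :: "tracial_algebra \<Rightarrow> tracial_algebra \<Rightarrow> (op \<Rightarrow> op) \<Rightarrow> bool" where
  "tracial_embedding A B \<iota> \<longleftrightarrow>
     (\<forall>a\<in>Linf A. \<iota> a \<in> Linf B) \<and>
     (\<forall>a\<in>Linf A. \<forall>b\<in>Linf A. \<iota> (a + b) = \<iota> a + \<iota> b \<and> \<iota> (a o\<^sub>L b) = \<iota> a o\<^sub>L \<iota> b) \<and>
     (\<forall>c. \<forall>a\<in>Linf A. \<iota> (op_scaleC c a) = op_scaleC c (\<iota> a)) \<and>
     (\<forall>a\<in>Linf A. \<iota> (op_adj a) = op_adj (\<iota> a)) \<and>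
     \<iota> id_blinfun = id_blinfun \<and>
     (\<forall>a\<in>Linf A. trace B (\<iota> a) = trace A a)"

definition tracial_isomorphic :: "tracial_algebra \<Rightarrow> tracial_algebra \<Rightarrow> bool" where
  "tracial_isomorphic A B \<longleftrightarrow> (\<exists>\<iota>. tracial_embedding A B \<iota> \<and> bij_betw \<iota> (Linf A) (Linf B))"

definition representatives :: "tracial_algebra set \<Rightarrow> bool" where
  "representatives W \<longleftrightarrow>
     (\<forall>A\<in>W. tracial_wstar_algebra A \<and> separable_predual (Linf A)) \<and>
     (\<forall>A. tracial_wstar_algebra A \<and> separable_predual (Linf A) \<longrightarrow> (\<exists>!B. B \<in> W \<and> tracial_isomorphic A B))"

definition embed :: "tracial_algebra \<Rightarrow> tracial_algebra \<Rightarrow> (op \<Rightarrow> op) \<Rightarrow> ell2 ^ 'n \<Rightarrow> ell2 ^ 'n" where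
  "embed A B \<iota> X = (\<chi> j. l2_extend A B \<iota> (X $ j))"

text \<open>The conditional expectation \<open>L\<^sup>2(B) \<rightarrow> L\<^sup>2(A)\<close> is the Hilbert space adjoint of the isometry
  \<open>L\<^sup>2(A) \<rightarrow> L\<^sup>2(B)\<close> given by an embedding.\<close>

definition l2_cond_exp :: "tracial_algebra \<Rightarrow> tracial_algebra \<Rightarrow> (op \<Rightarrow> op) \<Rightarrow> ell2 \<Rightarrow> ell2" where
  "l2_cond_exp A B \<iota> \<eta> =
     (THE \<zeta>. \<zeta> \<in> L2 A \<and> (\<forall>\<xi>\<in>L2 A. cinner \<zeta> \<xi> = cinner \<eta> (l2_extend A B \<iota> \<xi>)))"

definition cond_exp :: "tracial_algebra \<Rightarrow> tracial_algebra \<Rightarrow> (op \<Rightarrow> op) \<Rightarrow> ell2 ^ 'n \<Rightarrow> ell2 ^ 'n" where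
  "cond_exp A B \<iota> X = (\<chi> j. l2_cond_exp A B \<iota> (X $ j))"


section \<open>Tracial W*-functions\<close>

text \<open>Only the values \<open>f A X\<close> with \<open>A \<in> W\<close> and \<open>X \<in> tuples A\<close> are meaningful.\<close>

type_synonym 'n wfun = "tracial_algebra \<Rightarrow> ell2 ^ 'n \<Rightarrow> ereal"

definition wfun_eq :: "tracial_algebra set \<Rightarrow> ('n::finite) wfun \<Rightarrow> 'n wfun \<Rightarrow> bool" where
  "wfun_eq W f g \<longleftrightarrow> (\<forall>A\<in>W. \<forall>X\<in>tuples A. f A X = g A X)"

definition tracial_function :: "tracial_algebra set \<Rightarrow> ('n::finite) wfun \<Rightarrow> bool" where
  "tracial_function W f \<longleftrightarrow>
     (\<forall>A\<in>W. \<forall>B\<in>W. \<forall>\<iota>. tracial_embedding A B \<iota> \<longrightarrow> (\<forall>X\<in>tuples A. f A X = f B (embed A B \<iota> X)))"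

definition ereal_convex_on :: "'a::real_vector set \<Rightarrow> ('a \<Rightarrow> ereal) \<Rightarrow> bool" where
  "ereal_convex_on S \<phi> \<longleftrightarrow>
     (\<forall>x\<in>S. \<forall>y\<in>S. \<forall>r. 0 < r \<and> r < 1 \<longrightarrow>
        \<phi> ((1 - r) *\<^sub>R x + r *\<^sub>R y) \<le> ereal (1 - r) * \<phi> x + ereal r * \<phi> y)"

definition lsc_on :: "'a::topological_space set \<Rightarrow> ('a \<Rightarrow> ereal) \<Rightarrow> bool" where
  "lsc_on S \<phi> \<longleftrightarrow> (\<forall>x\<in>S. \<phi> x \<le> Liminf (at x within S) \<phi>)"

definition E_convex :: "tracial_algebra set \<Rightarrow> ('n::finite) wfun \<Rightarrow> bool" where
  "E_convex W f \<longleftrightarrow> tracial_function W f \<and>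
     ((\<forall>A\<in>W. \<forall>X\<in>tuples A. f A X = -\<infinity>) \<or>
      ((\<forall>A\<in>W. ereal_convex_on (tuples A) (f A) \<and> lsc_on (tuples A) (f A) \<and>
               (\<forall>X\<in>tuples A. f A X \<noteq> -\<infinity>)) \<and>
       (\<forall>A\<in>W. \<forall>B\<in>W. \<forall>\<iota>. tracial_embedding A B \<iota> \<longrightarrow>
          (\<forall>X\<in>tuples B. f A (cond_exp A B \<iota> X) \<le> f B X))))"

definition q1 :: "('n::finite) wfun" where
  "q1 A X = ereal ((norm X)\<^sup>2 / 2)"

definition legendre :: "tracial_algebra set \<Rightarrow> ('n::finite) wfun \<Rightarrow> 'n wfun" where
  "legendre W f A X = Sup {ereal (inner (embed A B \<iota> X) Y) - f B Y | B \<iota> Y.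
     B \<in> W \<and> tracial_embedding A B \<iota> \<and> Y \<in> tuples B}"

definition inf_convolution ::
    "tracial_algebra set \<Rightarrow> ('n::finite) wfun \<Rightarrow> 'n wfun \<Rightarrow> 'n wfun" where
  "inf_convolution W f g A X = Inf {f B (embed A B \<iota> X - Y) + g B Y | B \<iota> Y.
     B \<in> W \<and> tracial_embedding A B \<iota> \<and> Y \<in> tuples B}"

definition subdiff :: "'a::real_inner set \<Rightarrow> ('a \<Rightarrow> ereal) \<Rightarrow> 'a \<Rightarrow> 'a set" where
  "subdiff H \<phi> x = {y \<in> H. \<forall>x'\<in>H. \<phi> x' \<ge> \<phi> x + ereal (inner y (x' - x))}"

definition grad :: "'a::real_inner set \<Rightarrow> ('a \<Rightarrow> ereal) \<Rightarrow> 'a \<Rightarrow> 'a" where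
  "grad H \<phi> x = (THE y. y \<in> subdiff H \<phi> x)"

text \<open>The two formulas for \<open>s > 0\<close> share the expression below.  The convention \<open>0 \<cdot> (\<plusminus>\<infinity>) = 0\<close> is
  that of \<^typ>\<open>ereal\<close>.\<close>

definition interp_term :: "('n::finite) wfun \<Rightarrow> real \<Rightarrow> real \<Rightarrow>
    tracial_algebra \<Rightarrow> ell2 ^ 'n \<Rightarrow> ell2 ^ 'n \<Rightarrow> ereal" where
  "interp_term f t s A X Y =
     ereal (t / (2 * s) * (norm X)\<^sup>2 - (t - s) / s * inner X Y
            + (t - s) * (1 - s) / (2 * s) * (norm Y)\<^sup>2)
     + ereal (t - s) * f A Y"

definition interp_zero :: "('n::finite) wfun \<Rightarrow> real \<Rightarrow> 'n wfun" where
  "interp_zero f t A X = ereal (1 - t) * q1 A X + ereal t * f A X"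

definition interp_inf :: "('n::finite) wfun \<Rightarrow> real \<Rightarrow> real \<Rightarrow> 'n wfun" where
  "interp_inf f t s A X = (INF Y\<in>tuples A. interp_term f t s A X Y)"

definition interp_sup :: "('n::finite) wfun \<Rightarrow> real \<Rightarrow> real \<Rightarrow> 'n wfun" where
  "interp_sup f t s A X = (SUP Y\<in>tuples A. interp_term f t s A X Y)"

text \<open>The defining clauses overlap for \<open>t = 0\<close> and for \<open>s = t\<close>; \<open>interp\<close> gives priority to
  the earlier clauses.\<close>

definition interp :: "tracial_algebra set \<Rightarrow> ('n::finite) wfun \<Rightarrow> real \<Rightarrow> real \<Rightarrow> 'n wfun" where
  "interp W f t s =
     (if s = 0 then interp_zero f t
      else if t = 0 then legendre W (interp_zero f s)
      else if s \<le> t then interp_inf f t s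
      else interp_sup f t s)"

end

theory Submission
  imports Defs
begin

text \<open>Completing squares gives \<open>f\<^sub>t\<^sub>,\<^sub>s = (t/s) q\<^sub>1 + ((s - t)/s) g\<^sub>s\<close> for \<open>s > 0\<close>, where \<open>g\<^sub>s\<close> is the Legendre
  transform of \<open>(1 - s) q\<^sub>1 + s f\<close>.  \<open>E\<close>-convexity reduces Legendre transforms and inf-convolutions
  to a single algebra.  For \<open>s < 1\<close> the function \<open>k\<^sub>s = q\<^sub>1/(1 - s) - g\<^sub>s\<close> is \<open>E\<close>-convex too, being a Moreau
  envelope, and every function in (1)--(3) is a nonnegative combination of \<open>q\<^sub>1\<close> with one of \<open>f\<close>, \<open>g\<^sub>s\<close>, \<open>k\<^sub>s\<close>.
  The gradients are computed from Minty's theorem: each \<open>X\<close> is \<open>(1 - s) p + s z\<close> with \<open>z \<in> \<eth>f(p)\<close>, and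
  then \<open>\<nabla>f\<^sub>t\<^sub>,\<^sub>s X = (1 - t) p + t z\<close>.\<close>

section \<open>Convex functions on a closed subspace of a Hilbert space\<close>

text \<open>Existence arguments all rest on \<open>minty\<close>: it gives the biconjugation
  theorem, the resolvents, and, applied to a linear functional, a Riesz theorem that yields operator
  adjoints and conditional expectations. Everything is stated relative to a closed real subspace
  \<open>S\<close>, because the self-adjoint tuples of an algebra are only a subset of the ambient
  type \<open>ell2 ^ 'n\<close>. Two obstacles shape the rest. One is that \<open>f\<close> may be
  constantly \<open>\<infinity>\<close> or \<open>-\<infinity>\<close>. Identities in
  \<open>f\<close> therefore have to hold in \<open>ereal\<close>, where multiplication by a factor
  depends on its sign, and finiteness in one algebra has to be carried to every other one; the
  scalars, which embed everywhere, do this. The other is that \<open>k s\<close> is a difference of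
  \<open>E\<close>-convex functions. Its monotonicity under conditional expectation comes from the
  contraction \<open>E\<close> acting on \<open>X - (1 - s) Y\<close>, and its convexity from an
  explicit supporting affine function at each point.\<close>

text \<open>The filter \<open>at x within S\<close> omits \<open>x\<close> itself, while the
  right-hand side admits \<open>y = x\<close>; at that point the required inequality is the
  assumption \<open>c < \<phi> x\<close>.\<close>

lemma lsc_on_iff:
  fixes S :: "'a::metric_space set"
  shows "lsc_on S \<phi> \<longleftrightarrow> (\<forall>x\<in>S. \<forall>c<\<phi> x. \<exists>d>0. \<forall>y\<in>S. dist y x < d \<longrightarrow> c < \<phi> y)"
  unfolding lsc_on_def le_Liminf_iff eventually_at
  by (rule ball_cong[OF refl], rule all_cong, rule ex_cong1) auto

lemma lsc_onD:
  fixes S :: "'a::metric_space set"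
  assumes "lsc_on S \<phi>" "x \<in> S" "c < \<phi> x"
  obtains d where "d > 0" "\<And>y. y \<in> S \<Longrightarrow> dist y x < d \<Longrightarrow> c < \<phi> y"
  using assms unfolding lsc_on_iff by blast

text \<open>A downward cone suffices to bound the functional minimised in \<open>minty\<close>.
  Lower semicontinuity bounds \<open>\<phi>\<close> below on a ball around \<open>x0\<close>;
  convexity along the segment from \<open>x0\<close> carries the bound outside the ball, with slope
  \<open>2 / d\<close>.\<close>

lemma affine_minorant:
  fixes S :: "'a::real_inner set"
  assumes S: "subspace S" and conv: "ereal_convex_on S \<phi>" and lsc: "lsc_on S \<phi>"
    and x0: "x0 \<in> S" and fin: "\<bar>\<phi> x0\<bar> \<noteq> \<infinity>" and ninf: "\<And>x. x \<in> S \<Longrightarrow> \<phi> x \<noteq> -\<infinity>"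
  shows "\<exists>c k. k \<ge> 0 \<and> (\<forall>y\<in>S. ereal (c - k * norm y) \<le> \<phi> y)"
proof -
  obtain a where a: "\<phi> x0 = ereal a" using fin by auto
  have "ereal (a - 1) < \<phi> x0" by (simp add: a)
  then obtain d where d: "d > 0" and dl: "\<And>y. y \<in> S \<Longrightarrow> dist y x0 < d \<Longrightarrow> ereal (a - 1) < \<phi> y"
    using lsc_onD[OF lsc x0] by blast
  have bnd: "ereal (a - 1 - 2 / d * norm (y - x0)) \<le> \<phi> y" if y: "y \<in> S" for y
  proof (cases "dist y x0 < d")
    case True
    have "ereal (a - 1 - 2 / d * norm (y - x0)) \<le> ereal (a - 1)" using d by simp
    then show ?thesis using dl[OF y True] by (meson less_imp_le order_trans)
  next
    case False
    \<comment> \<open>This \<open>r\<close> puts the point \<open>z\<close> of the segment at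
      distance \<open>d / 2\<close> from \<open>x0\<close>, inside the ball where
      \<open>\<phi>\<close> exceeds \<open>a - 1\<close>.\<close>
    define r where "r = d / (2 * norm (y - x0))"
    have ny: "norm (y - x0) \<ge> d" using False by (simp add: dist_norm)
    have "norm (y - x0) > 0" using ny d by linarith
    then have r: "0 < r" "r < 1" using d ny unfolding r_def by (auto simp: divide_less_eq intro!: divide_pos_pos)
    define z where "z = (1 - r) *\<^sub>R x0 + r *\<^sub>R y"
    have zS: "z \<in> S" unfolding z_def using S x0 y by (intro subspace_add subspace_scale)
    have "z - x0 = r *\<^sub>R (y - x0)" by (simp add: z_def algebra_simps)
    then have "norm (z - x0) = r * norm (y - x0)" using r by simp
    also have "\<dots> = d / 2" using \<open>norm (y - x0) > 0\<close> by (simp add: r_def)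
    finally have "dist z x0 < d" using d by (simp add: dist_norm)
    then have z1: "ereal (a - 1) < \<phi> z" using dl[OF zS] by simp
    have z2: "\<phi> z \<le> ereal (1 - r) * \<phi> x0 + ereal r * \<phi> y"
      using conv x0 y r unfolding ereal_convex_on_def z_def by blast
    show ?thesis
    proof (cases "\<phi> y")
      case (real w)
      from z1 z2 have "ereal (a - 1) < ereal ((1 - r) * a + r * w)"
        unfolding a real times_ereal.simps plus_ereal.simps by (rule less_le_trans)
      then have "a - 1 < (1 - r) * a + r * w" by simp
      then have "r * a - 1 < r * w" by (simp add: algebra_simps)
      then have "a - 1 / r < w" using r by (simp add: field_simps)
      moreover have "1 / r = 2 / d * norm (y - x0)" using d by (simp add: r_def)
      ultimately show ?thesis by (simp add: real)
    qed (use ninf[OF y] in auto)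
  qed
  show ?thesis
  proof (intro exI conjI ballI)
    show "0 \<le> 2 / d" using d by simp
    fix y assume y: "y \<in> S"
    have "norm (y - x0) \<le> norm y + norm x0" by (rule norm_triangle_ineq4)
    then have "2 / d * norm (y - x0) \<le> 2 / d * (norm y + norm x0)"
      using d by (intro mult_left_mono) auto
    then have "ereal (a - 1 - 2 / d * norm x0 - 2 / d * norm y) \<le> ereal (a - 1 - 2 / d * norm (y - x0))"
      by (simp add: distrib_left)
    then show "ereal ((a - 1 - 2 / d * norm x0) - 2 / d * norm y) \<le> \<phi> y"
      using bnd[OF y] order_trans by blast
  qed
qed

lemma parallelogram_midpoint:
  fixes a b x :: "'a::real_inner"
  shows "(norm ((1/2) *\<^sub>R a + (1/2) *\<^sub>R b - x))\<^sup>2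
    = ((norm (a - x))\<^sup>2 + (norm (b - x))\<^sup>2) / 2 - (norm (a - b))\<^sup>2 / 4"
  unfolding power2_norm_eq_inner
  by (simp add: inner_diff_left inner_diff_right inner_add_left inner_add_right
      inner_commute field_simps)

text \<open>Minty's theorem: \<open>p\<close> is the minimiser of \<open>y \<mapsto> \<phi> y + \<parallel>y - x\<parallel>\<^sup>2 / (2\<lambda>)\<close>; by strong
  convexity every minimising sequence is Cauchy.\<close>

lemma minty:
  fixes S :: "'a::{real_inner,complete_space} set"
  assumes S: "subspace S" "closed S" and conv: "ereal_convex_on S \<phi>" and lsc: "lsc_on S \<phi>"
    and x0: "x0 \<in> S" "\<phi> x0 \<noteq> \<infinity>" and ninf: "\<And>x. x \<in> S \<Longrightarrow> \<phi> x \<noteq> -\<infinity>"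
    and l: "l > 0" and x: "x \<in> S"
  obtains p z where "p \<in> S" "z \<in> subdiff S \<phi> p" "\<bar>\<phi> p\<bar> \<noteq> \<infinity>" "x = p + l *\<^sub>R z"
proof -
  have "\<bar>\<phi> x0\<bar> \<noteq> \<infinity>" using x0 ninf[OF x0(1)] by auto
  from affine_minorant[OF S(1) conv lsc x0(1) this ninf] obtain c k where k: "k \<ge> 0"
    and mino: "\<And>y. y \<in> S \<Longrightarrow> ereal (c - k * norm y) \<le> \<phi> y" by blast
  define \<Phi> where "\<Phi> y = \<phi> y + ereal ((norm (y - x))\<^sup>2 / (2 * l))" for y
  define m where "m = (INF y\<in>S. \<Phi> y)"
  \<comment> \<open>Young's inequality: the quadratic term absorbs the linear decay of the cone, at
    the cost of the constant \<open>k\<^sup>2 * l / 2\<close>. Hence the infimum \<open>m\<close> is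
    finite.\<close>
  have lowr: "c - k * norm x - k\<^sup>2 * l / 2 \<le> (c - k * norm y) + (norm (y - x))\<^sup>2 / (2 * l)" for y
  proof -
    let ?r = "norm (y - x)"
    have "norm y \<le> norm x + ?r" by (metis norm_triangle_sub add.commute)
    then have "k * norm y \<le> k * norm x + k * ?r" using k by (metis mult_left_mono distrib_left)
    moreover have "k * ?r \<le> ?r\<^sup>2 / (2 * l) + k\<^sup>2 * l / 2"
    proof -
      have "0 \<le> (?r - k * l)\<^sup>2 / (2 * l)" using l by simp
      also have "\<dots> = ?r\<^sup>2 / (2 * l) + k\<^sup>2 * l / 2 - k * ?r"
        using l by (simp add: power2_diff field_simps power2_eq_square)
      finally show ?thesis by simp
    qed
    ultimately show ?thesis by linarith
  qed
  have "ereal (c - k * norm x - k\<^sup>2 * l / 2) \<le> m"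
    unfolding m_def
  proof (rule INF_greatest)
    fix y assume "y \<in> S"
    have "ereal (c - k * norm x - k\<^sup>2 * l / 2) \<le> ereal (c - k * norm y) + ereal ((norm (y - x))\<^sup>2 / (2 * l))"
      using lowr by simp
    also have "\<dots> \<le> \<Phi> y" unfolding \<Phi>_def by (rule add_right_mono) (rule mino[OF \<open>y \<in> S\<close>])
    finally show "ereal (c - k * norm x - k\<^sup>2 * l / 2) \<le> \<Phi> y" .
  qed
  moreover have "m \<le> \<Phi> x0" unfolding m_def by (rule INF_lower) (rule x0)
  then have "m \<noteq> \<infinity>" using x0 by (auto simp: \<Phi>_def)
  ultimately obtain M where M: "m = ereal M" by (cases m) auto
  have "\<exists>y\<in>S. \<Phi> y < ereal (M + 1 / real (Suc n))" for n
    using Inf_less_iff[of "\<Phi> ` S" "ereal (M + 1 / real (Suc n))"] M unfolding m_def by simp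
  then obtain ys where ysS: "\<And>n. ys n \<in> S" and ys: "\<And>n. \<Phi> (ys n) < ereal (M + 1 / real (Suc n))"
    by metis
  have "\<exists>v. \<phi> (ys n) = ereal v" for n
    using ys[of n] ninf[OF ysS[of n]] unfolding \<Phi>_def by (cases "\<phi> (ys n)") auto
  then obtain v where v: "\<And>n. \<phi> (ys n) = ereal (v n)" by metis
  have vb: "v n + (norm (ys n - x))\<^sup>2 / (2 * l) < M + 1 / real (Suc n)" for n
    using ys[of n] unfolding \<Phi>_def v by simp
  have Mlow: "ereal M \<le> \<Phi> y" if "y \<in> S" for y using that unfolding M[symmetric] m_def by (rule INF_lower)
  have halves: "C \<le> (E + F) / 2" if "M \<le> A / 2 + B / 2 - C" "A < M + E" "B < M + F" for A B C E F :: real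
    using that by (simp add: field_simps)
  \<comment> \<open>The midpoint of two almost-minimisers lies below the average of their values by
    the parallelogram term, but not below \<open>M\<close>; so that term, and with it the distance,
    is small.\<close>
  have cau: "(norm (ys n - ys j))\<^sup>2 \<le> 4 * l * (1 / real (Suc n) + 1 / real (Suc j))" for n j
  proof -
    let ?w = "(1/2) *\<^sub>R ys n + (1/2) *\<^sub>R ys j"
    have wS: "?w \<in> S" using S ysS by (intro subspace_add subspace_scale)
    have "\<phi> ((1 - 1/2) *\<^sub>R ys n + (1/2) *\<^sub>R ys j) \<le> ereal (1 - 1/2) * \<phi> (ys n) + ereal (1/2) * \<phi> (ys j)"
      by (rule conv[unfolded ereal_convex_on_def, rule_format, OF ysS ysS]) simp
    then have "\<phi> ?w \<le> ereal ((v n + v j) / 2)" unfolding v by (simp add: field_simps)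
    then have "\<Phi> ?w \<le> ereal ((v n + v j) / 2) + ereal ((norm (?w - x))\<^sup>2 / (2 * l))"
      unfolding \<Phi>_def by (rule add_right_mono)
    with Mlow[OF wS] have "ereal M \<le> ereal ((v n + v j) / 2 + (norm (?w - x))\<^sup>2 / (2 * l))"
      using order_trans by fastforce
    then have "M \<le> (v n + v j) / 2 + (norm (?w - x))\<^sup>2 / (2 * l)" by simp
    also have "\<dots> = (v n + (norm (ys n - x))\<^sup>2 / (2 * l)) / 2 + (v j + (norm (ys j - x))\<^sup>2 / (2 * l)) / 2
        - (norm (ys n - ys j))\<^sup>2 / (8 * l)"
      unfolding parallelogram_midpoint using l by (simp add: field_simps)
    finally have "(norm (ys n - ys j))\<^sup>2 / (8 * l) \<le> (1 / real (Suc n) + 1 / real (Suc j)) / 2"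
      using halves vb by blast
    then show ?thesis using l by (simp add: pos_divide_le_eq mult.commute)
  qed
  have "Cauchy ys"
  proof (rule metric_CauchyI)
    fix e :: real assume e: "e > 0"
    then have "e\<^sup>2 / (8 * l) > 0" using l by simp
    then obtain N where N: "1 / real (Suc N) < e\<^sup>2 / (8 * l)" using nat_approx_posE by blast
    have "dist (ys n) (ys j) < e" if "n \<ge> N" "j \<ge> N" for n j
    proof -
      have "1 / real (Suc n) \<le> 1 / real (Suc N)" "1 / real (Suc j) \<le> 1 / real (Suc N)"
        using that by (auto intro!: divide_left_mono)
      moreover have "e\<^sup>2 / (4 * l) = 2 * (e\<^sup>2 / (8 * l))" using l by simp
      ultimately have "1 / real (Suc n) + 1 / real (Suc j) < e\<^sup>2 / (4 * l)" using N by linarith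
      then have "4 * l * (1 / real (Suc n) + 1 / real (Suc j)) < 4 * l * (e\<^sup>2 / (4 * l))"
        using l by (intro mult_strict_left_mono) auto
      then have "(norm (ys n - ys j))\<^sup>2 < e\<^sup>2" using cau[of n j] l by simp
      then show ?thesis using e by (simp add: dist_norm power2_less_imp_less)
    qed
    then show "\<exists>N. \<forall>m\<ge>N. \<forall>n\<ge>N. dist (ys m) (ys n) < e" by blast
  qed
  then obtain p where p: "ys \<longlonglongrightarrow> p" by (auto simp: Cauchy_convergent_iff convergent_def)
  have pS: "p \<in> S" using S(2) p ysS by (metis closed_sequentially)
  \<comment> \<open>Lower semicontinuity bounds \<open>\<phi> p\<close> by limits of
    \<open>\<phi> (ys n)\<close>, while the quadratic term converges by continuity; so
    \<open>p\<close> attains the infimum.\<close>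
  have plow: "\<phi> p \<le> ereal (M - (norm (p - x))\<^sup>2 / (2 * l))"
  proof (rule ccontr)
    assume "\<not> ?thesis"
    then obtain c' where c': "ereal (M - (norm (p - x))\<^sup>2 / (2 * l)) < ereal c'" "ereal c' < \<phi> p"
      using ereal_dense2 by (metis not_le)
    obtain d where d: "d > 0" "\<And>y. y \<in> S \<Longrightarrow> dist y p < d \<Longrightarrow> ereal c' < \<phi> y"
      using lsc_onD[OF lsc pS c'(2)] by blast
    have "\<forall>\<^sub>F n in sequentially. dist (ys n) p < d" using p d(1) by (simp add: tendsto_iff)
    then have "\<forall>\<^sub>F n in sequentially. c' \<le> M + 1 / real (Suc n) - (norm (ys n - x))\<^sup>2 / (2 * l)"
    proof eventually_elim
      case (elim n)
      then have "c' < v n" using d(2)[OF ysS[of n]] v by simp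
      then show ?case using vb[of n] by linarith
    qed
    moreover have "(\<lambda>n. M + 1 / real (Suc n) - (norm (ys n - x))\<^sup>2 / (2 * l))
        \<longlonglongrightarrow> M + 0 - (norm (p - x))\<^sup>2 / (2 * l)"
    proof (intro tendsto_intros p)
      show "(\<lambda>n. 1 / real (Suc n)) \<longlonglongrightarrow> 0"
        using LIMSEQ_inverse_real_of_nat by (simp add: inverse_eq_divide)
    qed (use l in auto)
    ultimately have "c' \<le> M + 0 - (norm (p - x))\<^sup>2 / (2 * l)"
      using tendsto_lowerbound trivial_limit_sequentially by blast
    then show False using c'(1) by simp
  qed
  then obtain w where w: "\<phi> p = ereal w" using ninf[OF pS] by (cases "\<phi> p") auto
  have wM: "w + (norm (p - x))\<^sup>2 / (2 * l) \<le> M" using plow w by simp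
  define z where "z = (1 / l) *\<^sub>R (x - p)"
  have zS: "z \<in> S" unfolding z_def using S x pS by (intro subspace_scale subspace_diff)
  have "\<phi> p + ereal (inner z (y - p)) \<le> \<phi> y" if y: "y \<in> S" for y
  proof (cases "\<phi> y")
    case (real u)
    \<comment> \<open>First-order optimality: move from \<open>p\<close> a fraction \<open>r\<close>
      towards \<open>y\<close>, compare with the minimal value, divide by \<open>r\<close>. Letting
      \<open>r\<close> tend to 0 then gives the subgradient inequality for \<open>z\<close>.\<close>
    have ineq: "w \<le> u + inner (p - x) (y - p) / l + r * ((norm (y - p))\<^sup>2 / (2 * l))" if r: "0 < r" "r < 1" for r
    proof -
      let ?q = "(1 - r) *\<^sub>R p + r *\<^sub>R y"
      have qS: "?q \<in> S" using S pS y by (intro subspace_add subspace_scale)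
      have "\<phi> ?q \<le> ereal (1 - r) * \<phi> p + ereal r * \<phi> y"
        using conv pS y r unfolding ereal_convex_on_def by blast
      then have "\<phi> ?q \<le> ereal ((1 - r) * w + r * u)" unfolding w real by simp
      then have "\<Phi> ?q \<le> ereal ((1 - r) * w + r * u) + ereal ((norm (?q - x))\<^sup>2 / (2 * l))"
        unfolding \<Phi>_def by (rule add_right_mono)
      with Mlow[OF qS] have "ereal M \<le> ereal ((1 - r) * w + r * u + (norm (?q - x))\<^sup>2 / (2 * l))"
        using order_trans by fastforce
      then have 1: "M \<le> (1 - r) * w + r * u + (norm (?q - x))\<^sup>2 / (2 * l)" by simp
      have q: "?q - x = (p - x) + r *\<^sub>R (y - p)" by (simp add: algebra_simps)
      have "(norm (?q - x))\<^sup>2 = (norm (p - x))\<^sup>2 + 2 * r * inner (p - x) (y - p) + r\<^sup>2 * (norm (y - p))\<^sup>2"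
        unfolding q power2_norm_eq_inner
        by (simp add: inner_add_left inner_add_right inner_commute[of "y - p" "p - x"] power2_eq_square distrib_left mult_ac)
      then have 2: "(norm (?q - x))\<^sup>2 / (2 * l) = (norm (p - x))\<^sup>2 / (2 * l)
          + r * (inner (p - x) (y - p) / l) + r * (r * ((norm (y - p))\<^sup>2 / (2 * l)))"
        using l by (simp add: field_simps power2_eq_square)
      have "r * w \<le> r * (u + inner (p - x) (y - p) / l + r * ((norm (y - p))\<^sup>2 / (2 * l)))"
        using 1 wM unfolding 2 by (simp add: algebra_simps)
      then show ?thesis using r by simp
    qed
    have "((\<lambda>r. u + inner (p - x) (y - p) / l + r * ((norm (y - p))\<^sup>2 / (2 * l)))
        \<longlongrightarrow> u + inner (p - x) (y - p) / l + 0 * ((norm (y - p))\<^sup>2 / (2 * l))) (at_right 0)"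
      by (intro tendsto_intros)
    moreover have "\<forall>\<^sub>F r in at_right 0. w \<le> u + inner (p - x) (y - p) / l + r * ((norm (y - p))\<^sup>2 / (2 * l))"
      using ineq by (auto simp: eventually_at_right_field intro!: exI[of _ 1])
    ultimately have "w \<le> u + inner (p - x) (y - p) / l + 0 * ((norm (y - p))\<^sup>2 / (2 * l))"
      by (rule tendsto_lowerbound) simp
    moreover have "inner z (y - p) = - (inner (p - x) (y - p) / l)"
      by (simp add: z_def inner_diff_left diff_divide_distrib)
    ultimately show ?thesis by (simp add: w real)
  qed (use ninf[OF y] in auto)
  then have "z \<in> subdiff S \<phi> p" unfolding subdiff_def using zS by simp
  moreover have "x = p + l *\<^sub>R z" using l by (simp add: z_def)
  ultimately show ?thesis using that pS w by simp
qed

text \<open>The Legendre transform inside one algebra, to which \<open>legendre\<close> is reduced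
  later; \<open>S\<close> is going to be \<open>tuples A\<close>.\<close>

definition fenchel :: "'a::real_inner set \<Rightarrow> ('a \<Rightarrow> ereal) \<Rightarrow> 'a \<Rightarrow> ereal" where
  "fenchel S \<phi> x = (SUP y\<in>S. ereal (inner x y) - \<phi> y)"

lemma fenchel_cong: "(\<And>y. y \<in> S \<Longrightarrow> \<phi> y = \<psi> y) \<Longrightarrow> fenchel S \<phi> x = fenchel S \<psi> x"
  unfolding fenchel_def by (intro SUP_cong) auto

lemma subdiff_subset: "subdiff S \<phi> x \<subseteq> S" by (auto simp: subdiff_def)

text \<open>Equality case of Fenchel-Young: the subgradient inequality says precisely that
  \<open>x\<close> maximises the expression under the supremum.\<close>

lemma fenchel_eq_subdiff:
  assumes "x \<in> S" "\<phi> x = ereal v" "y \<in> subdiff S \<phi> x"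
  shows "fenchel S \<phi> y = ereal (inner y x - v)"
  unfolding fenchel_def
proof (rule antisym)
  show "(SUP z\<in>S. ereal (inner y z) - \<phi> z) \<le> ereal (inner y x - v)"
  proof (rule SUP_least)
    fix z assume "z \<in> S"
    then have "ereal (v + inner y (z - x)) \<le> \<phi> z" using assms unfolding subdiff_def by auto
    then show "ereal (inner y z) - \<phi> z \<le> ereal (inner y x - v)"
      by (cases "\<phi> z") (auto simp: inner_diff_right)
  qed
  show "ereal (inner y x - v) \<le> (SUP z\<in>S. ereal (inner y z) - \<phi> z)"
    by (rule SUP_upper2[OF assms(1)]) (simp add: assms(2))
qed

text \<open>Fenchel--Moreau: resolving \<open>x = p + l z\<close> by \<open>minty\<close> for small \<open>l\<close> yields the affine
  minorant \<open>\<phi> p + \<langle>z, \<cdot> - p\<rangle>\<close>, whose value \<open>\<phi> p + \<parallel>x - p\<parallel>\<^sup>2 / l\<close> at \<open>x\<close> exceeds any given \<open>a < \<phi> x\<close>.\<close>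

lemma fenchel_fenchel:
  fixes S :: "'a::{real_inner,complete_space} set"
  assumes S: "subspace S" "closed S" and conv: "ereal_convex_on S \<phi>" and lsc: "lsc_on S \<phi>"
    and ninf: "\<And>x. x \<in> S \<Longrightarrow> \<phi> x \<noteq> -\<infinity>" and x: "x \<in> S"
  shows "fenchel S (fenchel S \<phi>) x = \<phi> x"
proof (cases "\<forall>y\<in>S. \<phi> y = \<infinity>")
  case True
  then have "fenchel S \<phi> y = -\<infinity>" for y
    using x by (auto simp: fenchel_def SUP_constant bot_ereal_def)
  then show ?thesis using x True by (auto simp: fenchel_def[of S "fenchel S \<phi>"] SUP_constant)
next
  case False
  then obtain x0 where x0: "x0 \<in> S" "\<phi> x0 \<noteq> \<infinity>" by blast
  have "\<bar>\<phi> x0\<bar> \<noteq> \<infinity>" using x0 ninf[OF x0(1)] by auto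
  from affine_minorant[OF S(1) conv lsc x0(1) this ninf] obtain c k where k: "k \<ge> 0"
    and mino: "\<And>y. y \<in> S \<Longrightarrow> ereal (c - k * norm y) \<le> \<phi> y" by blast
  show ?thesis
  proof (rule antisym)
    show "fenchel S (fenchel S \<phi>) x \<le> \<phi> x"
      unfolding fenchel_def[of S "fenchel S \<phi>"]
    proof (rule SUP_least)
      fix y assume y: "y \<in> S"
      have "ereal (inner y x) - \<phi> x \<le> fenchel S \<phi> y" unfolding fenchel_def using x by (rule SUP_upper)
      then show "ereal (inner x y) - fenchel S \<phi> y \<le> \<phi> x"
        using ninf[OF x] by (cases "\<phi> x"; cases "fenchel S \<phi> y") (auto simp: inner_commute)
    qed
    show "\<phi> x \<le> fenchel S (fenchel S \<phi>) x"
    proof (rule ereal_le_real)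
      fix a assume "fenchel S (fenchel S \<phi>) x \<le> ereal a"
      then show "\<phi> x \<le> ereal a"
      proof (rule contrapos_pp)
        assume "\<not> \<phi> x \<le> ereal a"
        then have a: "ereal a < \<phi> x" by simp
        obtain d where d: "d > 0" "\<And>y. y \<in> S \<Longrightarrow> dist y x < d \<Longrightarrow> ereal a < \<phi> y"
          using lsc_onD[OF lsc x a] by blast
        \<comment> \<open>The choice of \<open>l\<close> makes \<open>d / l = k + b / d\<close>. If
          \<open>p\<close> is at distance \<open>r \<ge> d\<close> from \<open>x\<close>, then
          \<open>r\<^sup>2 / l\<close> is at least \<open>k * r + b\<close>: the first summand
          compensates the decay of the cone between \<open>x\<close> and \<open>p\<close>, the
          second exceeds the remaining gap \<open>a - c + k * norm x\<close>.\<close>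
        define b where "b = \<bar>a - c + k * norm x\<bar> + 1"
        have b: "b > 0" "b > a - c + k * norm x" by (auto simp: b_def)
        define l where "l = d / (k + b / d)"
        have kb: "k + b / d > 0" using k b d(1) by (simp add: add_nonneg_pos)
        have l: "l > 0" using kb d by (simp add: l_def)
        have dl: "d / l = k + b / d" using d kb by (simp add: l_def)
        obtain p z where p: "p \<in> S" "z \<in> subdiff S \<phi> p" "\<bar>\<phi> p\<bar> \<noteq> \<infinity>" "x = p + l *\<^sub>R z"
          using minty[OF S conv lsc x0 ninf l x] by blast
        obtain v where v: "\<phi> p = ereal v" using p(3) by auto
        have zS: "z \<in> S" using p(2) subdiff_subset by blast
        let ?r = "norm (x - p)"
        have r: "?r = l * norm z" using p(4) l by simp
        have zxp: "inner z (x - p) = ?r * ?r / l"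
          using l by (simp add: p(4) r power2_norm_eq_inner[symmetric] power2_eq_square)
        have "a < v + ?r * ?r / l"
        proof (cases "dist p x < d")
          case True
          then have "a < v" using d(2)[OF p(1)] v by simp
          moreover have "0 \<le> ?r * ?r / l" using l by simp
          ultimately show ?thesis by linarith
        next
          case False
          then have rd: "?r \<ge> d" by (simp add: dist_norm norm_minus_commute)
          have "norm p \<le> norm x + ?r" by (metis norm_triangle_sub norm_minus_commute add.commute)
          then have "k * norm p \<le> k * norm x + k * ?r" using k by (metis mult_left_mono distrib_left)
          moreover have "c - k * norm p \<le> v" using mino[OF p(1)] v by simp
          moreover have "?r * ?r / l \<ge> ?r * (k + b / d)"
            unfolding dl[symmetric] using rd l by (simp add: divide_right_mono mult_left_mono)
          moreover have "?r * (b / d) \<ge> b" using rd b d(1) by (simp add: field_simps)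
          ultimately show ?thesis using b by (simp add: distrib_left mult.commute)
        qed
        also have "v + ?r * ?r / l = inner x z - (inner z p - v)"
          using zxp by (simp add: inner_diff_right inner_commute)
        finally have "ereal a < ereal (inner x z) - fenchel S \<phi> z"
          using fenchel_eq_subdiff[OF p(1) v p(2)] by simp
        also have "\<dots> \<le> fenchel S (fenchel S \<phi>) x"
          unfolding fenchel_def[of S "fenchel S \<phi>"] using zS by (rule SUP_upper)
        finally show "\<not> fenchel S (fenchel S \<phi>) x \<le> ereal a" by simp
      qed
    qed
  qed
qed

text \<open>A bounded linear functional is convex and continuous, so \<open>minty\<close> provides a
  subgradient at some point; a subgradient of a linear functional represents it.\<close>

lemma riesz_subspace:
  fixes S :: "'a::{real_inner,complete_space} set" and g :: "'a \<Rightarrow> real"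
  assumes S: "subspace S" "closed S"
    and add: "\<And>x y. x \<in> S \<Longrightarrow> y \<in> S \<Longrightarrow> g (x + y) = g x + g y"
    and scale: "\<And>r x. x \<in> S \<Longrightarrow> g (r *\<^sub>R x) = r * g x"
    and bound: "\<And>x. x \<in> S \<Longrightarrow> \<bar>g x\<bar> \<le> K * norm x"
  shows "\<exists>p\<in>S. \<forall>x\<in>S. g x = inner p x"
proof -
  let ?g = "\<lambda>x. ereal (g x)"
  have diff: "g (x - y) = g x - g y" if "x \<in> S" "y \<in> S" for x y
    using add[of x "(-1) *\<^sub>R y"] scale[of y "-1"] that S(1) subspace_neg by fastforce
  have conv: "ereal_convex_on S ?g"
    unfolding ereal_convex_on_def using S(1) by (auto simp: add scale subspace_scale)
  have lsc: "lsc_on S ?g"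
    unfolding lsc_on_iff
  proof (intro ballI allI impI)
    fix x c assume x: "x \<in> S" and c: "c < ereal (g x)"
    show "\<exists>d>0. \<forall>y\<in>S. dist y x < d \<longrightarrow> c < ereal (g y)"
    proof (cases c)
      case (real r)
      \<comment> \<open>\<open>K\<close> may vanish or be negative, so
        \<open>\<bar>K\<bar> + 1\<close> serves as a positive Lipschitz constant.\<close>
      have pos: "0 < (g x - r) / (\<bar>K\<bar> + 1)" using c real by simp
      have "r < g y" if y: "y \<in> S" "dist y x < (g x - r) / (\<bar>K\<bar> + 1)" for y
      proof -
        have "g x - g y \<le> K * norm (x - y)" using bound[of "x - y"] diff[of x y] x y S(1)
          by (simp add: subspace_diff)
        also have "\<dots> \<le> (\<bar>K\<bar> + 1) * dist y x" by (simp add: dist_norm norm_minus_commute mult_right_mono)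
        also have "\<dots> < g x - r" using y(2) by (simp add: field_simps)
        finally show ?thesis by simp
      qed
      then show ?thesis using pos real by auto
    qed (use c in \<open>auto intro: exI[of _ 1]\<close>)
  qed
  have 0: "0 \<in> S" by (rule subspace_0[OF S(1)])
  obtain p z where p: "p \<in> S" "z \<in> subdiff S ?g p" "0 = p + 1 *\<^sub>R z"
    using minty[OF S conv lsc 0 _ _ _ 0, of 1] by auto
  have ge: "g y \<ge> g p + inner z (y - p)" if "y \<in> S" for y using p(2) that by (simp add: subdiff_def)
  have "g x = inner z x" if x: "x \<in> S" for x
  proof -
    \<comment> \<open>Testing the subgradient inequality at \<open>p + x\<close> and at
      \<open>p - x\<close> gives the two directions.\<close>
    have "g x \<ge> inner z x" using ge[of "p + x"] x p(1) S(1) by (simp add: subspace_add add)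
    moreover have "g x \<le> inner z x" using ge[of "p - x"] x p(1) S(1) by (simp add: subspace_diff diff)
    ultimately show ?thesis by simp
  qed
  moreover have "z \<in> S" using p(2) subdiff_subset by blast
  ultimately show ?thesis by blast
qed

section \<open>The \<open>L\<^sup>2\<close>-spaces of tracial W*-algebras\<close>

lemma cinner_add_right: "cinner x (y + z) = cinner x y + cinner x z"
  unfolding cinner_def suminf_add[OF summable_coeff_mult summable_coeff_mult] plus_ell2.rep_eq
  by (simp add: distrib_left)

lemma cinner_commute: "cinner x y = cnj (cinner y x)"
proof -
  have "(\<lambda>n. cnj (coeff y n) * coeff x n) sums cinner y x"
    unfolding cinner_def by (rule summable_sums[OF summable_coeff_mult])
  then have "(\<lambda>n. cnj (cnj (coeff y n) * coeff x n)) sums cnj (cinner y x)"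
    by (simp only: sums_cnj)
  then have "(\<lambda>n. cnj (coeff x n) * coeff y n) sums cnj (cinner y x)"
    by (simp add: mult.commute)
  then show ?thesis unfolding cinner_def by (rule sums_unique[symmetric])
qed

lemma cinner_add_left: "cinner (x + y) z = cinner x z + cinner y z"
  by (metis cinner_add_right cinner_commute complex_cnj_add)

lemma cinner_scaleC_right: "cinner x (scaleC c y) = c * cinner x y"
  unfolding cinner_def suminf_mult[OF summable_coeff_mult, symmetric] scaleC.rep_eq
  by (simp add: mult_ac)

lemma cinner_scaleC_left: "cinner (scaleC c x) y = cnj c * cinner x y"
  by (metis cinner_scaleC_right cinner_commute complex_cnj_mult)

lemma Re_cinner: "Re (cinner x y) = inner x y"
  by (simp add: inner_ell2_def)

lemma Im_cinner: "Im (cinner x y) = inner x (scaleC (- \<i>) y)"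
  by (simp add: inner_ell2_def cinner_scaleC_right)

text \<open>Both parts of \<open>cinner\<close> are real inner products, the imaginary one after
  rotation by \<open>-\<i>\<close>. A real Riesz representation therefore becomes a complex one as
  soon as the maps commute with \<open>scaleC\<close>.\<close>

lemma cinner_eq_iff:
  "cinner x y = cinner u v \<longleftrightarrow> inner x y = inner u v \<and> inner x (scaleC (- \<i>) y) = inner u (scaleC (- \<i>) v)"
  by (simp add: complex_eq_iff Re_cinner Im_cinner)

lemma scaleC_of_real: "scaleC (complex_of_real r) x = r *\<^sub>R x"
  by transfer simp

lemma inner_eqI:
  fixes u v :: "'a::real_inner"
  assumes "u \<in> S" "v \<in> S" "subspace S" "\<And>y. y \<in> S \<Longrightarrow> inner u y = inner v y"
  shows "u = v"
proof -
  have "inner (u - v) (u - v) = 0"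
    using assms(4)[of "u - v"] subspace_diff[OF assms(3,1,2)] by (simp add: inner_diff_left)
  then show ?thesis by simp
qed

text \<open>Makes the definite description in \<open>op_adj\<close> meaningful: the real Riesz
  theorem is applied for each fixed \<open>x\<close>, and complex linearity of \<open>T\<close>
  upgrades the real identity to \<open>cinner\<close>.\<close>

lemma op_adj_exists:
  assumes T: "complex_linear_op T"
  shows "\<exists>S :: op. \<forall>x y. cinner (S x) y = cinner x (T y)"
proof -
  have "\<exists>v. \<forall>y. inner x (T y) = inner v y" for x
  proof -
    have "\<exists>p\<in>UNIV. \<forall>y\<in>UNIV. inner x (T y) = inner p y"
    proof (rule riesz_subspace[where K = "norm x * norm T"])
      show "\<bar>inner x (T y)\<bar> \<le> norm x * norm T * norm y" for y
        using Cauchy_Schwarz_ineq2[of x "T y"] mult_left_mono[OF norm_blinfun[of T y], of "norm x"]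
        by (simp add: mult.assoc)
    qed (auto simp: blinfun.add_right blinfun.scaleR_right inner_add_right)
    then show ?thesis by simp
  qed
  then obtain F where F: "\<And>x y. inner x (T y) = inner (F x) y" by metis
  have "bounded_linear F"
  proof (rule bounded_linear_intro)
    show "F (x + y) = F x + F y" for x y
      by (rule inner_eqI[of _ UNIV]) (auto simp: F[symmetric] inner_add_left)
    show "F (r *\<^sub>R x) = r *\<^sub>R F x" for r x
      by (rule inner_eqI[of _ UNIV]) (auto simp: F[symmetric])
    show "norm (F x) \<le> norm x * norm T" for x
    proof (cases "F x = 0")
      case False
      have "norm (F x) * norm (F x) = inner x (T (F x))"
        by (simp add: F power2_norm_eq_inner[symmetric] power2_eq_square)
      also have "\<dots> \<le> norm x * norm (T (F x))" by (rule norm_cauchy_schwarz)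
      also have "\<dots> \<le> norm x * (norm T * norm (F x))" by (intro mult_left_mono norm_blinfun) simp
      finally show ?thesis using False by (simp add: mult.assoc[symmetric])
    qed simp
  qed
  then have "blinfun_apply (Blinfun F) = F" by (rule bounded_linear_Blinfun_apply)
  moreover have "cinner (F x) y = cinner x (T y)" for x y
    using T unfolding cinner_eq_iff complex_linear_op_def by (metis F)
  ultimately show ?thesis by (intro exI[of _ "Blinfun F"]) simp
qed

lemma op_adj_eqI:
  assumes "\<And>x y. cinner (blinfun_apply S x) y = cinner x (blinfun_apply T y)"
  shows "op_adj T = S"
  unfolding op_adj_def
proof (rule the_equality)
  show "\<forall>x y. cinner (S x) y = cinner x (T y)" using assms by simp
  fix S' :: op assume S': "\<forall>x y. cinner (blinfun_apply S' x) y = cinner x (T y)"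
  have "S' x = S x" for x
    by (rule inner_eqI[of _ UNIV]) (auto simp: Re_cinner[symmetric] S' assms)
  then show "S' = S" by (rule blinfun_eqI)
qed

lemma cinner_op_adj: "complex_linear_op T \<Longrightarrow> cinner (op_adj T x) y = cinner x (T y)"
  using op_adj_exists[of T] op_adj_eqI by metis

lemma op_adj_op_adj: "complex_linear_op T \<Longrightarrow> op_adj (op_adj T) = T"
  by (rule op_adj_eqI) (metis cinner_op_adj cinner_commute)

lemma op_adj_add:
  "complex_linear_op T \<Longrightarrow> complex_linear_op S \<Longrightarrow> op_adj (T + S) = op_adj T + op_adj S"
  by (rule op_adj_eqI) (simp add: blinfun.add_left cinner_add_left cinner_add_right cinner_op_adj)

lemma op_adj_scaleC:
  "complex_linear_op T \<Longrightarrow> op_adj (op_scaleC c T) = op_scaleC (cnj c) (op_adj T)"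
  by (rule op_adj_eqI) (simp add: op_scaleC_apply cinner_scaleC_left cinner_scaleC_right cinner_op_adj)

section \<open>The completion of one algebra and extension by continuity\<close>

locale tracial_wstar =
  fixes A :: tracial_algebra
  assumes wstar: "tracial_wstar_algebra A"
begin

lemma vn: "von_neumann_algebra (Linf A)"
  and tr: "faithful_normal_tracial_state (Linf A) (trace A)"
  using wstar unfolding tracial_wstar_algebra_def by simp_all

lemma Linf_complex_linear: "a \<in> Linf A \<Longrightarrow> complex_linear_op a"
  and Linf_id: "id_blinfun \<in> Linf A"
  and Linf_add: "a \<in> Linf A \<Longrightarrow> b \<in> Linf A \<Longrightarrow> a + b \<in> Linf A"
  and Linf_comp: "a \<in> Linf A \<Longrightarrow> b \<in> Linf A \<Longrightarrow> a o\<^sub>L b \<in> Linf A"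
  and Linf_scaleC: "a \<in> Linf A \<Longrightarrow> op_scaleC c a \<in> Linf A"
  and Linf_adj: "a \<in> Linf A \<Longrightarrow> op_adj a \<in> Linf A"
  using vn unfolding von_neumann_algebra_def by simp_all

lemma trace_commute: "a \<in> Linf A \<Longrightarrow> b \<in> Linf A \<Longrightarrow> trace A (a o\<^sub>L b) = trace A (b o\<^sub>L a)"
  and trace_id: "trace A id_blinfun = 1"
  using tr unfolding faithful_normal_tracial_state_def by simp_all

lemma trace_scaleC: "a \<in> Linf A \<Longrightarrow> trace A (op_scaleC c a) = c * trace A a"
  using tr unfolding faithful_normal_tracial_state_def predual_def complex_linear_functional_def by simp

lemma l2_add: "a \<in> Linf A \<Longrightarrow> b \<in> Linf A \<Longrightarrow> l2 A (a + b) = l2 A a + l2 A b"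
  and l2_scaleC: "a \<in> Linf A \<Longrightarrow> l2 A (op_scaleC c a) = scaleC c (l2 A a)"
  and cinner_l2: "a \<in> Linf A \<Longrightarrow> b \<in> Linf A \<Longrightarrow> cinner (l2 A a) (l2 A b) = trace A (op_adj a o\<^sub>L b)"
  using wstar unfolding tracial_wstar_algebra_def by simp_all

lemma norm_l2: "a \<in> Linf A \<Longrightarrow> (norm (l2 A a))\<^sup>2 = Re (trace A (op_adj a o\<^sub>L a))"
  by (simp add: power2_norm_eq_inner inner_ell2_def cinner_l2)

lemma L2_iff: "\<xi> \<in> L2 A \<longleftrightarrow> (\<exists>a. (\<forall>n::nat. a n \<in> Linf A) \<and> (\<lambda>n. l2 A (a n)) \<longlonglongrightarrow> \<xi>)"
proof
  assume "\<xi> \<in> L2 A"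
  then obtain x where x: "\<And>n. x n \<in> l2 A ` Linf A" "x \<longlonglongrightarrow> \<xi>"
    unfolding L2_def closure_sequential by blast
  then have "\<forall>n. \<exists>a. a \<in> Linf A \<and> x n = l2 A a" by blast
  then obtain a where a: "\<And>n. a n \<in> Linf A \<and> x n = l2 A (a n)" by metis
  then have "x = (\<lambda>n. l2 A (a n))" by auto
  then show "\<exists>a. (\<forall>n. a n \<in> Linf A) \<and> (\<lambda>n. l2 A (a n)) \<longlonglongrightarrow> \<xi>" using a x(2) by blast
next
  assume "\<exists>a. (\<forall>n. a n \<in> Linf A) \<and> (\<lambda>n. l2 A (a n)) \<longlonglongrightarrow> \<xi>"
  then obtain a where "\<And>n. a n \<in> Linf A" "(\<lambda>n. l2 A (a n)) \<longlonglongrightarrow> \<xi>" by blast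
  then show "\<xi> \<in> L2 A"
    unfolding L2_def closure_sequential by (intro exI[of _ "\<lambda>n. l2 A (a n)"]) auto
qed

lemma L2_add: "\<xi> \<in> L2 A \<Longrightarrow> \<eta> \<in> L2 A \<Longrightarrow> \<xi> + \<eta> \<in> L2 A"
proof -
  assume "\<xi> \<in> L2 A" "\<eta> \<in> L2 A"
  then obtain a b where a: "\<And>n::nat. a n \<in> Linf A" "(\<lambda>n. l2 A (a n)) \<longlonglongrightarrow> \<xi>"
    and b: "\<And>n::nat. b n \<in> Linf A" "(\<lambda>n. l2 A (b n)) \<longlonglongrightarrow> \<eta>" unfolding L2_iff by blast
  have "(\<lambda>n. l2 A (a n + b n)) \<longlonglongrightarrow> \<xi> + \<eta>"
    using tendsto_add[OF a(2) b(2)] a(1) b(1) by (simp add: l2_add)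
  then show ?thesis using a(1) b(1) Linf_add by (auto simp: L2_iff intro!: exI[of _ "\<lambda>n. a n + b n"])
qed

lemma L2_scaleC: "\<xi> \<in> L2 A \<Longrightarrow> scaleC c \<xi> \<in> L2 A"
proof -
  assume "\<xi> \<in> L2 A"
  then obtain a where a: "\<And>n::nat. a n \<in> Linf A" "(\<lambda>n. l2 A (a n)) \<longlonglongrightarrow> \<xi>" unfolding L2_iff by blast
  have "(\<lambda>n. l2 A (op_scaleC c (a n))) \<longlonglongrightarrow> scaleC c \<xi>"
    using bounded_linear.tendsto[OF bounded_linear_scaleC a(2)] a(1) by (simp add: l2_scaleC)
  then show ?thesis using a(1) Linf_scaleC by (auto simp: L2_iff intro!: exI[of _ "\<lambda>n. op_scaleC c (a n)"])
qed

lemma L2_subspace: "subspace (L2 A)"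
  unfolding subspace_def
proof (intro conjI allI ballI)
  show "\<xi> + \<eta> \<in> L2 A" if "\<xi> \<in> L2 A" "\<eta> \<in> L2 A" for \<xi> \<eta> using that by (rule L2_add)
  show scale: "r *\<^sub>R \<xi> \<in> L2 A" if "\<xi> \<in> L2 A" for r \<xi>
    using L2_scaleC[OF that, of "complex_of_real r"] by (simp add: scaleC_of_real)
  have "l2 A id_blinfun \<in> L2 A" unfolding L2_def using Linf_id by (simp add: closure_subset[THEN subsetD])
  from scale[OF this, of 0] show "0 \<in> L2 A" by simp
qed

lemma L2_closed: "closed (L2 A)" by (simp add: L2_def)

end

text \<open>Homogeneity is demanded for real scalars only, so that the conjugate-linear map
  \<open>op_adj\<close> is an instance alongside the trace-preserving embeddings.\<close>

locale l2_isometry = A: tracial_wstar A + B: tracial_wstar B for A B +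
  fixes \<phi> :: "op \<Rightarrow> op"
  assumes maps: "a \<in> Linf A \<Longrightarrow> \<phi> a \<in> Linf B"
    and map_add: "a \<in> Linf A \<Longrightarrow> b \<in> Linf A \<Longrightarrow> \<phi> (a + b) = \<phi> a + \<phi> b"
    and map_scale: "a \<in> Linf A \<Longrightarrow> \<phi> (op_scaleC (complex_of_real r) a) = op_scaleC (complex_of_real r) (\<phi> a)"
    and map_norm: "a \<in> Linf A \<Longrightarrow> norm (l2 B (\<phi> a)) = norm (l2 A a)"
begin

abbreviation "ext \<equiv> l2_extend A B \<phi>"

lemma map_dist:
  assumes a: "a \<in> Linf A" and b: "b \<in> Linf A"
  shows "dist (l2 B (\<phi> a)) (l2 B (\<phi> b)) = dist (l2 A a) (l2 A b)"
proof -
  let ?m = "complex_of_real (-1)"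
  let ?b = "op_scaleC ?m b"
  have bL: "?b \<in> Linf A" by (rule A.Linf_scaleC[OF b])
  have "l2 B (\<phi> (a + ?b)) = l2 B (\<phi> a) + scaleC ?m (l2 B (\<phi> b))"
    unfolding map_add[OF a bL] map_scale[OF b]
    by (simp only: B.l2_add[OF maps[OF a] B.Linf_scaleC[OF maps[OF b]]] B.l2_scaleC[OF maps[OF b]])
  moreover have "l2 A (a + ?b) = l2 A a + scaleC ?m (l2 A b)"
    by (simp only: A.l2_add[OF a bL] A.l2_scaleC[OF b])
  ultimately show ?thesis
    using map_norm[OF A.Linf_add[OF a bL]] unfolding scaleC_of_real by (simp add: dist_norm)
qed

text \<open>Justifies the definite description in \<open>l2_extend\<close>. Images of a convergent
  sequence are Cauchy because distances are preserved, and for the same reason two sequences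
  approximating the same vector have the same image limit.\<close>

lemma ext_lim:
  assumes a: "\<And>n::nat. a n \<in> Linf A" and lim: "(\<lambda>n. l2 A (a n)) \<longlonglongrightarrow> \<xi>"
  shows "(\<lambda>n. l2 B (\<phi> (a n))) \<longlonglongrightarrow> ext \<xi>"
proof -
  have "Cauchy (\<lambda>n. l2 B (\<phi> (a n)))"
    using LIMSEQ_imp_Cauchy[OF lim] by (simp add: Cauchy_def map_dist a)
  then obtain \<eta> where \<eta>: "(\<lambda>n. l2 B (\<phi> (a n))) \<longlonglongrightarrow> \<eta>"
    by (auto simp: Cauchy_convergent_iff convergent_def)
  have "ext \<xi> = \<eta>"
    unfolding l2_extend_def
  proof (rule the_equality)
    show "\<exists>a. (\<forall>n. a n \<in> Linf A) \<and> (\<lambda>n. l2 A (a n)) \<longlonglongrightarrow> \<xi> \<and> (\<lambda>n. l2 B (\<phi> (a n))) \<longlonglongrightarrow> \<eta>"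
      using a lim \<eta> by blast
    fix \<eta>' assume "\<exists>a. (\<forall>n. a n \<in> Linf A) \<and> (\<lambda>n. l2 A (a n)) \<longlonglongrightarrow> \<xi> \<and> (\<lambda>n. l2 B (\<phi> (a n))) \<longlonglongrightarrow> \<eta>'"
    then obtain b where b: "\<And>n::nat. b n \<in> Linf A" "(\<lambda>n. l2 A (b n)) \<longlonglongrightarrow> \<xi>" "(\<lambda>n. l2 B (\<phi> (b n))) \<longlonglongrightarrow> \<eta>'"
      by blast
    have "(\<lambda>n. dist (l2 B (\<phi> (a n))) (l2 B (\<phi> (b n)))) \<longlonglongrightarrow> dist \<eta> \<eta>'" by (intro tendsto_dist \<eta> b)
    moreover have "(\<lambda>n. dist (l2 A (a n)) (l2 A (b n))) \<longlonglongrightarrow> dist \<xi> \<xi>" by (intro tendsto_dist lim b)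
    ultimately have "dist \<eta> \<eta>' = 0" using LIMSEQ_unique by (force simp: map_dist a b(1))
    then show "\<eta>' = \<eta>" by simp
  qed
  then show ?thesis using \<eta> by simp
qed

lemma ext_in: assumes "\<xi> \<in> L2 A" shows "ext \<xi> \<in> L2 B"
proof -
  obtain a where a: "\<And>n::nat. a n \<in> Linf A" "(\<lambda>n. l2 A (a n)) \<longlonglongrightarrow> \<xi>" using assms unfolding A.L2_iff by blast
  show ?thesis using ext_lim[OF a] maps a(1) by (auto simp: B.L2_iff intro!: exI[of _ "\<lambda>n. \<phi> (a n)"])
qed

lemma ext_add:
  assumes "\<xi> \<in> L2 A" "\<eta> \<in> L2 A"
  shows "ext (\<xi> + \<eta>) = ext \<xi> + ext \<eta>"
proof -
  obtain a where a: "\<And>n::nat. a n \<in> Linf A" "(\<lambda>n. l2 A (a n)) \<longlonglongrightarrow> \<xi>" using assms(1) unfolding A.L2_iff by blast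
  obtain b where b: "\<And>n::nat. b n \<in> Linf A" "(\<lambda>n. l2 A (b n)) \<longlonglongrightarrow> \<eta>" using assms(2) unfolding A.L2_iff by blast
  have "(\<lambda>n. l2 A (a n + b n)) \<longlonglongrightarrow> \<xi> + \<eta>" using tendsto_add[OF a(2) b(2)] by (simp add: A.l2_add a b)
  then have "(\<lambda>n. l2 B (\<phi> (a n + b n))) \<longlonglongrightarrow> ext (\<xi> + \<eta>)" by (intro ext_lim A.Linf_add a b)
  then have "(\<lambda>n. l2 B (\<phi> (a n)) + l2 B (\<phi> (b n))) \<longlonglongrightarrow> ext (\<xi> + \<eta>)"
    by (simp add: map_add a b B.l2_add maps)
  moreover have "(\<lambda>n. l2 B (\<phi> (a n)) + l2 B (\<phi> (b n))) \<longlonglongrightarrow> ext \<xi> + ext \<eta>"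
    by (intro tendsto_add ext_lim a b)
  ultimately show ?thesis by (rule LIMSEQ_unique)
qed

lemma ext_scaleC:
  assumes "\<xi> \<in> L2 A" and c: "\<And>a. a \<in> Linf A \<Longrightarrow> \<phi> (op_scaleC c a) = op_scaleC c (\<phi> a)"
  shows "ext (scaleC c \<xi>) = scaleC c (ext \<xi>)"
proof -
  obtain a where a: "\<And>n::nat. a n \<in> Linf A" "(\<lambda>n. l2 A (a n)) \<longlonglongrightarrow> \<xi>" using assms(1) unfolding A.L2_iff by blast
  have "(\<lambda>n. l2 A (op_scaleC c (a n))) \<longlonglongrightarrow> scaleC c \<xi>"
    using bounded_linear.tendsto[OF bounded_linear_scaleC a(2)] a(1) by (simp add: A.l2_scaleC)
  then have "(\<lambda>n. l2 B (\<phi> (op_scaleC c (a n)))) \<longlonglongrightarrow> ext (scaleC c \<xi>)"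
    by (intro ext_lim A.Linf_scaleC a)
  then have "(\<lambda>n. scaleC c (l2 B (\<phi> (a n)))) \<longlonglongrightarrow> ext (scaleC c \<xi>)"
    by (simp add: c a B.l2_scaleC maps)
  moreover have "(\<lambda>n. scaleC c (l2 B (\<phi> (a n)))) \<longlonglongrightarrow> scaleC c (ext \<xi>)"
    by (intro bounded_linear.tendsto[OF bounded_linear_scaleC] ext_lim a)
  ultimately show ?thesis by (rule LIMSEQ_unique)
qed

lemma ext_scaleR: "\<xi> \<in> L2 A \<Longrightarrow> ext (r *\<^sub>R \<xi>) = r *\<^sub>R ext \<xi>"
  using ext_scaleC[of \<xi> "complex_of_real r"] map_scale by (simp add: scaleC_of_real)

lemma ext_norm: assumes "\<xi> \<in> L2 A" shows "norm (ext \<xi>) = norm \<xi>"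
proof -
  obtain a where a: "\<And>n::nat. a n \<in> Linf A" "(\<lambda>n. l2 A (a n)) \<longlonglongrightarrow> \<xi>" using assms unfolding A.L2_iff by blast
  have "(\<lambda>n. norm (l2 B (\<phi> (a n)))) \<longlonglongrightarrow> norm (ext \<xi>)" by (intro tendsto_norm ext_lim a)
  then have "(\<lambda>n. norm (l2 A (a n))) \<longlonglongrightarrow> norm (ext \<xi>)" by (simp add: map_norm a)
  then show ?thesis using tendsto_norm[OF a(2)] LIMSEQ_unique by blast
qed

lemma ext_diff: "\<xi> \<in> L2 A \<Longrightarrow> \<eta> \<in> L2 A \<Longrightarrow> ext (\<xi> - \<eta>) = ext \<xi> - ext \<eta>"
  using ext_add[of \<xi> "(-1) *\<^sub>R \<eta>"] ext_scaleR[of \<eta> "-1"] subspace_scale[OF A.L2_subspace, of \<eta> "-1"] by simp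

lemma ext_inner: "\<xi> \<in> L2 A \<Longrightarrow> \<eta> \<in> L2 A \<Longrightarrow> inner (ext \<xi>) (ext \<eta>) = inner \<xi> \<eta>"
  unfolding dot_norm by (simp add: ext_add[symmetric] ext_norm A.L2_add)

end

context tracial_wstar
begin

sublocale adj: l2_isometry A A op_adj
proof
  fix a assume a: "a \<in> Linf A"
  show "op_adj a \<in> Linf A" by (rule Linf_adj[OF a])
  show "op_adj (a + b) = op_adj a + op_adj b" if "b \<in> Linf A" for b
    by (intro op_adj_add Linf_complex_linear a that)
  show "op_adj (op_scaleC (complex_of_real r) a) = op_scaleC (complex_of_real r) (op_adj a)" for r
    using op_adj_scaleC[OF Linf_complex_linear[OF a], of "complex_of_real r"] by simp
  have "(norm (l2 A (op_adj a)))\<^sup>2 = (norm (l2 A a))\<^sup>2"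
    unfolding norm_l2[OF a] norm_l2[OF Linf_adj[OF a]] op_adj_op_adj[OF Linf_complex_linear[OF a]]
    by (simp add: trace_commute a Linf_adj)
  then show "norm (l2 A (op_adj a)) = norm (l2 A a)" by simp
qed

lemma adj_adj: assumes "\<xi> \<in> L2 A" shows "adj.ext (adj.ext \<xi>) = \<xi>"
proof -
  obtain a where a: "\<And>n::nat. a n \<in> Linf A" "(\<lambda>n. l2 A (a n)) \<longlonglongrightarrow> \<xi>" using assms unfolding L2_iff by blast
  have "(\<lambda>n. l2 A (op_adj (op_adj (a n)))) \<longlonglongrightarrow> adj.ext (adj.ext \<xi>)"
    by (rule adj.ext_lim[OF _ adj.ext_lim[OF a]]) (rule Linf_adj[OF a(1)])
  then show ?thesis using a(2) LIMSEQ_unique by (simp add: op_adj_op_adj Linf_complex_linear a(1))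
qed

lemma L2_sa_subspace: "subspace (L2_sa A)"
  unfolding subspace_def
proof (intro conjI allI ballI)
  show "0 \<in> L2_sa A" using adj.ext_scaleR[of 0 0] subspace_0[OF L2_subspace] by (simp add: L2_sa_def)
qed (auto simp: L2_sa_def adj.ext_add adj.ext_scaleR L2_add subspace_scale[OF L2_subspace])

lemma L2_sa_closed: "closed (L2_sa A)"
  unfolding closed_sequential_limits
proof (intro allI impI, elim conjE)
  fix x l assume x: "\<forall>n. x n \<in> L2_sa A" and l: "x \<longlonglongrightarrow> l"
  have xL: "x n \<in> L2 A" "adj.ext (x n) = x n" for n using x by (auto simp: L2_sa_def)
  have lL: "l \<in> L2 A" using closed_sequentially[OF L2_closed] xL(1) l by blast
  have "(\<lambda>n. dist (x n) l) \<longlonglongrightarrow> 0" using l by (rule tendsto_dist_iff[THEN iffD1])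
  moreover have "dist (x n) l = dist (x n) (adj.ext l)" for n
    using adj.ext_norm[of "x n - l"] adj.ext_diff[of "x n" l] xL lL L2_subspace
    by (simp add: dist_norm subspace_diff)
  ultimately have "x \<longlonglongrightarrow> adj.ext l" by (subst tendsto_dist_iff) simp
  from LIMSEQ_unique[OF this l] show "l \<in> L2_sa A" using lL by (simp add: L2_sa_def)
qed

lemma tuples_subspace: "subspace (tuples A)"
  using subspace_0[OF L2_sa_subspace] subspace_add[OF L2_sa_subspace] subspace_scale[OF L2_sa_subspace]
  by (intro subspaceI) (simp_all add: tuples_def)

lemma tuples_closed: "closed (tuples A :: (ell2 ^ 'n::finite) set)"
proof -
  have "(tuples A :: (ell2 ^ 'n) set) = (\<Inter>j. (\<lambda>X. X $ j) -` L2_sa A)" by (auto simp: tuples_def)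
  moreover have "closed ((\<lambda>X :: ell2 ^ 'n. X $ j) -` L2_sa A)" for j
    by (rule closed_vimage[OF L2_sa_closed continuous_on_component[OF continuous_on_id]])
  ultimately show ?thesis by (metis closed_INT)
qed

end

locale trace_embedding = A: tracial_wstar A + B: tracial_wstar B for A B +
  fixes \<iota> :: "op \<Rightarrow> op"
  assumes emb: "tracial_embedding A B \<iota>"
begin

lemma emb_maps: "a \<in> Linf A \<Longrightarrow> \<iota> a \<in> Linf B"
  and emb_add: "a \<in> Linf A \<Longrightarrow> b \<in> Linf A \<Longrightarrow> \<iota> (a + b) = \<iota> a + \<iota> b"
  and emb_comp: "a \<in> Linf A \<Longrightarrow> b \<in> Linf A \<Longrightarrow> \<iota> (a o\<^sub>L b) = \<iota> a o\<^sub>L \<iota> b"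
  and emb_scaleC: "a \<in> Linf A \<Longrightarrow> \<iota> (op_scaleC c a) = op_scaleC c (\<iota> a)"
  and emb_adj: "a \<in> Linf A \<Longrightarrow> \<iota> (op_adj a) = op_adj (\<iota> a)"
  and emb_trace: "a \<in> Linf A \<Longrightarrow> trace B (\<iota> a) = trace A a"
  using emb unfolding tracial_embedding_def by simp_all

sublocale l2_isometry A B \<iota>
proof
  fix a assume a: "a \<in> Linf A"
  have "(norm (l2 B (\<iota> a)))\<^sup>2 = (norm (l2 A a))\<^sup>2"
    by (simp add: B.norm_l2 A.norm_l2 a emb_maps emb_adj[symmetric] emb_comp[symmetric] A.Linf_adj emb_trace A.Linf_comp)
  then show "norm (l2 B (\<iota> a)) = norm (l2 A a)" by simp
qed (auto simp: emb_maps emb_add emb_scaleC)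

lemma ext_adj:
  assumes "\<xi> \<in> L2 A"
  shows "ext (A.adj.ext \<xi>) = B.adj.ext (ext \<xi>)"
proof -
  obtain a where a: "\<And>n::nat. a n \<in> Linf A" "(\<lambda>n. l2 A (a n)) \<longlonglongrightarrow> \<xi>" using assms unfolding A.L2_iff by blast
  have "(\<lambda>n. l2 B (\<iota> (op_adj (a n)))) \<longlonglongrightarrow> ext (A.adj.ext \<xi>)"
    by (intro ext_lim A.adj.ext_lim a A.Linf_adj)
  moreover have "(\<lambda>n. l2 B (op_adj (\<iota> (a n)))) \<longlonglongrightarrow> B.adj.ext (ext \<xi>)"
    by (intro B.adj.ext_lim ext_lim a emb_maps)
  ultimately show ?thesis using LIMSEQ_unique by (simp add: emb_adj a(1))
qed

lemma ext_L2_sa: "\<xi> \<in> L2_sa A \<Longrightarrow> ext \<xi> \<in> L2_sa B"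
  by (auto simp: L2_sa_def ext_in ext_adj[symmetric])

text \<open>The Riesz vector of \<open>\<xi> \<mapsto> inner \<eta> (ext \<xi>)\<close> is found
  with real inner products; as \<open>ext\<close> commutes with \<open>scaleC\<close>, it also
  satisfies the \<open>cinner\<close> condition in the definition.\<close>

lemma l2_cond_exp:
  assumes \<eta>: "\<eta> \<in> L2 B"
  shows "l2_cond_exp A B \<iota> \<eta> \<in> L2 A"
    and "\<xi> \<in> L2 A \<Longrightarrow> inner (l2_cond_exp A B \<iota> \<eta>) \<xi> = inner \<eta> (ext \<xi>)"
proof -
  have "\<exists>\<zeta>\<in>L2 A. \<forall>\<xi>\<in>L2 A. inner \<eta> (ext \<xi>) = inner \<zeta> \<xi>"
  proof (rule riesz_subspace[OF A.L2_subspace A.L2_closed, where K = "norm \<eta>"])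
    show "\<bar>inner \<eta> (ext \<xi>)\<bar> \<le> norm \<eta> * norm \<xi>" if "\<xi> \<in> L2 A" for \<xi>
      using Cauchy_Schwarz_ineq2[of \<eta> "ext \<xi>"] ext_norm[OF that] by simp
  qed (auto simp: ext_add ext_scaleR inner_add_right)
  then obtain \<zeta> where \<zeta>: "\<zeta> \<in> L2 A" "\<And>\<xi>. \<xi> \<in> L2 A \<Longrightarrow> inner \<zeta> \<xi> = inner \<eta> (ext \<xi>)" by metis
  have "l2_cond_exp A B \<iota> \<eta> = \<zeta>"
    unfolding l2_cond_exp_def
  proof (rule the_equality)
    show "\<zeta> \<in> L2 A \<and> (\<forall>\<xi>\<in>L2 A. cinner \<zeta> \<xi> = cinner \<eta> (ext \<xi>))"
      unfolding cinner_eq_iff using \<zeta> by (auto simp: A.L2_scaleC ext_scaleC[symmetric] emb_scaleC)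
    fix \<zeta>' assume "\<zeta>' \<in> L2 A \<and> (\<forall>\<xi>\<in>L2 A. cinner \<zeta>' \<xi> = cinner \<eta> (ext \<xi>))"
    then show "\<zeta>' = \<zeta>"
      by (intro inner_eqI[OF _ \<zeta>(1) A.L2_subspace]) (auto simp: Re_cinner[symmetric] \<zeta>(2)[unfolded Re_cinner[symmetric]])
  qed
  with \<zeta> show "l2_cond_exp A B \<iota> \<eta> \<in> L2 A"
    and "\<xi> \<in> L2 A \<Longrightarrow> inner (l2_cond_exp A B \<iota> \<eta>) \<xi> = inner \<eta> (ext \<xi>)" by auto
qed

text \<open>The extended adjoint is an isometric involution and commutes with \<open>ext\<close>. In
  the pairing of the conditional expectation with a test vector it can therefore be moved to the
  test vector, through \<open>ext\<close>, and onto \<open>\<eta>\<close>, which it fixes.\<close>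

lemma l2_cond_exp_sa:
  assumes \<eta>: "\<eta> \<in> L2_sa B"
  shows "l2_cond_exp A B \<iota> \<eta> \<in> L2_sa A"
proof -
  have \<eta>B: "\<eta> \<in> L2 B" "B.adj.ext \<eta> = \<eta>" using \<eta> by (auto simp: L2_sa_def)
  let ?z = "l2_cond_exp A B \<iota> \<eta>"
  note z = l2_cond_exp[OF \<eta>B(1)]
  have "A.adj.ext ?z = ?z"
  proof (rule inner_eqI[OF A.adj.ext_in[OF z(1)] z(1) A.L2_subspace])
    fix \<xi> assume \<xi>: "\<xi> \<in> L2 A"
    have J: "A.adj.ext \<xi> \<in> L2 A" by (rule A.adj.ext_in[OF \<xi>])
    have "inner (A.adj.ext ?z) \<xi> = inner (A.adj.ext ?z) (A.adj.ext (A.adj.ext \<xi>))"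
      by (simp add: A.adj_adj \<xi>)
    also have "\<dots> = inner ?z (A.adj.ext \<xi>)" by (rule A.adj.ext_inner[OF z(1) J])
    also have "\<dots> = inner \<eta> (B.adj.ext (ext \<xi>))" by (simp add: z(2)[OF J] ext_adj[OF \<xi>])
    also have "\<dots> = inner (B.adj.ext \<eta>) (B.adj.ext (ext \<xi>))" by (simp add: \<eta>B(2))
    also have "\<dots> = inner \<eta> (ext \<xi>)" by (rule B.adj.ext_inner[OF \<eta>B(1) ext_in[OF \<xi>]])
    also have "\<dots> = inner ?z \<xi>" by (rule z(2)[OF \<xi>, symmetric])
    finally show "inner (A.adj.ext ?z) \<xi> = inner ?z \<xi>" .
  qed
  then show ?thesis using z(1) by (simp add: L2_sa_def)
qed

lemma embed_tuples: "X \<in> tuples A \<Longrightarrow> embed A B \<iota> X \<in> tuples B"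
  by (auto simp: tuples_def embed_def ext_L2_sa)

lemma cond_exp_tuples: "X \<in> tuples B \<Longrightarrow> cond_exp A B \<iota> X \<in> tuples A"
  by (auto simp: tuples_def cond_exp_def l2_cond_exp_sa)

lemma embed_scaleR: "X \<in> tuples A \<Longrightarrow> embed A B \<iota> (r *\<^sub>R X) = r *\<^sub>R embed A B \<iota> X"
  and embed_inner: "X \<in> tuples A \<Longrightarrow> Y \<in> tuples A \<Longrightarrow> inner (embed A B \<iota> X) (embed A B \<iota> Y) = inner X Y"
  by (auto simp: vec_eq_iff tuples_def embed_def L2_sa_def inner_vec_def ext_scaleR ext_inner)

lemma cond_exp_inner:
  "X \<in> tuples B \<Longrightarrow> Y \<in> tuples A \<Longrightarrow> inner (cond_exp A B \<iota> X) Y = inner X (embed A B \<iota> Y)"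
  by (auto simp: tuples_def embed_def cond_exp_def L2_sa_def inner_vec_def l2_cond_exp)

end

context tracial_wstar
begin

lemma id_embedding: "tracial_embedding A A id"
  by (simp add: tracial_embedding_def)

lemma embed_id:
  assumes "X \<in> tuples A"
  shows "embed A A id X = X"
proof -
  interpret trace_embedding A A id by unfold_locales (rule id_embedding)
  have ext_id: "l2_extend A A id \<xi> = \<xi>" if \<xi>: "\<xi> \<in> L2 A" for \<xi>
  proof -
    obtain a where a: "\<And>n::nat. a n \<in> Linf A" "(\<lambda>n. l2 A (a n)) \<longlonglongrightarrow> \<xi>" using \<xi> unfolding L2_iff by blast
    from ext_lim[OF a] have "(\<lambda>n. l2 A (a n)) \<longlonglongrightarrow> l2_extend A A id \<xi>" by simp
    then show ?thesis using a(2) by (rule LIMSEQ_unique)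
  qed
  have "X $ j \<in> L2 A" for j using assms by (simp add: tuples_def L2_sa_def)
  then show ?thesis by (simp add: vec_eq_iff embed_def ext_id)
qed

end

section \<open>The scalars as a tracial W*-algebra\<close>

lemma scaleC_add_left: "scaleC (a + b) x = scaleC a x + scaleC b x"
  by transfer (simp add: algebra_simps)

lemma scaleC_scaleC: "scaleC a (scaleC b x) = scaleC (a * b) x"
  by transfer (simp add: algebra_simps)

lemma scaleC_one: "scaleC 1 x = x"
  by transfer simp

lemma scaleC_zero: "scaleC 0 x = 0"
  by transfer simp

definition unit_vec :: ell2 where
  "unit_vec = Abs_ell2 (\<lambda>n. if n = 0 then 1 else 0)"

lemma cinner_unit_vec: "cinner unit_vec unit_vec = 1"
proof -
  have "summable (\<lambda>n::nat. (cmod (if n = 0 then 1 else 0))\<^sup>2)"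
    by (rule summable_finite[of "{0}"]) auto
  then have coeff: "coeff unit_vec = (\<lambda>n. if n = 0 then 1 else 0)"
    unfolding unit_vec_def by (simp add: Abs_ell2_inverse)
  have "cinner unit_vec unit_vec = (\<Sum>n\<in>{0::nat}. 1)"
    unfolding cinner_def coeff by (subst suminf_finite[of "{0}"]) auto
  then show ?thesis by simp
qed

lemma norm_unit_vec: "norm unit_vec = 1"
  by (simp add: norm_eq_sqrt_inner Re_cinner[symmetric] cinner_unit_vec)

definition scalar :: "complex \<Rightarrow> op" where
  "scalar c = op_scaleC c id_blinfun"

text \<open>A vector state, defined on all operators. On scalar operators it reads off the scalar,
  and as a single matrix entry it is continuous in both operator topologies.\<close>

definition scalar_trace :: "op \<Rightarrow> complex" where
  "scalar_trace T = cinner unit_vec (T unit_vec)"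

definition scalar_algebra :: tracial_algebra where
  "scalar_algebra = \<lparr>Linf = range scalar, trace = scalar_trace,
     l2 = (\<lambda>T. scaleC (scalar_trace T) unit_vec)\<rparr>"

lemma scalar_apply: "blinfun_apply (scalar c) x = scaleC c x"
  by (simp add: scalar_def op_scaleC_apply)

lemma scalar_trace_scalar [simp]: "scalar_trace (scalar c) = c"
  by (simp add: scalar_trace_def scalar_apply cinner_scaleC_right cinner_unit_vec)

lemma scalar_add: "scalar a + scalar b = scalar (a + b)"
  by (rule blinfun_eqI) (simp add: scalar_apply blinfun.add_left scaleC_add_left)

lemma scalar_comp: "scalar a o\<^sub>L scalar b = scalar (a * b)"
  by (rule blinfun_eqI) (simp add: scalar_apply scaleC_scaleC)

lemma op_scaleC_scalar: "op_scaleC c (scalar a) = scalar (c * a)"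
  by (rule blinfun_eqI) (simp add: scalar_apply op_scaleC_apply scaleC_scaleC)

lemma scalar_one: "scalar 1 = id_blinfun"
  by (rule blinfun_eqI) (simp add: scalar_apply scaleC_one)

lemma scalar_zero: "scalar 0 = 0"
  by (rule blinfun_eqI) (simp add: scalar_apply scaleC_zero)

lemma op_adj_scalar: "op_adj (scalar c) = scalar (cnj c)"
  by (rule op_adj_eqI) (simp add: scalar_apply cinner_scaleC_left cinner_scaleC_right)

lemma continuous_map_generated:
  assumes "\<And>U. open U \<Longrightarrow> {T. f T \<in> U} \<in> B"
  shows "continuous_map (topology_generated_by B) euclidean f"
proof -
  have "openin (topology_generated_by B) {T \<in> topspace (topology_generated_by B). f T \<in> U}" if "open U" for U
  proof -
    have op: "openin (topology_generated_by B) {T. f T \<in> U}"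
      by (rule topology_generated_by_Basis) (rule assms[OF that])
    then have "{T \<in> topspace (topology_generated_by B). f T \<in> U} = {T. f T \<in> U}"
      using openin_subset by blast
    with op show ?thesis by simp
  qed
  then show ?thesis by (simp add: continuous_map_def)
qed

lemma continuous_map_cmult:
  fixes f :: "'a \<Rightarrow> complex"
  assumes "continuous_map X euclidean f"
  shows "continuous_map X euclidean (\<lambda>T. c * f T)"
proof -
  have "continuous_map euclidean euclidean (\<lambda>z :: complex. c * z)"
    by (simp add: continuous_on_mult_left)
  from continuous_map_compose[OF assms this] show ?thesis by (simp add: o_def)
qed

lemma continuous_map_matrix_entry:
  "continuous_map weak_operator_topology euclidean (\<lambda>T. cinner x (blinfun_apply T y))"
  unfolding weak_operator_topology_def by (rule continuous_map_generated) auto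

text \<open>An operator is scalar exactly if each matrix entry equals \<open>cinner x y\<close>
  times its entry at \<open>unit_vec\<close>. Each of these equations compares two continuous
  functions, hence cuts out a closed set.\<close>

lemma closedin_scalars: "closedin weak_operator_topology (range scalar)"
proof -
  let ?t = "weak_operator_topology"
  let ?E = "\<lambda>(x, y). {T \<in> topspace ?t. cinner x (blinfun_apply T y) = cinner x y * scalar_trace T}"
  have "{T. cinner 0 (blinfun_apply T 0) \<in> UNIV} \<in> {{T. cinner x (blinfun_apply T y) \<in> U} | x y U. open U}"
    using open_UNIV by blast
  then have top: "topspace ?t = UNIV"
    unfolding weak_operator_topology_def topology_generated_by_topspace by blast
  have "closedin ?t (\<Inter>z\<in>UNIV. ?E z)"
  proof (rule closedin_INT)
    fix z :: "ell2 \<times> ell2"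
    obtain x y where z: "z = (x, y)" by fastforce
    have "closedin ?t {T \<in> topspace ?t. cinner x (blinfun_apply T y) = cinner x y * scalar_trace T}"
      unfolding scalar_trace_def
      by (rule closedin_continuous_maps_eq[OF Hausdorff_space_euclidean continuous_map_matrix_entry
            continuous_map_cmult[OF continuous_map_matrix_entry]])
    then show "closedin ?t (?E z)" by (simp add: z)
  qed simp
  also have "(\<Inter>z\<in>UNIV. ?E z) = range scalar"
  proof (intro set_eqI iffI)
    fix T assume "T \<in> range scalar"
    then show "T \<in> (\<Inter>z\<in>UNIV. ?E z)"
      by (auto simp: top scalar_apply cinner_scaleC_right)
  next
    fix T assume "T \<in> (\<Inter>z\<in>UNIV. ?E z)"
    then have T: "cinner x (T y) = cinner x y * scalar_trace T" for x y by auto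
    have "T y = scalar (scalar_trace T) y" for y
    proof (rule inner_eqI[of _ UNIV])
      show "inner (T y) x = inner (scalar (scalar_trace T) y) x" for x
      proof -
        have "inner x (T y) = inner x (scalar (scalar_trace T) y)"
          unfolding Re_cinner[symmetric] T by (simp add: scalar_apply cinner_scaleC_right mult.commute)
        then show ?thesis by (simp only: inner_commute)
      qed
    qed auto
    then have "T = scalar (scalar_trace T)" by (rule blinfun_eqI)
    then show "T \<in> range scalar" by (rule range_eqI)
  qed
  finally show ?thesis .
qed

lemma vn_scalars: "von_neumann_algebra (range scalar)"
proof -
  have "complex_linear_op (scalar c)" for c
    by (simp add: complex_linear_op_def scalar_apply scaleC_scaleC mult.commute)
  moreover have "id_blinfun \<in> range scalar" unfolding scalar_one[symmetric] by blast
  ultimately show ?thesis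
    unfolding von_neumann_algebra_def
    by (auto simp: scalar_add scalar_comp op_scaleC_scalar op_adj_scalar closedin_scalars)
qed

text \<open>A matrix entry is sigma-weakly continuous because it is the defining series of that
  topology with \<open>unit_vec\<close> at index 0 and zero elsewhere.\<close>

lemma scalar_trace_predual: "(\<lambda>T. c * scalar_trace T) \<in> predual (range scalar)"
proof -
  have "continuous_map sigma_weak_topology euclidean scalar_trace"
    unfolding sigma_weak_topology_def
  proof (rule continuous_map_generated)
    fix U :: "complex set" assume U: "open U"
    let ?x = "\<lambda>n::nat. if n = 0 then unit_vec else 0"
    have "cinner 0 y = 0" for y using cinner_scaleC_left[of 0 0 y] by (simp add: scaleC_zero)
    then have "(\<Sum>n. cinner (?x n) (blinfun_apply T (?x n))) = scalar_trace T" for T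
      by (subst suminf_finite[of "{0}"]) (auto simp: scalar_trace_def)
    moreover have "summable (\<lambda>n. (norm (?x n))\<^sup>2)" by (rule summable_finite[of "{0}"]) auto
    ultimately show "{T. scalar_trace T \<in> U} \<in> {{T. (\<Sum>n. cinner (x n) (blinfun_apply T (y n))) \<in> U} | x y U.
       summable (\<lambda>n. (norm (x n :: ell2))\<^sup>2) \<and> summable (\<lambda>n. (norm (y n :: ell2))\<^sup>2) \<and> open U}"
      using U by (intro CollectI exI[of _ ?x] exI[of _ U]) simp
  qed
  then have "continuous_map (subtopology sigma_weak_topology (range scalar)) euclidean (\<lambda>T. c * scalar_trace T)"
    by (intro continuous_map_from_subtopology continuous_map_cmult)
  then show ?thesis
    by (auto simp: predual_def complex_linear_functional_def scalar_add op_scaleC_scalar distrib_left)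
qed

text \<open>A functional on the scalars is determined by its value at the identity, so multiples of
  the trace by a countable dense set of complex numbers are norm dense.\<close>

lemma separable_scalars: "separable_predual (range scalar)"
proof -
  obtain Q :: "complex set" where Q: "countable Q" "\<And>X. open X \<Longrightarrow> X \<noteq> {} \<Longrightarrow> \<exists>q\<in>Q. q \<in> X"
    by (rule countable_dense_setE) blast
  show ?thesis
    unfolding separable_predual_def
  proof (intro exI conjI ballI allI impI)
    show "countable ((\<lambda>q T. q * scalar_trace T) ` Q)" using Q(1) by simp
    show "(\<lambda>q T. q * scalar_trace T) ` Q \<subseteq> predual (range scalar)" using scalar_trace_predual by blast
    fix \<phi> and \<epsilon> :: real assume \<phi>: "\<phi> \<in> predual (range scalar)" and \<epsilon>: "0 < \<epsilon>"
    obtain q where q: "q \<in> Q" "q \<in> ball (\<phi> (scalar 1)) \<epsilon>"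
      using Q(2)[of "ball (\<phi> (scalar 1)) \<epsilon>"] \<epsilon> by auto
    have "cmod (\<phi> a - q * scalar_trace a) \<le> \<epsilon>" if a: "a \<in> range scalar" "norm a \<le> 1" for a
    proof -
      obtain c where c: "a = scalar c" using a(1) by blast
      have "\<phi> (op_scaleC c (scalar 1)) = c * \<phi> (scalar 1)"
        using \<phi> unfolding predual_def complex_linear_functional_def by blast
      then have "\<phi> a = c * \<phi> (scalar 1)" by (simp add: op_scaleC_scalar c)
      then have "cmod (\<phi> a - q * scalar_trace a) = cmod c * cmod (\<phi> (scalar 1) - q)"
        by (simp add: c norm_mult[symmetric] algebra_simps)
      also have "\<dots> \<le> 1 * \<epsilon>"
      proof (rule mult_mono)
        have "cmod c = norm (a unit_vec)" by (simp add: c scalar_apply norm_scaleC norm_unit_vec)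
        also have "\<dots> \<le> norm a * norm unit_vec" by (rule norm_blinfun)
        finally show "cmod c \<le> 1" using a(2) by (simp add: norm_unit_vec)
      qed (use q in \<open>auto simp: dist_norm\<close>)
      finally show ?thesis by simp
    qed
    then show "\<exists>\<psi>\<in>(\<lambda>q T. q * scalar_trace T) ` Q.
        \<forall>a\<in>range scalar. norm a \<le> 1 \<longrightarrow> cmod (\<phi> a - \<psi> a) \<le> \<epsilon>"
      using q(1) by (intro bexI[of _ "\<lambda>T. q * scalar_trace T"]) auto
  qed
qed

lemma wstar_scalars: "tracial_wstar_algebra scalar_algebra"
proof -
  have sq: "cnj c * c = complex_of_real ((cmod c)\<^sup>2)" "c * cnj c = complex_of_real ((cmod c)\<^sup>2)" for c
    by (simp_all add: complex_norm_square mult.commute del: of_real_power)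
  have "faithful_normal_tracial_state (range scalar) scalar_trace"
    using scalar_trace_predual[of 1]
    by (auto simp: faithful_normal_tracial_state_def op_adj_scalar scalar_comp scalar_one[symmetric]
        sq mult.commute scalar_zero simp del: of_real_power)
  then show ?thesis
    by (auto simp: tracial_wstar_algebra_def scalar_algebra_def vn_scalars scalar_add op_scaleC_scalar
        scaleC_add_left scaleC_scaleC cinner_scaleC_left cinner_scaleC_right cinner_unit_vec op_adj_scalar scalar_comp)
qed

text \<open>The representative of the scalar algebra again consists of scalar operators, since the
  isomorphism is unital and complex linear. Every algebra contains those, and normalisation of the
  trace forces its values on them, so \<open>id\<close> is an embedding.\<close>

lemma representatives_initial:
  assumes W: "representatives W"
  obtains C where "C \<in> W" "\<And>A. A \<in> W \<Longrightarrow> \<exists>\<iota>. tracial_embedding C A \<iota>"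
proof -
  have "separable_predual (Linf scalar_algebra)"
    using separable_scalars by (simp add: scalar_algebra_def)
  then obtain C where C: "C \<in> W" "tracial_isomorphic scalar_algebra C"
    using W wstar_scalars unfolding representatives_def by blast
  then obtain j where j: "tracial_embedding scalar_algebra C j" "j ` range scalar = Linf C"
    unfolding tracial_isomorphic_def bij_betw_def scalar_algebra_def by auto
  have "tracial_wstar_algebra C" using W C(1) by (simp add: representatives_def)
  then interpret C: tracial_wstar C by unfold_locales
  have jid: "j (scalar 1) = scalar 1"
    using j(1) unfolding tracial_embedding_def scalar_one by blast
  have "j (op_scaleC c (scalar 1)) = op_scaleC c (j (scalar 1))" for c
    using j(1) unfolding tracial_embedding_def by (simp add: scalar_algebra_def)
  then have j_scalar: "j (scalar c) = scalar c" for c by (simp add: jid op_scaleC_scalar)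
  have LC: "Linf C = range scalar" using j(2) by (auto simp: j_scalar image_image)
  have traceC: "trace C (scalar c) = c" for c
    using C.trace_scaleC[of "scalar 1" c] C.trace_id C.Linf_id by (simp add: op_scaleC_scalar scalar_one[symmetric])
  have "tracial_embedding C A id" if A: "A \<in> W" for A
  proof -
    have "tracial_wstar_algebra A" using W A by (simp add: representatives_def)
    then interpret A: tracial_wstar A by unfold_locales
    have in_A: "scalar c \<in> Linf A" for c
      using A.Linf_scaleC[OF A.Linf_id, of c] by (simp add: scalar_def)
    have "trace A (scalar c) = c" for c
      using A.trace_scaleC[of "scalar 1" c] A.trace_id A.Linf_id by (simp add: op_scaleC_scalar scalar_one[symmetric])
    then show ?thesis using in_A by (auto simp: tracial_embedding_def LC traceC)
  qed
  then show ?thesis using that C(1) by blast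
qed

section \<open>Closure properties of convex lower semicontinuous functions\<close>

text \<open>Increasing affine maps are order isomorphisms of \<open>ereal\<close>, including the
  infinite values. This is how they are moved through suprema and infima below.\<close>

lemma ereal_affine_le_iff:
  fixes a c :: real and x z :: ereal
  assumes "c > 0"
  shows "ereal a + ereal c * x \<le> z \<longleftrightarrow> x \<le> ereal (1 / c) * (z - ereal a)"
    and "z \<le> ereal a + ereal c * x \<longleftrightarrow> ereal (1 / c) * (z - ereal a) \<le> x"
  using assms by (cases x; cases z; simp add: field_simps)+

lemma SUP_affine:
  assumes "c > 0"
  shows "(SUP y\<in>S. ereal a + ereal c * u y) = ereal a + ereal c * (SUP y\<in>S. u y)"
proof (rule antisym)
  show "ereal a + ereal c * (SUP y\<in>S. u y) \<le> (SUP y\<in>S. ereal a + ereal c * u y)"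
    unfolding ereal_affine_le_iff(1)[OF assms] SUP_le_iff
  proof
    fix y assume "y \<in> S"
    then show "u y \<le> ereal (1 / c) * ((SUP y\<in>S. ereal a + ereal c * u y) - ereal a)"
      unfolding ereal_affine_le_iff(1)[OF assms, symmetric] by (rule SUP_upper)
  qed
qed (intro SUP_least add_left_mono ereal_mult_left_mono SUP_upper, use assms in auto)

lemma INF_affine:
  assumes "c > 0"
  shows "(INF y\<in>S. ereal a + ereal c * u y) = ereal a + ereal c * (INF y\<in>S. u y)"
proof (rule antisym)
  show "(INF y\<in>S. ereal a + ereal c * u y) \<le> ereal a + ereal c * (INF y\<in>S. u y)"
    unfolding ereal_affine_le_iff(2)[OF assms] le_INF_iff
  proof
    fix y assume "y \<in> S"
    then show "ereal (1 / c) * ((INF y\<in>S. ereal a + ereal c * u y) - ereal a) \<le> u y"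
      unfolding ereal_affine_le_iff(2)[OF assms, symmetric] by (rule INF_lower)
  qed
qed (intro INF_greatest add_left_mono ereal_mult_left_mono INF_lower, use assms in auto)

lemma ereal_uminus_mult_uminus: "ereal c * x = ereal (- c) * (- x)"
  by (cases x) auto

lemma SUP_affine_neg:
  assumes "c < 0"
  shows "(SUP y\<in>S. ereal a + ereal c * u y) = ereal a + ereal c * (INF y\<in>S. u y)"
  unfolding ereal_uminus_mult_uminus[of c] ereal_SUP_uminus_eq[symmetric]
  by (rule SUP_affine) (use assms in simp)

lemma INF_affine_neg:
  assumes "c < 0"
  shows "(INF y\<in>S. ereal a + ereal c * u y) = ereal a + ereal c * (SUP y\<in>S. u y)"
  unfolding ereal_uminus_mult_uminus[of c] ereal_INF_uminus_eq[symmetric]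
  by (rule INF_affine) (use assms in simp)

text \<open>Separates a real optimisation from a constant \<open>e\<close> that may be infinite. It
  is used with \<open>r\<close> a quadratic and \<open>e\<close> a multiple of \<open>f A Y\<close>,
  so that completing the square is legitimate for every value of \<open>f\<close>.\<close>

lemma SUP_real_add:
  assumes "x0 \<in> S" "\<And>x. x \<in> S \<Longrightarrow> r x \<le> r x0"
  shows "(SUP x\<in>S. ereal (r x) + e) = ereal (r x0) + e"
  using assms by (intro antisym SUP_least SUP_upper2[OF assms(1)] add_right_mono) auto

lemma INF_real_add:
  assumes "x0 \<in> S" "\<And>x. x \<in> S \<Longrightarrow> r x0 \<le> r x"
  shows "(INF x\<in>S. ereal (r x) + e) = ereal (r x0) + e"
  using assms by (intro antisym INF_greatest INF_lower2[OF assms(1)] add_right_mono) auto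

definition closed_convex_on :: "'a::real_inner set \<Rightarrow> ('a \<Rightarrow> ereal) \<Rightarrow> bool" where
  "closed_convex_on S \<phi> \<longleftrightarrow> ereal_convex_on S \<phi> \<and> lsc_on S \<phi> \<and> (\<forall>x\<in>S. \<phi> x \<noteq> -\<infinity>)"

lemma norm_sq_convex:
  fixes x y :: "'a::real_inner"
  assumes "0 < r" "r < 1"
  shows "(norm ((1 - r) *\<^sub>R x + r *\<^sub>R y))\<^sup>2 \<le> (1 - r) * (norm x)\<^sup>2 + r * (norm y)\<^sup>2"
proof -
  have "(1 - r) * (norm x)\<^sup>2 + r * (norm y)\<^sup>2 - (norm ((1 - r) *\<^sub>R x + r *\<^sub>R y))\<^sup>2
      = r * (1 - r) * (norm (x - y))\<^sup>2"
    unfolding power2_norm_eq_inner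
    by (simp add: inner_diff_left inner_diff_right inner_add_left inner_add_right
        inner_commute[of y x] algebra_simps)
  also have "\<dots> \<ge> 0" using assms by simp
  finally show ?thesis by simp
qed

lemma closed_convex_on_combination:
  assumes S: "subspace S" and \<phi>: "closed_convex_on S \<phi>" and c: "c > 0" and d: "d \<ge> 0"
  shows "closed_convex_on S (\<lambda>x. ereal (d * (norm x)\<^sup>2) + ereal c * \<phi> x)"
  unfolding closed_convex_on_def
proof (intro conjI ballI)
  have ninf: "\<And>x. x \<in> S \<Longrightarrow> \<phi> x \<noteq> -\<infinity>" using \<phi> by (simp add: closed_convex_on_def)
  show "ereal (d * (norm x)\<^sup>2) + ereal c * \<phi> x \<noteq> -\<infinity>" if "x \<in> S" for x
    using ninf[OF that] c by (cases "\<phi> x") auto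
  show "ereal_convex_on S (\<lambda>x. ereal (d * (norm x)\<^sup>2) + ereal c * \<phi> x)"
    unfolding ereal_convex_on_def
  proof (intro ballI allI impI, elim conjE)
    fix x y r assume x: "x \<in> S" and y: "y \<in> S" and r: "0 < (r::real)" "r < 1"
    let ?z = "(1 - r) *\<^sub>R x + r *\<^sub>R y"
    have conv: "\<phi> ?z \<le> ereal (1 - r) * \<phi> x + ereal r * \<phi> y"
      using \<phi> x y r unfolding closed_convex_on_def ereal_convex_on_def by blast
    have z: "?z \<in> S" using S x y by (intro subspace_add subspace_scale)
    have n: "d * (norm ?z)\<^sup>2 \<le> d * ((1 - r) * (norm x)\<^sup>2 + r * (norm y)\<^sup>2)"
      by (rule mult_left_mono[OF norm_sq_convex[OF r] d])
    show "ereal (d * (norm ?z)\<^sup>2) + ereal c * \<phi> ?z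
        \<le> ereal (1 - r) * (ereal (d * (norm x)\<^sup>2) + ereal c * \<phi> x) + ereal r * (ereal (d * (norm y)\<^sup>2) + ereal c * \<phi> y)"
    proof (cases "\<phi> x = \<infinity> \<or> \<phi> y = \<infinity>")
      case True
      then show ?thesis using ninf[OF x] ninf[OF y] r c
        by (cases "\<phi> x"; cases "\<phi> y") auto
    next
      case False
      then obtain a b where ab: "\<phi> x = ereal a" "\<phi> y = ereal b"
        using ninf[OF x] ninf[OF y] by (cases "\<phi> x"; cases "\<phi> y") auto
      then obtain e where e: "\<phi> ?z = ereal e" using conv ninf[OF z] by (cases "\<phi> ?z") auto
      have "c * e \<le> c * ((1 - r) * a + r * b)" using conv c unfolding ab e by simp
      then show ?thesis unfolding ab e using n by (simp add: algebra_simps)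
    qed
  qed
  show "lsc_on S (\<lambda>x. ereal (d * (norm x)\<^sup>2) + ereal c * \<phi> x)"
    unfolding lsc_on_iff
  proof (intro ballI allI impI)
    fix x a assume x: "x \<in> S" and a: "a < ereal (d * (norm x)\<^sup>2) + ereal c * \<phi> x"
    show "\<exists>e>0. \<forall>y\<in>S. dist y x < e \<longrightarrow> a < ereal (d * (norm y)\<^sup>2) + ereal c * \<phi> y"
    proof (cases a)
      case (real a')
      have "ereal ((a' - d * (norm x)\<^sup>2) / c) < \<phi> x"
        using a c unfolding real by (cases "\<phi> x") (auto simp: field_simps)
      \<comment> \<open>The intermediate real \<open>b\<close> splits the strict gap: semicontinuity
        keeps \<open>\<phi> y\<close> above \<open>b\<close>, continuity of the norm keeps the
        quadratic above \<open>a' - c * b\<close>.\<close>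
      then obtain b where b: "ereal ((a' - d * (norm x)\<^sup>2) / c) < ereal b" "ereal b < \<phi> x"
        using ereal_dense2 by blast
      have ab: "d * (norm x)\<^sup>2 > a' - c * b" using b(1) c by (simp add: field_simps)
      obtain e1 where e1: "e1 > 0" "\<And>y. y \<in> S \<Longrightarrow> dist y x < e1 \<Longrightarrow> ereal b < \<phi> y"
        using lsc_onD[of S \<phi> x "ereal b"] x b(2) \<phi> unfolding closed_convex_on_def by blast
      have "((\<lambda>y. d * (norm y)\<^sup>2) \<longlongrightarrow> d * (norm x)\<^sup>2) (nhds x)"
        by (intro tendsto_intros filterlim_ident)
      from order_tendstoD(1)[OF this ab] obtain e2 where
        e2: "e2 > 0" "\<And>y. dist y x < e2 \<Longrightarrow> a' - c * b < d * (norm y)\<^sup>2"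
        unfolding eventually_nhds_metric by blast
      show ?thesis
      proof (intro exI[of _ "min e1 e2"] conjI ballI impI)
        fix y assume y: "y \<in> S" "dist y x < min e1 e2"
        have 1: "ereal b < \<phi> y" using e1(2) y by simp
        have 2: "a' - c * b < d * (norm y)\<^sup>2" using e2(2) y by simp
        show "a < ereal (d * (norm y)\<^sup>2) + ereal c * \<phi> y"
        proof (cases "\<phi> y")
          case (real w)
          then have "c * b < c * w" using 1 c by simp
          then show ?thesis using 2 real \<open>a = ereal a'\<close> by simp
        qed (use 1 c \<open>a = ereal a'\<close> in auto)
      qed (use e1 e2 in auto)
    next
      case MInf
      have "-\<infinity> < ereal (d * (norm y)\<^sup>2) + ereal c * \<phi> y" if "y \<in> S" for y
        using ninf[OF that] c by (cases "\<phi> y") auto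
      then show ?thesis using MInf by (auto intro: exI[of _ 1])
    qed (use a in auto)
  qed
qed

lemma closed_convex_on_const: "e \<noteq> -\<infinity> \<Longrightarrow> closed_convex_on S (\<lambda>_. e)"
  unfolding closed_convex_on_def ereal_convex_on_def lsc_on_iff
  by (cases e) (auto simp: algebra_simps intro: exI[of _ "1::real"])

lemma closed_convex_on_norm_sq:
  assumes "subspace S" "d \<ge> 0"
  shows "closed_convex_on S (\<lambda>x. ereal (d * (norm x)\<^sup>2))"
  using closed_convex_on_combination[OF assms(1) closed_convex_on_const[of 0] zero_less_one assms(2)] by simp

text \<open>A supremum of continuous affine functions, with the \<open>w\<close> where
  \<open>\<phi> w\<close> is infinite contributing constants; the point \<open>x0\<close> keeps it
  away from \<open>-\<infinity>\<close>.\<close>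

lemma closed_convex_on_fenchel:
  assumes x0: "x0 \<in> S" "\<phi> x0 \<noteq> \<infinity>"
  shows "closed_convex_on S (fenchel S \<phi>)"
  unfolding closed_convex_on_def
proof (intro conjI ballI)
  have up: "ereal (inner x y) - \<phi> y \<le> fenchel S \<phi> x" if "y \<in> S" for x y
    unfolding fenchel_def using that by (rule SUP_upper)
  show ninf: "fenchel S \<phi> x \<noteq> -\<infinity>" for x
    using up[OF x0(1), of x] x0(2) by (cases "\<phi> x0") auto
  show "ereal_convex_on S (fenchel S \<phi>)"
    unfolding ereal_convex_on_def
  proof (intro ballI allI impI, elim conjE)
    fix x y r assume r: "0 < (r::real)" "r < 1"
    show "fenchel S \<phi> ((1 - r) *\<^sub>R x + r *\<^sub>R y) \<le> ereal (1 - r) * fenchel S \<phi> x + ereal r * fenchel S \<phi> y"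
      unfolding fenchel_def[of S \<phi> "(1 - r) *\<^sub>R x + r *\<^sub>R y"]
    proof (rule SUP_least)
      fix w assume w: "w \<in> S"
      have "ereal (inner ((1 - r) *\<^sub>R x + r *\<^sub>R y) w) - \<phi> w
          = ereal (1 - r) * (ereal (inner x w) - \<phi> w) + ereal r * (ereal (inner y w) - \<phi> w)"
        using r by (cases "\<phi> w") (auto simp: inner_add_left algebra_simps)
      also have "\<dots> \<le> ereal (1 - r) * fenchel S \<phi> x + ereal r * fenchel S \<phi> y"
        using r by (intro add_mono ereal_mult_left_mono up w) auto
      finally show "ereal (inner ((1 - r) *\<^sub>R x + r *\<^sub>R y) w) - \<phi> w
          \<le> ereal (1 - r) * fenchel S \<phi> x + ereal r * fenchel S \<phi> y" .
    qed
  qed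
  show "lsc_on S (fenchel S \<phi>)"
    unfolding lsc_on_iff
  proof (intro ballI allI impI)
    fix x a assume "a < fenchel S \<phi> x"
    then obtain w where w: "w \<in> S" "a < ereal (inner x w) - \<phi> w"
      unfolding fenchel_def less_SUP_iff by blast
    have ev: "\<exists>e>0. \<forall>y. dist y x < e \<longrightarrow> a < ereal (inner y w) - \<phi> w"
    proof (cases "\<phi> w")
      case (real v)
      have "((\<lambda>y. ereal (inner y w - v)) \<longlongrightarrow> ereal (inner x w - v)) (nhds x)"
        by (intro tendsto_intros filterlim_ident)
      from order_tendstoD(1)[OF this, of a] w(2) show ?thesis
        unfolding eventually_nhds_metric by (simp add: real)
    qed (use w in \<open>auto intro: exI[of _ "1::real"]\<close>)
    then show "\<exists>e>0. \<forall>y\<in>S. dist y x < e \<longrightarrow> a < fenchel S \<phi> y"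
      using up[OF w(1)] less_le_trans by blast
  qed
qed

text \<open>A finite function with a supporting affine function at every point is the supremum of
  these. The criterion is meant for \<open>k s\<close>, whose definition as a difference hides its
  convexity.\<close>

lemma closed_convex_on_subdiff:
  assumes S: "subspace S"
    and sub: "\<And>x. x \<in> S \<Longrightarrow> \<bar>\<phi> x\<bar> \<noteq> \<infinity> \<and> subdiff S \<phi> x \<noteq> {}"
  shows "closed_convex_on S \<phi>"
  unfolding closed_convex_on_def
proof (intro conjI ballI)
  have ge: "\<exists>v p. \<phi> x = ereal v \<and> (\<forall>y\<in>S. ereal (v + inner p (y - x)) \<le> \<phi> y)" if "x \<in> S" for x
    using sub[OF that] unfolding subdiff_def by (cases "\<phi> x") auto
  show "\<phi> x \<noteq> -\<infinity>" if "x \<in> S" for x using sub[OF that] by auto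
  show "ereal_convex_on S \<phi>"
    unfolding ereal_convex_on_def
  proof (intro ballI allI impI, elim conjE)
    fix x y r assume x: "x \<in> S" and y: "y \<in> S" and r: "0 < (r::real)" "r < 1"
    let ?z = "(1 - r) *\<^sub>R x + r *\<^sub>R y"
    have z: "?z \<in> S" using S x y by (intro subspace_add subspace_scale)
    obtain v p where v: "\<phi> ?z = ereal v" "\<And>y. y \<in> S \<Longrightarrow> ereal (v + inner p (y - ?z)) \<le> \<phi> y"
      using ge[OF z] by blast
    obtain a b where ab: "\<phi> x = ereal a" "\<phi> y = ereal b" using ge[OF x] ge[OF y] by blast
    have "(1 - r) * (v + inner p (x - ?z)) + r * (v + inner p (y - ?z)) \<le> (1 - r) * a + r * b"
      using v(2)[OF x] v(2)[OF y] r unfolding ab by (intro add_mono mult_left_mono) auto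
    moreover have "(1 - r) * (v + inner p (x - ?z)) + r * (v + inner p (y - ?z)) = v"
      by (simp add: inner_diff_right inner_add_right algebra_simps)
    ultimately show "\<phi> ?z \<le> ereal (1 - r) * \<phi> x + ereal r * \<phi> y" unfolding ab v(1) by simp
  qed
  show "lsc_on S \<phi>"
    unfolding lsc_on_iff
  proof (intro ballI allI impI)
    fix x a assume x: "x \<in> S" and a: "a < \<phi> x"
    obtain v p where v: "\<phi> x = ereal v" "\<And>y. y \<in> S \<Longrightarrow> ereal (v + inner p (y - x)) \<le> \<phi> y"
      using ge[OF x] by blast
    have "((\<lambda>y. ereal (v + inner p (y - x))) \<longlongrightarrow> ereal (v + inner p (x - x))) (nhds x)"
      by (intro tendsto_intros filterlim_ident)
    from order_tendstoD(1)[OF this, of a] a v(1)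
    obtain e where "e > 0" "\<And>y. dist y x < e \<Longrightarrow> a < ereal (v + inner p (y - x))"
      unfolding eventually_nhds_metric by auto
    then show "\<exists>e>0. \<forall>y\<in>S. dist y x < e \<longrightarrow> a < \<phi> y"
      using v(2) less_le_trans by blast
  qed
qed

section \<open>\<open>E\<close>-convex functions\<close>

text \<open>The part of \<open>E_convex\<close> that compares different algebras. It holds uniformly
  for the constant \<open>-\<infinity>\<close> and for the regular case, and reducing Legendre
  transforms and inf-convolutions to one algebra rests on it.\<close>

definition E_monotone :: "tracial_algebra set \<Rightarrow> ('n::finite) wfun \<Rightarrow> bool" where
  "E_monotone W f \<longleftrightarrow> tracial_function W f \<and>
     (\<forall>A\<in>W. \<forall>B\<in>W. \<forall>\<iota>. tracial_embedding A B \<iota> \<longrightarrow>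
        (\<forall>X\<in>tuples B. f A (cond_exp A B \<iota> X) \<le> f B X))"

lemma E_monotoneI:
  assumes "\<And>A B \<iota> X. A \<in> W \<Longrightarrow> B \<in> W \<Longrightarrow> tracial_embedding A B \<iota> \<Longrightarrow> X \<in> tuples A \<Longrightarrow> f A X = f B (embed A B \<iota> X)"
    and "\<And>A B \<iota> X. A \<in> W \<Longrightarrow> B \<in> W \<Longrightarrow> tracial_embedding A B \<iota> \<Longrightarrow> X \<in> tuples B \<Longrightarrow> f A (cond_exp A B \<iota> X) \<le> f B X"
  shows "E_monotone W f"
  using assms unfolding E_monotone_def tracial_function_def by blast

lemma E_monotone_embed:
    "E_monotone W f \<Longrightarrow> A \<in> W \<Longrightarrow> B \<in> W \<Longrightarrow> tracial_embedding A B \<iota> \<Longrightarrow> X \<in> tuples A \<Longrightarrow> f A X = f B (embed A B \<iota> X)"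
  and E_monotone_cond_exp:
    "E_monotone W f \<Longrightarrow> A \<in> W \<Longrightarrow> B \<in> W \<Longrightarrow> tracial_embedding A B \<iota> \<Longrightarrow> Y \<in> tuples B \<Longrightarrow> f A (cond_exp A B \<iota> Y) \<le> f B Y"
  unfolding E_monotone_def tracial_function_def by blast+

lemma E_convexI:
  "E_monotone W f \<Longrightarrow> (\<And>A. A \<in> W \<Longrightarrow> closed_convex_on (tuples A) (f A)) \<Longrightarrow> E_convex W f"
  unfolding E_convex_def E_monotone_def closed_convex_on_def by blast

locale representing =
  fixes W :: "tracial_algebra set"
  assumes W: "representatives W"
begin

lemma wstar_W: "A \<in> W \<Longrightarrow> tracial_wstar A"
  using W unfolding representatives_def tracial_wstar_def by blast

lemma embedding_W: "A \<in> W \<Longrightarrow> B \<in> W \<Longrightarrow> tracial_embedding A B \<iota> \<Longrightarrow> trace_embedding A B \<iota>"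
  by (intro trace_embedding.intro trace_embedding_axioms.intro wstar_W)

lemmas subspace_tuples = tracial_wstar.tuples_subspace[OF wstar_W]
  and closed_tuples = tracial_wstar.tuples_closed[OF wstar_W]
  and id_embedding_W = tracial_wstar.id_embedding[OF wstar_W]
  and embed_id_W = tracial_wstar.embed_id[OF wstar_W]
  and embed_in = trace_embedding.embed_tuples[OF embedding_W]
  and cond_exp_in = trace_embedding.cond_exp_tuples[OF embedding_W]
  and inner_embed = trace_embedding.embed_inner[OF embedding_W]
  and inner_cond_exp = trace_embedding.cond_exp_inner[OF embedding_W]
  and embed_scale = trace_embedding.embed_scaleR[OF embedding_W]

lemma zero_tuples: "A \<in> W \<Longrightarrow> 0 \<in> tuples A"
  by (rule subspace_0[OF subspace_tuples])

lemma norm_embed: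
  assumes "A \<in> W" "B \<in> W" "tracial_embedding A B \<iota>" "X \<in> tuples A"
  shows "norm (embed A B \<iota> X) = norm X"
  by (simp add: norm_eq_sqrt_inner inner_embed[OF assms assms(4)])

text \<open>The vector \<open>?V\<close> is paired with itself and transported to \<open>B\<close>
  by adjointness, where Cauchy-Schwarz and the isometry of \<open>embed\<close> bound the
  pairing.\<close>

lemma norm_cond_exp_diff:
  assumes i: "A \<in> W" "B \<in> W" "tracial_embedding A B \<iota>" and X: "X \<in> tuples B" and Y: "Y \<in> tuples B"
  shows "norm (cond_exp A B \<iota> X - a *\<^sub>R cond_exp A B \<iota> Y) \<le> norm (X - a *\<^sub>R Y)"
proof -
  let ?E = "cond_exp A B \<iota>"
  let ?V = "?E X - a *\<^sub>R ?E Y"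
  have V: "?V \<in> tuples A"
    using subspace_tuples[OF i(1)] cond_exp_in[OF i X] cond_exp_in[OF i Y]
    by (intro subspace_diff subspace_scale)
  have "norm ?V * norm ?V = inner ?V ?V" by (simp add: power2_norm_eq_inner[symmetric] power2_eq_square)
  also have "\<dots> = inner (?E X) ?V - a * inner (?E Y) ?V" by (simp only: inner_diff_left inner_scaleR_left)
  also have "\<dots> = inner (X - a *\<^sub>R Y) (embed A B \<iota> ?V)"
    by (simp only: inner_cond_exp[OF i X V] inner_cond_exp[OF i Y V] inner_diff_left inner_scaleR_left)
  also have "\<dots> \<le> norm (X - a *\<^sub>R Y) * norm ?V"
    using norm_cauchy_schwarz[of "X - a *\<^sub>R Y" "embed A B \<iota> ?V"] by (simp only: norm_embed[OF i V])
  finally show ?thesis by (metis mult_right_le_imp_le norm_ge_zero order_le_less)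
qed

lemma norm_cond_exp:
  assumes i: "A \<in> W" "B \<in> W" "tracial_embedding A B \<iota>" and X: "X \<in> tuples B"
  shows "norm (cond_exp A B \<iota> X) \<le> norm X"
  using norm_cond_exp_diff[OF i X X, of 0] by simp

lemma E_convex_monotone:
  assumes "E_convex W f" shows "E_monotone W f"
  using assms cond_exp_in unfolding E_convex_def E_monotone_def by fastforce

text \<open>\<open>f A\<close> cannot be identically \<open>\<infinity>\<close> for one \<open>A\<close> only: restrict along the scalars.\<close>

lemma E_convex_cases:
  assumes f: "E_convex W f"
  obtains (minus) "\<And>A X. A \<in> W \<Longrightarrow> X \<in> tuples A \<Longrightarrow> f A X = -\<infinity>"
  | (plus) "\<And>A X. A \<in> W \<Longrightarrow> X \<in> tuples A \<Longrightarrow> f A X = \<infinity>"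
  | (proper) "\<And>A. A \<in> W \<Longrightarrow> closed_convex_on (tuples A) (f A)" "\<And>A. A \<in> W \<Longrightarrow> \<exists>X\<in>tuples A. f A X \<noteq> \<infinity>"
proof (cases "\<forall>A\<in>W. \<forall>X\<in>tuples A. f A X = -\<infinity>")
  case True then show ?thesis using minus by blast
next
  case False
  then have cc: "\<And>A. A \<in> W \<Longrightarrow> closed_convex_on (tuples A) (f A)"
    using f unfolding E_convex_def closed_convex_on_def by blast
  show ?thesis
  proof (cases "\<forall>A\<in>W. \<forall>X\<in>tuples A. f A X = \<infinity>")
    case True then show ?thesis using plus by blast
  next
    case False
    then obtain B Y where B: "B \<in> W" "Y \<in> tuples B" "f B Y \<noteq> \<infinity>" by blast
    obtain C where C: "C \<in> W" "\<And>A. A \<in> W \<Longrightarrow> \<exists>\<iota>. tracial_embedding C A \<iota>"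
      using representatives_initial[OF W] by blast
    obtain j where j: "tracial_embedding C B j" using C(2)[OF B(1)] by blast
    \<comment> \<open>The point where \<open>f\<close> is below \<open>\<infinity>\<close> is pushed
      down from \<open>B\<close> to the scalars by conditional expectation, which can only lower
      \<open>f\<close>, and then up into any \<open>A\<close> by an embedding, which preserves
      \<open>f\<close>.\<close>
    let ?Z = "cond_exp C B j Y"
    have Z: "?Z \<in> tuples C" by (rule cond_exp_in[OF C(1) B(1) j B(2)])
    have "f C ?Z \<le> f B Y"
      using E_convex_monotone[OF f] C(1) B j unfolding E_monotone_def by blast
    then have fZ: "f C ?Z \<noteq> \<infinity>" using B(3) by auto
    have "\<exists>X\<in>tuples A. f A X \<noteq> \<infinity>" if A: "A \<in> W" for A
    proof -
      obtain i where i: "tracial_embedding C A i" using C(2)[OF A] by blast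
      have "f C ?Z = f A (embed C A i ?Z)"
        using E_convex_monotone[OF f] C(1) A i Z unfolding E_monotone_def tracial_function_def by blast
      then show ?thesis using fZ embed_in[OF C(1) A i Z] by metis
    qed
    then show ?thesis using proper cc by blast
  qed
qed

text \<open>Only values on \<open>tuples A\<close> carry meaning, so \<open>E_convex\<close> has to
  be transferable between functions that agree there. This works since embeddings, conditional
  expectations and convex combinations all stay within tuples.\<close>

lemma E_convex_cong:
  fixes f g :: "('n::finite) wfun"
  assumes eq: "\<And>A X. A \<in> W \<Longrightarrow> X \<in> tuples A \<Longrightarrow> f A X = g A X" and f: "E_convex W f"
  shows "E_convex W g"
proof -
  have "E_monotone W g"
  proof (rule E_monotoneI)
    fix A B \<iota> assume i: "A \<in> W" "B \<in> W" "tracial_embedding A B \<iota>"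
    show "g A X = g B (embed A B \<iota> X)" if X: "X \<in> tuples A" for X
      using E_monotone_embed[OF E_convex_monotone[OF f] i X] by (simp only: eq[OF i(1) X] eq[OF i(2) embed_in[OF i X]])
    show "g A (cond_exp A B \<iota> X) \<le> g B X" if X: "X \<in> tuples B" for X
      using E_monotone_cond_exp[OF E_convex_monotone[OF f] i X] by (simp only: eq[OF i(2) X] eq[OF i(1) cond_exp_in[OF i X]])
  qed
  show ?thesis
  proof (cases "\<forall>A\<in>W. \<forall>X\<in>tuples A. f A X = -\<infinity>")
    case True
    then have "\<forall>A\<in>W. \<forall>X\<in>tuples A. g A X = -\<infinity>" using eq by metis
    then show ?thesis using \<open>E_monotone W g\<close> unfolding E_convex_def E_monotone_def by blast
  next
    case False
    show ?thesis
    proof (rule E_convexI[OF \<open>E_monotone W g\<close>])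
      fix A assume A: "A \<in> W"
      have "closed_convex_on (tuples A) (f A)"
        using f False A unfolding E_convex_def closed_convex_on_def by blast
      moreover have "(1 - r) *\<^sub>R X + r *\<^sub>R Y \<in> tuples A"
        if "X \<in> tuples A" "Y \<in> tuples A" for r and X Y :: "ell2 ^ 'n"
        using that subspace_tuples[OF A] by (intro subspace_add subspace_scale)
      ultimately show "closed_convex_on (tuples A) (g A)"
        unfolding closed_convex_on_def ereal_convex_on_def lsc_on_iff by (simp add: eq[OF A])
    qed
  qed
qed

lemma E_convex_infinite:
  fixes f :: "('n::finite) wfun"
  assumes "\<And>A X. A \<in> W \<Longrightarrow> X \<in> tuples A \<Longrightarrow> f A X = e" "\<bar>e\<bar> = \<infinity>"
  shows "E_convex W f"
proof (rule E_convex_cong)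
  show "E_convex W (\<lambda>_ (_ :: ell2 ^ 'n). e)"
  proof (cases "e = -\<infinity>")
    case True then show ?thesis by (simp add: E_convex_def tracial_function_def)
  next
    case False then show ?thesis
      by (intro E_convexI closed_convex_on_const) (auto simp: E_monotone_def tracial_function_def)
  qed
qed (use assms in simp)

lemma E_monotone_q1: "E_monotone W q1"
  unfolding E_monotone_def tracial_function_def q1_def
  by (auto simp: norm_embed norm_cond_exp)

lemma E_monotone_combination:
  assumes "E_monotone W f" "c \<ge> 0" "d \<ge> 0"
  shows "E_monotone W (\<lambda>A X. ereal d * q1 A X + ereal c * f A X)"
proof (rule E_monotoneI)
  fix A B \<iota> assume i: "A \<in> W" "B \<in> W" "tracial_embedding A B \<iota>"
  show "ereal d * q1 A X + ereal c * f A X = ereal d * q1 B (embed A B \<iota> X) + ereal c * f B (embed A B \<iota> X)"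
    if X: "X \<in> tuples A" for X
    by (simp only: E_monotone_embed[OF assms(1) i X] E_monotone_embed[OF E_monotone_q1 i X])
  show "ereal d * q1 A (cond_exp A B \<iota> X) + ereal c * f A (cond_exp A B \<iota> X) \<le> ereal d * q1 B X + ereal c * f B X"
    if X: "X \<in> tuples B" for X
    using E_monotone_cond_exp[OF assms(1) i X] E_monotone_cond_exp[OF E_monotone_q1 i X] assms(2,3)
    by (intro add_mono ereal_mult_left_mono) auto
qed

lemma E_convex_combination:
  fixes f :: "('n::finite) wfun"
  assumes f: "E_convex W f" and c: "c \<ge> 0" and d: "d \<ge> 0"
  shows "E_convex W (\<lambda>A X. ereal d * q1 A X + ereal c * f A X)"
proof -
  note mono = E_monotone_combination[OF E_convex_monotone[OF f] c d]
  have q: "ereal d * q1 A X = ereal (d / 2 * (norm X)\<^sup>2)" for A and X :: "ell2 ^ 'n" by (simp add: q1_def)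
  show ?thesis
  proof (cases "c = 0")
    \<comment> \<open>With the convention for zero times infinity, \<open>f\<close> disappears here
      even where it is infinite, and the pure quadratic remains.\<close>
    case True
    have "closed_convex_on (tuples A) (\<lambda>X :: ell2 ^ 'n. ereal (d / 2 * (norm X)\<^sup>2))" if "A \<in> W" for A
      using d by (intro closed_convex_on_norm_sq subspace_tuples[OF that]) simp
    then show ?thesis
      by (intro E_convexI[OF mono]) (simp add: True q flip: zero_ereal_def)
  next
    case False
    then have c: "c > 0" using c by simp
    show ?thesis
    proof (cases "\<forall>A\<in>W. \<forall>X\<in>tuples A. f A X = -\<infinity>")
      case True
      then show ?thesis using c by (intro E_convex_infinite[of _ "-\<infinity>"]) (auto simp: q)
    next
      case False
      show ?thesis
      proof (rule E_convexI[OF mono])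
        fix A assume A: "A \<in> W"
        have "closed_convex_on (tuples A) (f A)"
          using f False A unfolding E_convex_def closed_convex_on_def by blast
        then show "closed_convex_on (tuples A) (\<lambda>X. ereal d * q1 A X + ereal c * f A X)"
          unfolding q using c d by (intro closed_convex_on_combination subspace_tuples[OF A]) auto
      qed
    qed
  qed
qed

lemma E_convex_scale: "E_convex W f \<Longrightarrow> c \<ge> 0 \<Longrightarrow> E_convex W (\<lambda>A X. ereal c * f A X)"
  using E_convex_combination[of f c 0] by (simp add: zero_ereal_def[symmetric])

text \<open>Obtained from the combination lemma with coefficient 0 on the constant
  \<open>\<infinity>\<close>.\<close>

lemma E_convex_q1: "E_convex W q1"
  using E_convex_combination[OF E_convex_infinite[of "\<lambda>_ _. \<infinity>" \<infinity>], of 0 1]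
  by (simp add: zero_ereal_def[symmetric] one_ereal_def[symmetric])

text \<open>Replacing \<open>Y\<close> in a larger algebra by its conditional expectation keeps the
  pairing with the embedded \<open>X\<close> and does not raise \<open>f\<close>; so nothing is
  gained beyond \<open>A\<close>. Conversely \<open>A\<close> itself occurs, through
  \<open>id\<close>.\<close>

lemma legendre_eq:
  fixes f :: "('n::finite) wfun"
  assumes f: "E_monotone W f" and A: "A \<in> W" and X: "X \<in> tuples A"
  shows "legendre W f A X = fenchel (tuples A) (f A) X"
  unfolding legendre_def fenchel_def
proof (rule antisym)
  show "Sup {ereal (inner (embed A B \<iota> X) Y) - f B Y | B \<iota> Y. B \<in> W \<and> tracial_embedding A B \<iota> \<and> Y \<in> tuples B}
      \<le> (SUP Y\<in>tuples A. ereal (inner X Y) - f A Y)"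
  proof (rule Sup_least, clarify)
    fix B \<iota> and Y :: "ell2 ^ 'n" assume B: "B \<in> W" "tracial_embedding A B \<iota>" and Y: "Y \<in> tuples B"
    let ?E = "cond_exp A B \<iota> Y"
    have "f A ?E \<le> f B Y" using f A B Y unfolding E_monotone_def by blast
    moreover have "inner (embed A B \<iota> X) Y = inner X ?E"
      using inner_cond_exp[OF A B Y X] by (simp add: inner_commute)
    ultimately have "ereal (inner (embed A B \<iota> X) Y) - f B Y \<le> ereal (inner X ?E) - f A ?E"
      by (simp add: ereal_minus_mono)
    then show "ereal (inner (embed A B \<iota> X) Y) - f B Y \<le> (SUP Y\<in>tuples A. ereal (inner X Y) - f A Y)"
      by (rule SUP_upper2[OF cond_exp_in[OF A B Y]])
  qed
  show "(SUP Y\<in>tuples A. ereal (inner X Y) - f A Y)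
      \<le> Sup {ereal (inner (embed A B \<iota> X) Y) - f B Y | B \<iota> Y. B \<in> W \<and> tracial_embedding A B \<iota> \<and> Y \<in> tuples B}"
  proof (rule SUP_least, rule Sup_upper, intro CollectI exI conjI)
    fix Y :: "ell2 ^ 'n" assume "Y \<in> tuples A"
    then show "Y \<in> tuples A" .
    show "ereal (inner X Y) - f A Y = ereal (inner (embed A A id X) Y) - f A Y"
      by (simp add: embed_id_W[OF A X])
  qed (use A id_embedding_W[OF A] in auto)
qed

text \<open>Passing from \<open>Y\<close> to its conditional expectation does not raise either
  summand. The premise \<open>f_diff\<close> is this statement for the first summand, with the
  expectation of \<open>embed A B \<iota> X - Y\<close> already written as \<open>X\<close> minus
  that of \<open>Y\<close>.\<close>

lemma inf_convolution_eq:
  fixes f g :: "('n::finite) wfun"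
  assumes f: "E_monotone W f" and g: "E_monotone W g" and A: "A \<in> W" and X: "X \<in> tuples A"
    and f_diff: "\<And>B \<iota> Y. B \<in> W \<Longrightarrow> tracial_embedding A B \<iota> \<Longrightarrow> Y \<in> tuples B \<Longrightarrow>
      f A (X - cond_exp A B \<iota> Y) \<le> f B (embed A B \<iota> X - Y)"
  shows "inf_convolution W f g A X = (INF Y\<in>tuples A. f A (X - Y) + g A Y)"
  unfolding inf_convolution_def
proof (rule antisym)
  show "(INF Y\<in>tuples A. f A (X - Y) + g A Y)
      \<le> Inf {f B (embed A B \<iota> X - Y) + g B Y | B \<iota> Y. B \<in> W \<and> tracial_embedding A B \<iota> \<and> Y \<in> tuples B}"
  proof (rule Inf_greatest, clarify)
    fix B \<iota> and Y :: "ell2 ^ 'n" assume B: "B \<in> W" "tracial_embedding A B \<iota>" and Y: "Y \<in> tuples B"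
    have "g A (cond_exp A B \<iota> Y) \<le> g B Y" using g A B Y unfolding E_monotone_def by blast
    then have "f A (X - cond_exp A B \<iota> Y) + g A (cond_exp A B \<iota> Y) \<le> f B (embed A B \<iota> X - Y) + g B Y"
      by (intro add_mono f_diff B Y)
    then show "(INF Y\<in>tuples A. f A (X - Y) + g A Y) \<le> f B (embed A B \<iota> X - Y) + g B Y"
      by (rule INF_lower2[OF cond_exp_in[OF A B Y]])
  qed
  show "Inf {f B (embed A B \<iota> X - Y) + g B Y | B \<iota> Y. B \<in> W \<and> tracial_embedding A B \<iota> \<and> Y \<in> tuples B}
      \<le> (INF Y\<in>tuples A. f A (X - Y) + g A Y)"
  proof (rule INF_greatest, rule Inf_lower, intro CollectI exI conjI)
    fix Y :: "ell2 ^ 'n" assume "Y \<in> tuples A"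
    then show "Y \<in> tuples A" .
    show "f A (X - Y) + g A Y = f A (embed A A id X - Y) + g A Y"
      by (simp add: embed_id_W[OF A X])
  qed (use A id_embedding_W[OF A] in auto)
qed

text \<open>Testing only against embedded vectors of \<open>A\<close> gives monotonicity; for an
  embedded argument, replacing test vectors by their expectations shows that larger algebras do not
  increase the supremum.\<close>

lemma E_monotone_fenchel:
  fixes f :: "('n::finite) wfun"
  assumes f: "E_monotone W f"
  shows "E_monotone W (\<lambda>A. fenchel (tuples A) (f A))"
proof -
  have le: "fenchel (tuples A) (f A) (cond_exp A B \<iota> X) \<le> fenchel (tuples B) (f B) X"
    if i: "A \<in> W" "B \<in> W" "tracial_embedding A B \<iota>" and X: "X \<in> tuples B" for A B \<iota> and X :: "ell2 ^ 'n"
    unfolding fenchel_def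
  proof (rule SUP_least)
    fix Y :: "ell2 ^ 'n" assume Y: "Y \<in> tuples A"
    have "f A Y = f B (embed A B \<iota> Y)"
      using f i Y unfolding E_monotone_def tracial_function_def by blast
    then show "ereal (inner (cond_exp A B \<iota> X) Y) - f A Y \<le> (SUP Y\<in>tuples B. ereal (inner X Y) - f B Y)"
      by (intro SUP_upper2[OF embed_in[OF i Y]]) (simp add: inner_cond_exp[OF i X Y])
  qed
  have eq: "fenchel (tuples A) (f A) X = fenchel (tuples B) (f B) (embed A B \<iota> X)"
    if i: "A \<in> W" "B \<in> W" "tracial_embedding A B \<iota>" and X: "X \<in> tuples A" for A B \<iota> and X :: "ell2 ^ 'n"
  proof (rule antisym)
    show "fenchel (tuples A) (f A) X \<le> fenchel (tuples B) (f B) (embed A B \<iota> X)"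
      unfolding fenchel_def
    proof (rule SUP_least)
      fix Y :: "ell2 ^ 'n" assume Y: "Y \<in> tuples A"
      have "f A Y = f B (embed A B \<iota> Y)"
        using f i Y unfolding E_monotone_def tracial_function_def by blast
      then show "ereal (inner X Y) - f A Y \<le> (SUP Y\<in>tuples B. ereal (inner (embed A B \<iota> X) Y) - f B Y)"
        by (intro SUP_upper2[OF embed_in[OF i Y]]) (simp add: inner_embed[OF i X Y])
    qed
    show "fenchel (tuples B) (f B) (embed A B \<iota> X) \<le> fenchel (tuples A) (f A) X"
      unfolding fenchel_def
    proof (rule SUP_least)
      fix Y :: "ell2 ^ 'n" assume Y: "Y \<in> tuples B"
      have "f A (cond_exp A B \<iota> Y) \<le> f B Y" using f i Y unfolding E_monotone_def by blast
      moreover have "inner (embed A B \<iota> X) Y = inner X (cond_exp A B \<iota> Y)"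
        using inner_cond_exp[OF i Y X] by (simp add: inner_commute)
      ultimately show "ereal (inner (embed A B \<iota> X) Y) - f B Y \<le> (SUP Y\<in>tuples A. ereal (inner X Y) - f A Y)"
        by (intro SUP_upper2[OF cond_exp_in[OF i Y]]) (simp add: ereal_minus_mono)
    qed
  qed
  show ?thesis unfolding E_monotone_def tracial_function_def using le eq by blast
qed

lemma fenchel_infinite:
  fixes \<phi> :: "ell2 ^ 'n::finite \<Rightarrow> ereal"
  assumes "A \<in> W" "\<And>X. X \<in> tuples A \<Longrightarrow> \<phi> X = e" "\<bar>e\<bar> = \<infinity>"
  shows "fenchel (tuples A) \<phi> X = - e"
proof -
  have "fenchel (tuples A) \<phi> X = (SUP Y\<in>(tuples A :: (ell2 ^ 'n) set). - e)"
    unfolding fenchel_def using assms by (intro SUP_cong) (auto simp: minus_ereal_def)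
  also have "\<dots> = - e" using zero_tuples[OF assms(1)] by (intro SUP_const) auto
  finally show ?thesis .
qed

lemma E_convex_fenchel:
  assumes f: "E_convex W f"
  shows "E_convex W (\<lambda>A. fenchel (tuples A) (f A))"
  using f
proof (cases rule: E_convex_cases)
  case minus
  then show ?thesis by (intro E_convex_infinite[of _ "- (-\<infinity>)"] fenchel_infinite) auto
next
  case plus
  then show ?thesis by (intro E_convex_infinite[of _ "- \<infinity>"] fenchel_infinite) auto
next
  case proper
  show ?thesis
    by (rule E_convexI[OF E_monotone_fenchel[OF E_convex_monotone[OF f]]])
      (use proper(2) closed_convex_on_fenchel in blast)
qed

text \<open>The two infinite constants are exchanged by conjugation, so they satisfy the identity as
  well.\<close>

lemma E_convex_fenchel_fenchel:
  assumes f: "E_convex W f" and A: "A \<in> W" and X: "X \<in> tuples A"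
  shows "fenchel (tuples A) (fenchel (tuples A) (f A)) X = f A X"
  using f
proof (cases rule: E_convex_cases)
  case minus
  then have "fenchel (tuples A) (f A) Y = \<infinity>" for Y using fenchel_infinite[OF A, of "f A" "-\<infinity>"] A by simp
  then show ?thesis using fenchel_infinite[OF A, of "fenchel (tuples A) (f A)" \<infinity>] minus A X by simp
next
  case plus
  then have "fenchel (tuples A) (f A) Y = -\<infinity>" for Y using fenchel_infinite[OF A, of "f A" \<infinity>] A by simp
  then show ?thesis using fenchel_infinite[OF A, of "fenchel (tuples A) (f A)" "-\<infinity>"] plus A X by simp
next
  case proper
  then show ?thesis
    using A X by (intro fenchel_fenchel subspace_tuples closed_tuples) (auto simp: closed_convex_on_def)
qed

end

section \<open>The interpolation\<close>

lemma norm_sq_diff_smult: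
  fixes u p :: "'a::real_inner"
  assumes "a \<noteq> 0"
  shows "(norm (u - a *\<^sub>R p))\<^sup>2 / (2 * a) = (norm u)\<^sup>2 / (2 * a) - inner u p + a / 2 * (norm p)\<^sup>2"
  using assms unfolding power2_norm_eq_inner
  by (simp add: inner_diff_left inner_diff_right inner_commute[of p u] field_simps)

lemma norm_sq_diff_combination:
  fixes x y z :: "'a::real_inner"
  shows "(norm (x - (b *\<^sub>R z + c *\<^sub>R y)))\<^sup>2 = (norm x)\<^sup>2 + b\<^sup>2 * (norm z)\<^sup>2 + c\<^sup>2 * (norm y)\<^sup>2
    - 2 * b * inner z x - 2 * c * inner x y + 2 * b * c * inner z y"
  unfolding power2_norm_eq_inner
  by (simp add: inner_diff_left inner_diff_right inner_add_left inner_add_right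
      inner_commute[of z x] inner_commute[of y x] inner_commute[of y z] power2_eq_square algebra_simps)

text \<open>Here \<open>i1\<close>, \<open>i2\<close>, \<open>i3\<close> stand for the inner
  products of \<open>Z\<close> with \<open>X\<close>, \<open>X\<close> with \<open>Y\<close>,
  \<open>Z\<close> with \<open>Y\<close>, and the last bracket is the squared distance from
  \<open>X\<close> to \<open>(s Z + (t - s) Y) / t\<close>. It computes the Legendre transform of
  the quadratic part in \<open>X\<close>.\<close>

lemma square_sup_identity:
  fixes s t i1 i2 i3 nx ny nz :: real
  assumes "s > 0" "t > 0"
  shows "i1 - (t / (2 * s) * nx - (t - s) / s * i2 + (t - s) * (1 - s) / (2 * s) * ny)
    = s / (2 * t) * nz - (s - t) / t * i3 + (s - t) * (1 - t) / (2 * t) * ny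
      - t / (2 * s) * (nx + (s / t)\<^sup>2 * nz + ((t - s) / t)\<^sup>2 * ny - 2 * (s / t) * i1 - 2 * ((t - s) / t) * i2
         + 2 * (s / t) * ((t - s) / t) * i3)"
proof -
  \<comment> \<open>Reciprocals become variables tied by polynomial relations, which turns the claim
    into an ideal membership for \<open>algebra\<close>.\<close>
  define r where "r = 1 / s"
  define q where "q = 1 / t"
  have d: "x / s = x * r" "x / t = x * q" "x / (2 * s) = x * r / 2" "x / (2 * t) = x * q / 2" for x
    by (simp_all add: r_def q_def)
  have "s * r = 1" "t * q = 1" using assms by (simp_all add: r_def q_def)
  then show ?thesis unfolding d by algebra
qed

lemma square_inf_identity0:
  fixes a b N i M :: real
  assumes "a > 0" "b > 0"
  shows "(a + b) / (2 * a) * N - b / a * i + b * (1 - a) / (2 * a) * M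
    = (a + b) / a / 2 * N - b / a * i + b\<^sup>2 / (a * (a + b)) / 2 * M + b / (a + b) * ((1 - (a + b)) * (M / 2))"
proof -
  define r where "r = 1 / a"
  define q where "q = 1 / (a + b)"
  have d: "x / a = x * r" "x / (a + b) = x * q" "x / (2 * a) = x * r / 2" "x / (a * (a + b)) = x * r * q" for x
    by (simp_all add: r_def q_def)
  have "a * r = 1" "(a + b) * q = 1" using assms by (simp_all add: r_def q_def)
  then show ?thesis unfolding d by algebra
qed

text \<open>The gaps are \<open>a = u - s\<close> and \<open>b = t - u\<close>; \<open>i1\<close>,
  \<open>i2\<close>, \<open>i3\<close> are the inner products of \<open>X\<close> with
  \<open>Z\<close>, \<open>Z\<close> with \<open>Y\<close>, \<open>X\<close> with \<open>Y\<close>.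
  The last bracket is the squared distance from \<open>Z\<close> to
  \<open>(s X + a Y) / u\<close>.\<close>

lemma square_inf_identity:
  fixes s a b i1 i2 i3 nx ny nz :: real
  assumes "s > 0" "a > 0" "b > 0"
  shows "(a + b) / a / 2 * nx - b / a * i1 + b\<^sup>2 / (a * (a + b)) / 2 * nz
      + b / (a + b) * ((s + a + b) / (2 * s) * nz - (s + a + b - s) / s * i2
         + (s + a + b - s) * (1 - s) / (2 * s) * ny)
    = (s + a + b) / (2 * (s + a)) * nx - (s + a + b - (s + a)) / (s + a) * i3
      + (s + a + b - (s + a)) * (1 - (s + a)) / (2 * (s + a)) * ny
      + b * (s + a) / (2 * s * a) * (nz + (s / (s + a))\<^sup>2 * nx + (a / (s + a))\<^sup>2 * ny - 2 * (s / (s + a)) * i1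
        - 2 * (a / (s + a)) * i2 + 2 * (s / (s + a)) * (a / (s + a)) * i3)"
proof -
  define p where "p = 1 / s"
  define r where "r = 1 / a"
  define q where "q = 1 / (a + b)"
  define w where "w = 1 / (s + a)"
  have d: "x / a = x * r" "x / (a + b) = x * q" "x / (2 * s) = x * p / 2" "x / (a * (a + b)) = x * r * q"
    "x / s = x * p" "x / (s + a) = x * w" "x / (2 * (s + a)) = x * w / 2" "x / (2 * s * a) = x * p * r / 2" for x
    by (simp_all add: r_def q_def p_def w_def)
  have "a * r = 1" "(a + b) * q = 1" "s * p = 1" "(s + a) * w = 1"
    using assms by (simp_all add: r_def q_def p_def w_def)
  then show ?thesis unfolding d by algebra
qed

lemma half_norm_sq_expand:
  fixes x x' :: "'a::real_inner"
  shows "(norm x')\<^sup>2 / 2 = (norm x)\<^sup>2 / 2 + inner x (x' - x) + (norm (x' - x))\<^sup>2 / 2"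
  unfolding power2_norm_eq_inner
  by (simp add: inner_diff_left inner_diff_right inner_commute[of x' x] field_simps)

lemma subdiff_half_norm_sq:
  fixes x :: "'a::real_inner"
  assumes "x \<in> S" "\<And>y. y \<in> S \<Longrightarrow> \<phi> y = ereal ((norm y)\<^sup>2 / 2)"
  shows "x \<in> subdiff S \<phi> x"
  unfolding subdiff_def
proof (intro CollectI conjI ballI assms(1))
  fix y assume y: "y \<in> S"
  have "(norm x)\<^sup>2 / 2 + inner x (y - x) \<le> (norm y)\<^sup>2 / 2" using half_norm_sq_expand[of y x] by simp
  then show "\<phi> x + ereal (inner x (y - x)) \<le> \<phi> y"
    by (simp add: assms(2)[OF assms(1)] assms(2)[OF y])
qed

text \<open>Pinched between an affine function and the same function plus a quadratic,
  \<open>\<phi>\<close> is differentiable at \<open>x\<close> with gradient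
  \<open>y\<close>.\<close>

lemma subdiff_eq_singleton:
  fixes S :: "'a::real_inner set"
  assumes S: "subspace S" and x: "x \<in> S" and y: "y \<in> S" and v: "\<phi> x = ereal v" and b: "b > 0"
    and bounds: "\<And>x'. x' \<in> S \<Longrightarrow> \<exists>w. \<phi> x' = ereal w \<and> v + inner y (x' - x) \<le> w \<and>
      w \<le> v + inner y (x' - x) + b / 2 * (norm (x' - x))\<^sup>2"
  shows "subdiff S \<phi> x = {y}"
proof (intro set_eqI iffI)
  fix y' assume "y' \<in> {y}"
  then show "y' \<in> subdiff S \<phi> x" using bounds y unfolding subdiff_def by (force simp: v)
next
  fix y' assume y': "y' \<in> subdiff S \<phi> x"
  then have y'S: "y' \<in> S" using subdiff_subset by blast
  define d where "d = y' - y"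
  \<comment> \<open>With step \<open>1 / b\<close> along \<open>d\<close>, a rival subgradient would
    force an excess of \<open>(norm d)\<^sup>2 / b\<close>, twice what the quadratic allows.\<close>
  let ?x = "x + (1 / b) *\<^sub>R d"
  have x': "?x - x = (1 / b) *\<^sub>R d" by simp
  have "?x \<in> S" unfolding d_def using S x y y'S by (intro subspace_add subspace_scale subspace_diff)
  then obtain w where w: "\<phi> ?x = ereal w" "w \<le> v + inner y (?x - x) + b / 2 * (norm (?x - x))\<^sup>2"
    using bounds by blast
  have "\<phi> x + ereal (inner y' (?x - x)) \<le> \<phi> ?x" using y' \<open>?x \<in> S\<close> unfolding subdiff_def by blast
  then have "v + inner y' d / b \<le> w" unfolding x' w(1) v by simp
  also have "w \<le> v + inner y d / b + (norm d)\<^sup>2 / (2 * b)"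
    using w(2) b unfolding x' by (simp add: power_divide power2_eq_square)
  finally have "inner d d / b \<le> (norm d)\<^sup>2 / (2 * b)"
    by (simp add: d_def inner_diff_left diff_divide_distrib)
  then have "(norm d)\<^sup>2 \<le> 0" using b by (simp add: power2_norm_eq_inner field_simps)
  then have "y' = y" by (simp add: d_def)
  then show "y' \<in> {y}" by simp
qed

lemma grad_eqI: "subdiff S \<phi> x = {y} \<Longrightarrow> grad S \<phi> x = y"
  unfolding grad_def by simp

lemma subdiff_monotone:
  assumes "z \<in> subdiff S \<phi> p" "z' \<in> subdiff S \<phi> p'" "\<phi> p = ereal v" "\<phi> p' = ereal v'"
    "p \<in> S" "p' \<in> S"
  shows "0 \<le> inner (z - z') (p - p')"
proof -
  have "ereal (v + inner z (p' - p)) \<le> ereal v'" "ereal (v' + inner z' (p - p')) \<le> ereal v"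
    using assms unfolding subdiff_def by auto
  then show ?thesis by (simp add: inner_diff_left inner_diff_right)
qed

lemma interp_zero_eq: "interp_zero f s = (\<lambda>A X. ereal (1 - s) * q1 A X + ereal s * f A X)"
  by (intro ext) (simp add: interp_zero_def)

lemma interp_term_eq:
  assumes s: "s > 0"
  shows "interp_term f t s A X Y
    = ereal (t / s * ((norm X)\<^sup>2 / 2)) + ereal ((s - t) / s) * (ereal (inner X Y) - interp_zero f s A Y)"
proof (cases "f A Y")
  case (real v)
  have "t / (2 * s) * (norm X)\<^sup>2 - (t - s) / s * inner X Y + (t - s) * (1 - s) / (2 * s) * (norm Y)\<^sup>2 + (t - s) * v
    = t / s * ((norm X)\<^sup>2 / 2) + (s - t) / s * (inner X Y - ((1 - s) * ((norm Y)\<^sup>2 / 2) + s * v))"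
    using s by (simp add: field_simps)
  then show ?thesis by (simp add: interp_term_def interp_zero_def q1_def real)
next
  case PInf
  \<comment> \<open>The product with an infinite value depends on the sign of the factor, and
    vanishes by convention when \<open>t = s\<close>.\<close>
  consider "t < s" "(s - t) / s > 0" | "t = s" | "t > s" "(s - t) / s < 0"
    using s by (cases t s rule: linorder_cases) (simp_all add: divide_neg_pos)
  then show ?thesis using s by cases (auto simp: interp_term_def interp_zero_def q1_def PInf)
next
  case MInf
  consider "t < s" "(s - t) / s > 0" | "t = s" | "t > s" "(s - t) / s < 0"
    using s by (cases t s rule: linorder_cases) (simp_all add: divide_neg_pos)
  then show ?thesis using s by cases (auto simp: interp_term_def interp_zero_def q1_def MInf)
qed

context representing
begin

lemma cond_exp_embed:
  assumes i: "A \<in> W" "B \<in> W" "tracial_embedding A B \<iota>" and X: "X \<in> tuples A"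
  shows "cond_exp A B \<iota> (embed A B \<iota> X) = X"
  by (rule inner_eqI[OF cond_exp_in[OF i embed_in[OF i X]] X subspace_tuples[OF i(1)]])
    (simp add: inner_cond_exp[OF i embed_in[OF i X]] inner_embed[OF i X])

lemma cond_exp_scale:
  assumes i: "A \<in> W" "B \<in> W" "tracial_embedding A B \<iota>" and X: "X \<in> tuples B"
  shows "cond_exp A B \<iota> (r *\<^sub>R X) = r *\<^sub>R cond_exp A B \<iota> X"
proof -
  have rX: "r *\<^sub>R X \<in> tuples B" by (rule subspace_scale[OF subspace_tuples[OF i(2)] X])
  show ?thesis
    by (rule inner_eqI[OF cond_exp_in[OF i rX] _ subspace_tuples[OF i(1)]])
      (simp_all add: inner_cond_exp[OF i rX] inner_cond_exp[OF i X] subspace_scale[OF subspace_tuples[OF i(1)]] cond_exp_in[OF i X])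
qed

lemma E_monotone_dilate:
  fixes f :: "('n::finite) wfun"
  assumes f: "E_monotone W f" and c: "c \<ge> 0"
  shows "E_monotone W (\<lambda>A X. ereal c * f A (r *\<^sub>R X))"
proof (rule E_monotoneI)
  fix A B \<iota> assume i: "A \<in> W" "B \<in> W" "tracial_embedding A B \<iota>"
  show "ereal c * f A (r *\<^sub>R X) = ereal c * f B (r *\<^sub>R embed A B \<iota> X)" if X: "X \<in> tuples A" for X
    using E_monotone_embed[OF f i subspace_scale[OF subspace_tuples[OF i(1)] X, of r]]
    by (simp add: embed_scale[OF i X])
  show "ereal c * f A (r *\<^sub>R cond_exp A B \<iota> X) \<le> ereal c * f B (r *\<^sub>R X)" if X: "X \<in> tuples B" for X
    using E_monotone_cond_exp[OF f i subspace_scale[OF subspace_tuples[OF i(2)] X, of r]] c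
    by (intro ereal_mult_left_mono) (simp_all add: cond_exp_scale[OF i X])
qed

lemma fenchel_q1:
  assumes A: "A \<in> W" and X: "X \<in> tuples A"
  shows "fenchel (tuples A) (q1 A) X = q1 A X"
proof -
  have "X \<in> subdiff (tuples A) (q1 A) X"
    by (rule subdiff_half_norm_sq[OF X]) (simp add: q1_def)
  from fenchel_eq_subdiff[OF X _ this] show ?thesis
    by (simp add: q1_def power2_norm_eq_inner)
qed

text \<open>Biconjugation makes the relation symmetric, so the Legendre claim has to be computed for
  one order of the indices only.\<close>

lemma legendre_sym:
  fixes F G :: "('n::finite) wfun"
  assumes F: "E_convex W F" and eq: "wfun_eq W G (legendre W F)"
  shows "wfun_eq W F (legendre W G)"
  unfolding wfun_eq_def
proof (intro ballI)
  fix A and X :: "ell2 ^ 'n" assume A: "A \<in> W" and X: "X \<in> tuples A"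
  have G: "G B Y = fenchel (tuples B) (F B) Y" if "B \<in> W" "Y \<in> tuples B" for B Y
    using eq that legendre_eq[OF E_convex_monotone[OF F] that] unfolding wfun_eq_def by simp
  have "E_convex W G" by (rule E_convex_cong[OF _ E_convex_fenchel[OF F]]) (simp add: G)
  then have "legendre W G A X = fenchel (tuples A) (G A) X"
    by (rule legendre_eq[OF E_convex_monotone A X])
  also have "\<dots> = fenchel (tuples A) (fenchel (tuples A) (F A)) X"
    by (rule fenchel_cong) (rule G[OF A])
  also have "\<dots> = F A X" by (rule E_convex_fenchel_fenchel[OF F A X])
  finally show "F A X = legendre W G A X" by simp
qed

end

locale interpolation = representing +
  fixes f :: "('n::finite) wfun"
  assumes f: "E_convex W f"
begin

abbreviation "F \<equiv> interp W f"

text \<open>For \<open>0 < s \<le> 1\<close> this is the endpoint \<open>F 0 s\<close>, expressed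
  within one algebra.\<close>

definition g :: "real \<Rightarrow> 'n wfun" where
  "g s A = fenchel (tuples A) (interp_zero f s A)"

lemma E_convex_zero: "0 \<le> s \<Longrightarrow> s \<le> 1 \<Longrightarrow> E_convex W (interp_zero f s)"
  unfolding interp_zero_eq by (rule E_convex_combination[OF f]) auto

lemma E_convex_g: "0 \<le> s \<Longrightarrow> s \<le> 1 \<Longrightarrow> E_convex W (g s)"
  using E_convex_fenchel[OF E_convex_zero] unfolding g_def[abs_def] by simp

lemma interp_inf_eq:
  assumes A: "A \<in> W" and s: "0 < s" "s \<le> t"
  shows "interp_inf f t s A X = ereal (t / s * ((norm X)\<^sup>2 / 2)) + ereal ((s - t) / s) * g s A X"
proof (cases "s = t")
  \<comment> \<open>Every term equals the same quadratic here, since the factor 0 removes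
    \<open>f\<close>; only nonemptiness of the index set is used.\<close>
  case True
  then show ?thesis using zero_tuples[OF A] s(1)
    by (auto simp: interp_inf_def interp_term_eq zero_ereal_def[symmetric] intro!: INF_const)
next
  case False
  then have "(s - t) / s < 0" using s by (simp add: divide_neg_pos)
  then show ?thesis
    unfolding interp_inf_def interp_term_eq[OF s(1)] g_def fenchel_def by (rule INF_affine_neg)
qed

lemma interp_sup_eq:
  assumes A: "A \<in> W" and s: "0 < s" "t \<le> s"
  shows "interp_sup f t s A X = ereal (t / s * ((norm X)\<^sup>2 / 2)) + ereal ((s - t) / s) * g s A X"
proof (cases "s = t")
  case True
  then show ?thesis using zero_tuples[OF A] s(1)
    by (auto simp: interp_sup_def interp_term_eq zero_ereal_def[symmetric] intro!: SUP_const)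
next
  case False
  then have "(s - t) / s > 0" using s by simp
  then show ?thesis
    unfolding interp_sup_def interp_term_eq[OF s(1)] g_def fenchel_def by (rule SUP_affine)
qed

lemma interp_zero_right: "F t 0 = interp_zero f t"
  by (simp add: interp_def)

lemma interp_zero_left: "t \<noteq> 0 \<Longrightarrow> F 0 t = legendre W (F t 0)"
  by (simp add: interp_def)

text \<open>One formula for the Legendre, infimum and supremum clauses together. It shows that
  overlapping clauses agree and makes the dependence on \<open>t\<close> visibly affine.\<close>

lemma interp_pos:
  assumes A: "A \<in> W" and X: "X \<in> tuples A" and s: "0 < s" "s \<le> 1" and t: "0 \<le> t"
  shows "F t s A X = ereal (t / s * ((norm X)\<^sup>2 / 2)) + ereal ((s - t) / s) * g s A X"
proof (cases "t = 0")
  case True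
  have "F 0 s A X = g s A X"
    using s legendre_eq[OF E_convex_monotone[OF E_convex_zero] A X] by (simp add: interp_def g_def)
  then show ?thesis using True s by (simp add: zero_ereal_def[symmetric] one_ereal_def[symmetric])
next
  case False
  then show ?thesis using s interp_inf_eq[OF A s(1)] interp_sup_eq[OF A s(1)] by (simp add: interp_def)
qed

lemma interp_diag:
  assumes "A \<in> W" "X \<in> tuples A" "0 \<le> t" "t \<le> 1"
  shows "F t t A X = q1 A X"
  using interp_pos[OF assms(1,2), of t t] assms(3,4)
  by (cases "t = 0") (simp_all add: interp_zero_right interp_zero_def q1_def zero_ereal_def[symmetric] one_ereal_def[symmetric])

text \<open>The transform contributes a supremum over \<open>X\<close>, and minus the infimum a
  supremum over \<open>Y\<close>; the two are exchanged. For fixed \<open>Y\<close> the problem in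
  \<open>X\<close> is a real concave quadratic, and its maximal value is the summand defining
  \<open>F s t\<close>.\<close>

lemma fenchel_interp_inf:
  assumes A: "A \<in> W" and Z: "Z \<in> tuples A" and s: "0 < s" "s < t"
  shows "fenchel (tuples A) (interp_inf f t s A) Z = interp_sup f s t A Z"
proof -
  let ?T = "tuples A :: (ell2 ^ 'n) set"
  define r where "r Y X = inner Z X - (t / (2 * s) * (norm X)\<^sup>2 - (t - s) / s * inner X Y
      + (t - s) * (1 - s) / (2 * s) * (norm Y)\<^sup>2)" for X Y :: "ell2 ^ 'n"
  have eq: "ereal (inner Z X) + ereal (- 1) * interp_term f t s A X Y = ereal (r Y X) + ereal (s - t) * f A Y" for X Y
  proof -
    have "ereal i + ereal (- 1) * (ereal q + ereal (t - s) * \<phi>) = ereal (i - q) + ereal (s - t) * \<phi>" for i q \<phi>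
      using s by (cases \<phi>) (simp_all add: algebra_simps)
    then show ?thesis unfolding interp_term_def r_def .
  qed
  have max: "(SUP X\<in>?T. ereal (r Y X) + ereal (s - t) * f A Y) = interp_term f s t A Z Y" if Y: "Y \<in> ?T" for Y
  proof -
    let ?x0 = "(s / t) *\<^sub>R Z + ((t - s) / t) *\<^sub>R Y"
    let ?m = "s / (2 * t) * (norm Z)\<^sup>2 - (s - t) / t * inner Z Y + (s - t) * (1 - t) / (2 * t) * (norm Y)\<^sup>2"
    have x0: "?x0 \<in> ?T" using subspace_tuples[OF A] Y Z by (intro subspace_add subspace_scale)
    have id: "r Y X = ?m - t / (2 * s) * (norm (X - ?x0))\<^sup>2" for X
      unfolding norm_sq_diff_combination r_def by (rule square_sup_identity) (use s in auto)
    have "r Y X \<le> r Y ?x0" for X using id[of X] id[of ?x0] s by simp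
    then have "(SUP X\<in>?T. ereal (r Y X) + ereal (s - t) * f A Y) = ereal (r Y ?x0) + ereal (s - t) * f A Y"
      by (intro SUP_real_add x0)
    also have "r Y ?x0 = ?m" using id[of ?x0] by simp
    finally show ?thesis by (simp only: interp_term_def)
  qed
  have "fenchel ?T (interp_inf f t s A) Z = (SUP X\<in>?T. ereal (inner Z X) + ereal (- 1) * interp_inf f t s A X)"
  proof -
    have "ereal (- 1) * x = - x" for x by (cases x) auto
    then show ?thesis by (simp only: fenchel_def minus_ereal_def)
  qed
  also have "\<dots> = (SUP X\<in>?T. SUP Y\<in>?T. ereal (inner Z X) + ereal (- 1) * interp_term f t s A X Y)"
    unfolding interp_inf_def by (subst SUP_affine_neg) auto
  also have "\<dots> = (SUP Y\<in>?T. SUP X\<in>?T. ereal (inner Z X) + ereal (- 1) * interp_term f t s A X Y)"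
    by (rule SUP_commute)
  also have "\<dots> = (SUP Y\<in>?T. interp_term f s t A Z Y)"
    by (rule SUP_cong[OF refl]) (simp only: eq max)
  finally show ?thesis by (simp add: interp_sup_def)
qed

text \<open>The formula behind the inf-convolution in (5): completing the square in \<open>Z\<close>, the minimum is
  at \<open>Z = (s X + (u - s) Y) / u\<close>, where \<open>Y\<close> is the variable of the infimum defining \<open>F t s\<close>.\<close>

lemma interp_inf_step:
  assumes A: "A \<in> W" and X: "X \<in> tuples A" and s: "0 \<le> s" "s < u" "u < t"
  shows "F t u A X = (INF Z\<in>tuples A. ereal ((t - s) / (u - s) / 2 * (norm (X - ((t - u) / (t - s)) *\<^sub>R Z))\<^sup>2)
    + ereal ((t - u) / (t - s)) * F t s A Z)"
proof -
  let ?T = "tuples A :: (ell2 ^ 'n) set"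
  \<comment> \<open>In terms of the gaps, the order \<open>s < u < t\<close> becomes positivity of
    \<open>a\<close> and \<open>b\<close>.\<close>
  define a where "a = u - s"
  define b where "b = t - u"
  have ab: "a > 0" "b > 0" "u = s + a" "t = s + a + b" using s by (auto simp: a_def b_def)
  define n where "n Z = (a + b) / a / 2 * (norm (X - (b / (a + b)) *\<^sub>R Z))\<^sup>2" for Z
  have n: "n Z = (a + b) / a / 2 * (norm X)\<^sup>2 - b / a * inner X Z + b\<^sup>2 / (a * (a + b)) / 2 * (norm Z)\<^sup>2" for Z
  proof -
    have "(a + b) / a / 2 * (N - 2 * (b / (a + b)) * i + (b / (a + b))\<^sup>2 * M)
        = (a + b) / a / 2 * N - b / a * i + b\<^sup>2 / (a * (a + b)) / 2 * M" for N i M :: real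
      using ab(1,2) by (simp add: divide_simps power2_eq_square) (simp add: algebra_simps)
    moreover have "(norm (X - (b / (a + b)) *\<^sub>R Z))\<^sup>2
        = (norm X)\<^sup>2 - 2 * (b / (a + b)) * inner X Z + (b / (a + b))\<^sup>2 * (norm Z)\<^sup>2"
      using norm_sq_diff_combination[of X "b / (a + b)" Z 0 0] by (simp add: inner_commute)
    ultimately show ?thesis by (simp add: n_def)
  qed
  have "F t u A X = (INF Z\<in>?T. interp_term f t u A X Z)"
    using s by (simp add: interp_def interp_inf_def)
  also have "\<dots> = (INF Z\<in>?T. ereal (n Z) + ereal (b / (a + b)) * F t s A Z)"
  proof (cases "s = 0")
    \<comment> \<open>\<open>F t 0\<close> is no infimum, so the summands on both sides already
      correspond, with \<open>Z\<close> itself as the variable of the infimum.\<close>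
    case True
    have "interp_term f t u A X Z = ereal (n Z) + ereal (b / (a + b)) * interp_zero f t A Z" for Z
    proof -
      have r: "t / (2 * u) * (norm X)\<^sup>2 - (t - u) / u * inner X Z + (t - u) * (1 - u) / (2 * u) * (norm Z)\<^sup>2
          = n Z + b / (a + b) * ((1 - t) * ((norm Z)\<^sup>2 / 2))" "b / (a + b) * t = t - u"
        using square_inf_identity0[OF ab(1,2), of "(norm X)\<^sup>2" "inner X Z" "(norm Z)\<^sup>2"] ab True
        unfolding n by simp_all
      show ?thesis
        unfolding interp_term_def interp_zero_def q1_def r(1)
        using ab True by (cases "f A Z") (simp_all add: distrib_left flip: r(2))
    qed
    then show ?thesis by (simp add: True interp_zero_right)
  next
    case False
    then have s0: "s > 0" using s by simp
    define r where "r Y Z = n Z + b / (a + b) * (t / (2 * s) * (norm Z)\<^sup>2 - (t - s) / s * inner Z Y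
      + (t - s) * (1 - s) / (2 * s) * (norm Y)\<^sup>2)" for Y Z
    have eq: "ereal (n Z) + ereal (b / (a + b)) * interp_term f t s A Z Y = ereal (r Y Z) + ereal b * f A Y" for Y Z
    proof -
      define c where "c = b / (a + b)"
      have c: "c > 0" "b = c * (t - s)" "t - s > 0" using ab by (simp_all add: c_def)
      have "ereal m + ereal c * (ereal q + ereal (t - s) * \<phi>) = ereal (m + c * q) + ereal (c * (t - s)) * \<phi>" for m q \<phi>
        using c by (cases \<phi>) (simp_all add: distrib_left mult_pos_pos)
      then show ?thesis unfolding interp_term_def r_def c_def[symmetric] c(2)[symmetric] .
    qed
    have min: "(INF Z\<in>?T. ereal (r Y Z) + ereal b * f A Y) = interp_term f t u A X Y" if Y: "Y \<in> ?T" for Y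
    proof -
      let ?z0 = "(s / u) *\<^sub>R X + (a / u) *\<^sub>R Y"
      let ?m = "t / (2 * u) * (norm X)\<^sup>2 - (t - u) / u * inner X Y + (t - u) * (1 - u) / (2 * u) * (norm Y)\<^sup>2"
      have z0: "?z0 \<in> ?T" using subspace_tuples[OF A] Y X by (intro subspace_add subspace_scale)
      have id: "r Y Z = ?m + b * u / (2 * s * a) * (norm (Z - ?z0))\<^sup>2" for Z
      proof -
        show ?thesis
          unfolding norm_sq_diff_combination r_def n unfolding ab(3,4) by (rule square_inf_identity[OF s0 ab(1,2)])
      qed
      have "0 \<le> b * u / (2 * s * a) * e\<^sup>2" for e using ab(1,2) s s0 by simp
      from this[of "norm (_ - ?z0)"] have "r Y ?z0 \<le> r Y Z" for Z using id[of Z] id[of ?z0] by simp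
      then have "(INF Z\<in>?T. ereal (r Y Z) + ereal b * f A Y) = ereal (r Y ?z0) + ereal b * f A Y"
        by (intro INF_real_add z0)
      also have "r Y ?z0 = ?m" using id[of ?z0] by simp
      finally show ?thesis by (simp only: interp_term_def b_def)
    qed
    have "(INF Z\<in>?T. ereal (n Z) + ereal (b / (a + b)) * F t s A Z)
        = (INF Z\<in>?T. INF Y\<in>?T. ereal (n Z) + ereal (b / (a + b)) * interp_term f t s A Z Y)"
      using s0 s ab by (simp add: interp_def interp_inf_def INF_affine)
    also have "\<dots> = (INF Y\<in>?T. INF Z\<in>?T. ereal (n Z) + ereal (b / (a + b)) * interp_term f t s A Z Y)"
      by (rule INF_commute)
    also have "\<dots> = (INF Y\<in>?T. interp_term f t u A X Y)"
      by (rule INF_cong[OF refl]) (simp only: eq min)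
    finally show ?thesis by simp
  qed
  finally show ?thesis by (simp add: n_def ab(3,4) add.assoc)
qed

text \<open>For fixed \<open>s > 0\<close> both coefficients in \<open>interp_pos\<close> are affine
  in the first index, and at the index \<open>s\<close> they give \<open>q1\<close>; the weights are
  those expressing \<open>u\<close> through \<open>s\<close> and \<open>t\<close>.\<close>

lemma interp_affine:
  assumes A: "A \<in> W" and X: "X \<in> tuples A" and s: "0 \<le> s" "s < u" "u < t" "t \<le> 1"
  shows "F u s A X = ereal ((t - u) / (t - s)) * q1 A X + ereal ((u - s) / (t - s)) * F t s A X"
proof (cases "s = 0")
  case True
  have "(t - u) / t * n + u / t * ((1 - t) * n + t * v) = (1 - u) * n + u * v" for n v :: real
    using s by (simp add: field_simps)
  from this[of "(norm X)\<^sup>2 / 2"] show ?thesis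
    using s True by (cases "f A X") (simp_all add: interp_zero_right interp_zero_def q1_def)
next
  case False
  then have s0: "s > 0" "s \<le> 1" "0 \<le> t" "0 \<le> u" using s by auto
  define c d k where "c = (t - u) / (t - s)" and "d = (u - s) / (t - s)" and "k = (s - t) / s"
  \<comment> \<open>The signs are needed because \<open>g s A X\<close> may be infinite.\<close>
  have d: "d > 0" "k < 0" using s s0 by (simp_all add: d_def k_def divide_neg_pos)
  then have dk: "d * k < 0" by (rule mult_pos_neg)
  have "u / s = c + d * (t / s)" "(s - u) / s = d * k"
    using s s0 by (simp_all add: c_def d_def k_def divide_simps) (simp_all add: algebra_simps)
  then show ?thesis
    unfolding interp_pos[OF A X s0(1,2,3)] interp_pos[OF A X s0(1,2,4)] q1_def
    unfolding c_def[symmetric] d_def[symmetric] k_def[symmetric]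
    using d dk by (cases "g s A X") (simp_all add: algebra_simps)
qed

text \<open>Rescaling the variable by \<open>(t - u) / (t - s)\<close>, a bijection of the tuples,
  turns the infimum of \<open>interp_inf_step\<close> into an inf-convolution within
  \<open>A\<close>.\<close>

lemma interp_inf_convolution:
  assumes A: "A \<in> W" and X: "X \<in> tuples A" and s: "0 \<le> s" "s < u" "u < t"
    and FE: "E_convex W (F t s)"
  shows "F t u A X = inf_convolution W (\<lambda>A X. ereal ((t - s) / (u - s)) * q1 A X)
    (\<lambda>A X. ereal ((t - u) / (t - s)) * F t s A (((t - s) / (t - u)) *\<^sub>R X)) A X"
    (is "_ = inf_convolution W ?f ?g A X")
proof -
  let ?T = "tuples A :: (ell2 ^ 'n) set"
  let ?c = "(t - u) / (t - s)"
  have mf: "E_monotone W ?f"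
    using E_convex_monotone[OF E_convex_scale[OF E_convex_q1, of "(t - s) / (u - s)"]] s by simp
  have mg: "E_monotone W ?g" by (rule E_monotone_dilate[OF E_convex_monotone[OF FE]]) (use s in simp)
  have diff: "?f A (X - cond_exp A B \<iota> Y) \<le> ?f B (embed A B \<iota> X - Y)"
    if B: "B \<in> W" "tracial_embedding A B \<iota>" and Y: "Y \<in> tuples B" for B \<iota> Y
  proof -
    have "norm (X - cond_exp A B \<iota> Y) \<le> norm (embed A B \<iota> X - Y)"
      using norm_cond_exp_diff[OF A B embed_in[OF A B X] Y, of 1] by (simp add: cond_exp_embed[OF A B X])
    then have "(norm (X - cond_exp A B \<iota> Y))\<^sup>2 \<le> (norm (embed A B \<iota> X - Y))\<^sup>2" by (intro power_mono) auto
    then show ?thesis using s by (simp add: q1_def mult_left_mono divide_right_mono)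
  qed
  have "inf_convolution W ?f ?g A X = (INF Y\<in>?T. ?f A (X - Y) + ?g A Y)"
    by (rule inf_convolution_eq[OF mf mg A X diff])
  also have "\<dots> = (INF Z\<in>?T. ?f A (X - ?c *\<^sub>R Z) + ?g A (?c *\<^sub>R Z))"
  proof (rule antisym)
    show "(INF Y\<in>?T. ?f A (X - Y) + ?g A Y) \<le> (INF Z\<in>?T. ?f A (X - ?c *\<^sub>R Z) + ?g A (?c *\<^sub>R Z))"
      by (rule INF_greatest, rule INF_lower) (rule subspace_scale[OF subspace_tuples[OF A]])
    show "(INF Z\<in>?T. ?f A (X - ?c *\<^sub>R Z) + ?g A (?c *\<^sub>R Z)) \<le> (INF Y\<in>?T. ?f A (X - Y) + ?g A Y)"
    proof (rule INF_greatest)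
      fix Y assume Y: "Y \<in> ?T"
      have "?c *\<^sub>R ((1 / ?c) *\<^sub>R Y) = Y" using s by simp
      then show "(INF Z\<in>?T. ?f A (X - ?c *\<^sub>R Z) + ?g A (?c *\<^sub>R Z)) \<le> ?f A (X - Y) + ?g A Y"
        using INF_lower[OF subspace_scale[OF subspace_tuples[OF A] Y, of "1 / ?c"],
          of "\<lambda>Z. ?f A (X - ?c *\<^sub>R Z) + ?g A (?c *\<^sub>R Z)"] by simp
    qed
  qed
  also have "\<dots> = F t u A X"
    unfolding interp_inf_step[OF A X s] using s by (intro INF_cong refl) (simp add: q1_def)
  finally show ?thesis by simp
qed

text \<open>The first claim adds the subgradient inequalities of \<open>q1\<close> and
  \<open>F t s\<close> at \<open>X\<close> with the weights of \<open>interp_affine\<close>. For the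
  second, \<open>X\<close> attains the infimum of \<open>interp_inf_step\<close> at
  \<open>Xu\<close>, and \<open>Y\<close> is at once the gradient of the quadratic there and a
  subgradient of \<open>F t s\<close> at \<open>X\<close>.\<close>

lemma subdiff_interp:
  assumes A: "A \<in> W" and X: "X \<in> tuples A" and Y: "Y \<in> tuples A" and s: "0 \<le> s" "s < t" "t \<le> 1"
    and sub: "Y \<in> subdiff (tuples A) (F t s A) X" and u: "s \<le> u" "u \<le> t"
    and Xu: "Xu = ((t - u) / (t - s)) *\<^sub>R X + ((u - s) / (t - s)) *\<^sub>R Y"
  shows "Xu \<in> subdiff (tuples A) (F u s A) X" and "Y \<in> subdiff (tuples A) (F t u A) Xu"
proof -
  have XuT: "Xu \<in> tuples A" unfolding Xu using subspace_tuples[OF A] X Y by (intro subspace_add subspace_scale)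
  have diag: "Z \<in> subdiff (tuples A) (F r r A) Z" if "Z \<in> tuples A" "0 \<le> r" "r \<le> 1" for Z :: "ell2 ^ 'n" and r
    by (rule subdiff_half_norm_sq[OF that(1)]) (simp add: interp_diag[OF A _ that(2,3)] q1_def)
  have ge: "F t s A X + ereal (inner Y (Z - X)) \<le> F t s A Z" if "Z \<in> tuples A" for Z :: "ell2 ^ 'n"
    using sub that unfolding subdiff_def by blast
  consider "u = s" | "u = t" | "s < u" "u < t" using u by linarith
  then have "Xu \<in> subdiff (tuples A) (F u s A) X \<and> Y \<in> subdiff (tuples A) (F t u A) Xu"
  proof cases
    case 1
    then show ?thesis using s sub diag[OF X] by (simp add: Xu)
  next
    case 2
    then show ?thesis using s sub diag[OF Y] by (simp add: Xu)
  next
    case 3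
    let ?l = "(t - u) / (t - s)" and ?m = "(u - s) / (t - s)"
    have lm: "?l > 0" "?m > 0" using 3 s by auto
    show ?thesis
    proof (intro conjI)
      show "Xu \<in> subdiff (tuples A) (F u s A) X"
        unfolding subdiff_def
      proof (intro CollectI conjI ballI XuT)
        fix Z :: "ell2 ^ 'n" assume Z: "Z \<in> tuples A"
        have i: "inner Xu (Z - X) = ?l * inner X (Z - X) + ?m * inner Y (Z - X)"
          by (simp add: Xu inner_add_left)
        have "q1 A X + ereal (inner X (Z - X)) \<le> q1 A Z"
          using half_norm_sq_expand[of Z X] by (simp add: q1_def)
        then have "ereal ?l * (q1 A X + ereal (inner X (Z - X))) + ereal ?m * (F t s A X + ereal (inner Y (Z - X)))
          \<le> ereal ?l * q1 A Z + ereal ?m * F t s A Z"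
          using lm by (intro add_mono ereal_mult_left_mono ge Z) auto
        moreover have "ereal ?l * (q1 A X + ereal (inner X (Z - X))) + ereal ?m * (F t s A X + ereal (inner Y (Z - X)))
          = ereal ?l * q1 A X + ereal ?m * F t s A X + ereal (inner Xu (Z - X))"
          unfolding i q1_def using lm by (cases "F t s A X") (simp_all add: distrib_left)
        ultimately show "F u s A X + ereal (inner Xu (Z - X)) \<le> F u s A Z"
          unfolding interp_affine[OF A X s(1) 3 s(3)] interp_affine[OF A Z s(1) 3 s(3)] by simp
      qed
      define a where "a = (t - s) / (u - s)"
      have a: "a > 0" using 3 s by (simp add: a_def)
      note inf_step = interp_inf_step[OF A _ s(1) 3, folded a_def]
      \<comment> \<open>\<open>Y\<close> is \<open>a\<close> times the argument of the quadratic,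
        hence its gradient at that point.\<close>
      have Y_eq: "Xu - ?l *\<^sub>R X = (1 / a) *\<^sub>R Y" by (simp add: Xu a_def)
      have upper: "F t u A Xu \<le> ereal (a / 2 * (norm (Xu - ?l *\<^sub>R X))\<^sup>2) + ereal ?l * F t s A X"
        unfolding inf_step[OF XuT] by (rule INF_lower[OF X])
      show "Y \<in> subdiff (tuples A) (F t u A) Xu"
        unfolding subdiff_def
      proof (intro CollectI conjI ballI Y)
        fix V :: "ell2 ^ 'n" assume V: "V \<in> tuples A"
        have step: "ereal (a / 2 * (norm (Xu - ?l *\<^sub>R X))\<^sup>2) + ereal ?l * F t s A X + ereal (inner Y (V - Xu))
            \<le> ereal (a / 2 * (norm (V - ?l *\<^sub>R Z))\<^sup>2) + ereal ?l * F t s A Z" if Z: "Z \<in> tuples A" for Z :: "ell2 ^ 'n"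
        proof -
          let ?w = "Xu - ?l *\<^sub>R X" and ?w' = "V - ?l *\<^sub>R Z"
          have "inner Y (?w' - ?w) = a * inner ?w (?w' - ?w)" unfolding Y_eq using a by simp
          moreover have "inner Y (V - Xu) = inner Y (?w' - ?w) + ?l * inner Y (Z - X)"
          proof -
            have "inner Y (V - Xu) = inner Y ((V - l *\<^sub>R Z) - (Xu - l *\<^sub>R X)) + l * inner Y (Z - X)" for l
              by (simp add: inner_diff_right algebra_simps)
            then show ?thesis .
          qed
          moreover have "a * ((norm ?w)\<^sup>2 / 2 + inner ?w (?w' - ?w)) \<le> a * ((norm ?w')\<^sup>2 / 2)"
            using half_norm_sq_expand[of ?w' ?w] a by (intro mult_left_mono) auto
          ultimately have r: "a / 2 * (norm ?w)\<^sup>2 + inner Y (V - Xu) \<le> a / 2 * (norm ?w')\<^sup>2 + ?l * inner Y (Z - X)"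
            by (simp add: distrib_left)
          have "ereal (a / 2 * (norm ?w)\<^sup>2) + ereal ?l * F t s A X + ereal (inner Y (V - Xu))
              = ereal (a / 2 * (norm ?w)\<^sup>2 + inner Y (V - Xu)) + ereal ?l * F t s A X"
            using lm by (cases "F t s A X") (simp_all add: ac_simps)
          also have "\<dots> \<le> ereal (a / 2 * (norm ?w')\<^sup>2 + ?l * inner Y (Z - X)) + ereal ?l * F t s A X"
            using r by (intro add_right_mono) simp
          also have "\<dots> = ereal (a / 2 * (norm ?w')\<^sup>2) + ereal ?l * (F t s A X + ereal (inner Y (Z - X)))"
            using lm by (cases "F t s A X") (simp_all add: distrib_left)
          also have "\<dots> \<le> ereal (a / 2 * (norm ?w')\<^sup>2) + ereal ?l * F t s A Z"
            using lm by (intro add_left_mono ereal_mult_left_mono ge Z) auto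
          finally show ?thesis .
        qed
        have "F t u A Xu + ereal (inner Y (V - Xu))
            \<le> ereal (a / 2 * (norm (Xu - ?l *\<^sub>R X))\<^sup>2) + ereal ?l * F t s A X + ereal (inner Y (V - Xu))"
          by (rule add_right_mono[OF upper])
        also have "\<dots> \<le> F t u A V"
          unfolding inf_step[OF V] by (rule INF_greatest) (rule step)
        finally show "F t u A Xu + ereal (inner Y (V - Xu)) \<le> F t u A V" .
      qed
    qed
  qed
  then show "Xu \<in> subdiff (tuples A) (F u s A) X" and "Y \<in> subdiff (tuples A) (F t u A) Xu" by auto
qed

end

lemma ereal_add_minus_cancel: "ereal a + e - ereal a = e"
  by (cases e) simp_all

lemma ereal_minus_add_uminus: "ereal a - (ereal a + - e) = e"
  by (cases e) simp_all

context interpolation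
begin

text \<open>Moving the minus sign into the supremum, for \<open>0 < s < 1\<close> this is the
  infimum over \<open>Y\<close> of
  \<open>norm (X - (1 - s) Y)\<^sup>2 / (2 (1 - s)) + s f(Y)\<close>: a Moreau envelope after a
  dilation.\<close>

definition k :: "real \<Rightarrow> 'n wfun" where
  "k s A X = ereal (1 / (1 - s)) * q1 A X - g s A X"

end

section \<open>Resolvents, smoothness and gradients for proper \<open>f\<close>\<close>

locale proper_interpolation = interpolation W f for W and f :: "('n::finite) wfun" +
  assumes closed_convex: "A \<in> W \<Longrightarrow> closed_convex_on (tuples A) (f A)"
    and finite_somewhere: "A \<in> W \<Longrightarrow> \<exists>X\<in>tuples A. f A X \<noteq> \<infinity>"
begin

text \<open>Points \<open>(1 - s) p + s z\<close> with \<open>z \<in> \<eth>f(p)\<close> parametrise the whole space, and \<open>\<nabla>f\<^sub>t\<^sub>,\<^sub>s\<close> maps such a point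
  to \<open>(1 - t) p + t z\<close> with the same \<open>p\<close> and \<open>z\<close>; this is why the gradients compose as in (7).\<close>

definition resolves :: "tracial_algebra \<Rightarrow> ell2 ^ 'n \<Rightarrow> ell2 ^ 'n \<Rightarrow> real \<Rightarrow> bool" where
  "resolves A p z v \<longleftrightarrow> p \<in> tuples A \<and> z \<in> subdiff (tuples A) (f A) p \<and> f A p = ereal v"

lemma resolves_in:
  assumes "resolves A p z v"
  shows "p \<in> tuples A" "z \<in> tuples A"
  using assms subdiff_subset unfolding resolves_def by blast+

lemma resolvent:
  assumes A: "A \<in> W" and s: "0 < s" "s < 1" and X: "X \<in> tuples A"
  obtains p z v where "resolves A p z v" "X = (1 - s) *\<^sub>R p + s *\<^sub>R z"
proof -
  obtain X0 where X0: "X0 \<in> tuples A" "f A X0 \<noteq> \<infinity>" using finite_somewhere[OF A] by blast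
  have cc: "ereal_convex_on (tuples A) (f A)" "lsc_on (tuples A) (f A)" "\<And>X. X \<in> tuples A \<Longrightarrow> f A X \<noteq> -\<infinity>"
    using closed_convex[OF A] unfolding closed_convex_on_def by blast+
  \<comment> \<open>Dividing \<open>X = (1 - s) p + s z\<close> by \<open>1 - s\<close> brings it to
    the form that \<open>minty\<close> solves, with parameter \<open>s / (1 - s)\<close>.\<close>
  have l: "s / (1 - s) > 0" using s by simp
  have X': "(1 / (1 - s)) *\<^sub>R X \<in> tuples A" by (rule subspace_scale[OF subspace_tuples[OF A] X])
  obtain p z where p: "p \<in> tuples A" "z \<in> subdiff (tuples A) (f A) p" "\<bar>f A p\<bar> \<noteq> \<infinity>"
    and eq: "(1 / (1 - s)) *\<^sub>R X = p + (s / (1 - s)) *\<^sub>R z"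
    using minty[OF subspace_tuples[OF A] closed_tuples[OF A] cc(1,2) X0 cc(3) l X'] by blast
  have "X = (1 - s) *\<^sub>R ((1 / (1 - s)) *\<^sub>R X)" using s by simp
  also have "\<dots> = (1 - s) *\<^sub>R p + s *\<^sub>R z" unfolding eq using s by (simp add: scaleR_add_right)
  finally show ?thesis using that p unfolding resolves_def by (cases "f A p") auto
qed

text \<open>\<open>p\<close> is the maximiser in the transform at \<open>X\<close>. Inserting it
  gives the lower bound; replacing \<open>f\<close> by its supporting function with slope
  \<open>z\<close> leaves a quadratic maximisation, whose value is the upper bound. So
  \<open>g s\<close> has gradient \<open>p\<close> at \<open>X\<close>.\<close>

lemma g_bounds:
  assumes A: "A \<in> W" and s: "0 < s" "s < 1" and r: "resolves A p z v" and X: "X = (1 - s) *\<^sub>R p + s *\<^sub>R z"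
  defines "\<gamma> \<equiv> inner X p - ((1 - s) / 2 * (norm p)\<^sup>2 + s * v)"
  shows "g s A X = ereal \<gamma>"
    and "Z \<in> tuples A \<Longrightarrow> ereal (\<gamma> + inner p (Z - X)) \<le> g s A Z"
    and "Z \<in> tuples A \<Longrightarrow> g s A Z \<le> ereal (\<gamma> + inner p (Z - X) + (norm (Z - X))\<^sup>2 / (2 * (1 - s)))"
proof -
  have p: "p \<in> tuples A" "f A p = ereal v" using r by (auto simp: resolves_def)
  have h_p: "interp_zero f s A p = ereal ((1 - s) / 2 * (norm p)\<^sup>2 + s * v)"
    by (simp add: interp_zero_def q1_def p)
  show lower: "ereal (\<gamma> + inner p (Z - X)) \<le> g s A Z" if "Z \<in> tuples A" for Z
    unfolding g_def fenchel_def
    by (rule SUP_upper2[OF p(1)]) (simp add: h_p \<gamma>_def inner_diff_right inner_commute)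
  show upper: "g s A Z \<le> ereal (\<gamma> + inner p (Z - X) + (norm (Z - X))\<^sup>2 / (2 * (1 - s)))" if "Z \<in> tuples A" for Z
    unfolding g_def fenchel_def
  proof (rule SUP_least)
    fix Y :: "ell2 ^ 'n" assume Y: "Y \<in> tuples A"
    have fY: "ereal (v + inner z (Y - p)) \<le> f A Y"
      using r Y unfolding resolves_def subdiff_def by auto
    show "ereal (inner Z Y) - interp_zero f s A Y
        \<le> ereal (\<gamma> + inner p (Z - X) + (norm (Z - X))\<^sup>2 / (2 * (1 - s)))"
    proof (cases "f A Y")
      case (real w)
      define a where "a = 1 - s"
      have a: "a > 0" using s by (simp add: a_def)
      let ?U = "Z - s *\<^sub>R z"
      have ZX: "Z - X = ?U - a *\<^sub>R p" unfolding X a_def by simp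
      \<comment> \<open>Nonnegativity of this square bounds the concave quadratic in
        \<open>Y\<close> by its maximum, attained at \<open>?U / a\<close>.\<close>
      have "0 \<le> (norm (?U - a *\<^sub>R Y))\<^sup>2 / (2 * a)" using a by simp
      then have 1: "inner ?U Y \<le> (norm ?U)\<^sup>2 / (2 * a) + a / 2 * (norm Y)\<^sup>2"
        using a by (simp add: norm_sq_diff_smult)
      have 2: "(norm (Z - X))\<^sup>2 / (2 * a) = (norm ?U)\<^sup>2 / (2 * a) - inner ?U p + a / 2 * (norm p)\<^sup>2"
        unfolding ZX using a by (simp add: norm_sq_diff_smult)
      have "s * (v + inner z (Y - p)) \<le> s * w" using fY s real by simp
      then have 3: "s * v + s * inner z Y - s * inner z p \<le> s * w"
        by (simp add: inner_diff_right algebra_simps)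
      have 4: "\<gamma> + inner p (Z - X) = inner Z p - (a / 2 * (norm p)\<^sup>2 + s * v)"
        by (simp add: \<gamma>_def a_def inner_diff_right inner_commute)
      have 5: "inner ?U Y = inner Z Y - s * inner z Y" "inner ?U p = inner Z p - s * inner z p"
        by (simp_all add: inner_diff_left)
      have "inner Z Y - (a * ((norm Y)\<^sup>2 / 2) + s * w) \<le> \<gamma> + inner p (Z - X) + (norm (Z - X))\<^sup>2 / (2 * a)"
        using 1 3 unfolding 2 4 5 by simp
      then show ?thesis by (simp add: interp_zero_def q1_def real a_def)
    qed (use fY s in \<open>auto simp: interp_zero_def q1_def\<close>)
  qed
  have XT: "X \<in> tuples A"
    unfolding X using subspace_tuples[OF A] resolves_in[OF r] by (intro subspace_add subspace_scale)
  show "g s A X = ereal \<gamma>" using lower[OF XT] upper[OF XT] by simp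
qed

lemma g_finite:
  assumes "A \<in> W" "0 < s" "s < 1" "X \<in> tuples A"
  shows "\<bar>g s A X\<bar> \<noteq> \<infinity>"
proof -
  obtain p z v where "resolves A p z v" "X = (1 - s) *\<^sub>R p + s *\<^sub>R z" using resolvent[OF assms] .
  from g_bounds(1)[OF assms(1-3) this] show ?thesis by simp
qed

text \<open>Monotonicity of \<open>g s\<close> points the wrong way for \<open>-g s\<close>, so the
  quadratic has to compensate: the contraction estimate for \<open>X - (1 - s) Y\<close> bounds the
  increase of \<open>g s\<close> from \<open>A\<close> to \<open>B\<close> by the increase of
  \<open>q1 / (1 - s)\<close>.\<close>

lemma E_convex_k_proper:
  assumes s: "0 < s" "s < 1"
  shows "E_convex W (k s)"
proof (rule E_convexI)
  have mg: "E_monotone W (g s)" using E_convex_monotone[OF E_convex_g] s by simp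
  show "E_monotone W (k s)"
  proof (rule E_monotoneI)
    fix A B \<iota> assume i: "A \<in> W" "B \<in> W" "tracial_embedding A B \<iota>"
    show "k s A X = k s B (embed A B \<iota> X)" if X: "X \<in> tuples A" for X
      unfolding k_def by (simp only: E_monotone_embed[OF mg i X] E_monotone_embed[OF E_monotone_q1 i X])
    fix X :: "ell2 ^ 'n" assume X: "X \<in> tuples B"
    let ?E = "cond_exp A B \<iota>"
    have EX: "?E X \<in> tuples A" by (rule cond_exp_in[OF i X])
    obtain \<gamma> where \<gamma>: "g s A (?E X) = ereal \<gamma>" using g_finite[OF i(1) s EX] by auto
    obtain \<beta> where \<beta>: "g s B X = ereal \<beta>" using g_finite[OF i(2) s X] by auto
    define a where "a = 1 - s"
    have a: "a > 0" using s by (simp add: a_def)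
    have "g s B X \<le> ereal (\<gamma> + (norm X)\<^sup>2 / (2 * a) - (norm (?E X))\<^sup>2 / (2 * a))"
      unfolding g_def fenchel_def
    proof (rule SUP_least)
      fix Y :: "ell2 ^ 'n" assume Y: "Y \<in> tuples B"
      have EY: "?E Y \<in> tuples A" by (rule cond_exp_in[OF i Y])
      have fY: "f A (?E Y) \<le> f B Y" by (rule E_monotone_cond_exp[OF E_convex_monotone[OF f] i Y])
      have "(norm (?E X - a *\<^sub>R ?E Y))\<^sup>2 / (2 * a) \<le> (norm (X - a *\<^sub>R Y))\<^sup>2 / (2 * a)"
        using a norm_cond_exp_diff[OF i X Y] by (intro divide_right_mono power_mono) auto
      then have le: "(norm (?E X))\<^sup>2 / (2 * a) - inner (?E X) (?E Y) + a / 2 * (norm (?E Y))\<^sup>2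
          \<le> (norm X)\<^sup>2 / (2 * a) - inner X Y + a / 2 * (norm Y)\<^sup>2"
        using a by (simp add: norm_sq_diff_smult)
      have up: "ereal (inner (?E X) (?E Y)) - interp_zero f s A (?E Y) \<le> ereal \<gamma>"
        unfolding \<gamma>[symmetric] g_def fenchel_def by (rule SUP_upper[OF EY])
      show "ereal (inner X Y) - interp_zero f s B Y \<le> ereal (\<gamma> + (norm X)\<^sup>2 / (2 * a) - (norm (?E X))\<^sup>2 / (2 * a))"
      proof (cases "f B Y")
        case (real w)
        then obtain w' where w': "f A (?E Y) = ereal w'" "w' \<le> w"
          using fY closed_convex[OF i(1)] EY unfolding closed_convex_on_def by (cases "f A (?E Y)") auto
        have "s * w' \<le> s * w" using w' s by simp
        moreover have "inner (?E X) (?E Y) - (a / 2 * (norm (?E Y))\<^sup>2 + s * w') \<le> \<gamma>"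
          using up by (simp add: interp_zero_def q1_def w' a_def)
        ultimately have "inner X Y - (a / 2 * (norm Y)\<^sup>2 + s * w) \<le> \<gamma> + (norm X)\<^sup>2 / (2 * a) - (norm (?E X))\<^sup>2 / (2 * a)"
          using le by linarith
        then show ?thesis by (simp add: interp_zero_def q1_def real a_def)
      next
        case PInf
        then show ?thesis using s by (simp add: interp_zero_def q1_def)
      next
        case MInf
        then show ?thesis using closed_convex[OF i(2)] Y unfolding closed_convex_on_def by simp
      qed
    qed
    then show "k s A (?E X) \<le> k s B X"
      unfolding k_def \<gamma> \<beta> by (simp add: q1_def a_def mult.commute)
  qed
  fix A assume A: "A \<in> W"
  show "closed_convex_on (tuples A) (k s A)"
  proof (rule closed_convex_on_subdiff[OF subspace_tuples[OF A]])
    fix X :: "ell2 ^ 'n" assume X: "X \<in> tuples A"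
    obtain p z v where r: "resolves A p z v" and Xeq: "X = (1 - s) *\<^sub>R p + s *\<^sub>R z" using resolvent[OF A s X] .
    note b = g_bounds[OF A s r Xeq]
    \<comment> \<open>The formal gradient of \<open>k s\<close> at \<open>X\<close>. It is a
      subgradient because the second-order term of \<open>q1 / (1 - s)\<close> equals the quadratic
      error in the upper bound for \<open>g s\<close>.\<close>
    let ?y = "(1 / (1 - s)) *\<^sub>R X - p"
    have "?y \<in> subdiff (tuples A) (k s A) X"
      unfolding subdiff_def
    proof (intro CollectI conjI ballI)
      show "?y \<in> tuples A"
        using subspace_tuples[OF A] resolves_in[OF r] X by (intro subspace_diff subspace_scale)
      fix Z :: "ell2 ^ 'n" assume Z: "Z \<in> tuples A"
      obtain \<zeta> where \<zeta>: "g s A Z = ereal \<zeta>" using g_finite[OF A s Z] by auto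
      define a where "a = 1 / (1 - s)"
      have a: "(norm (Z - X))\<^sup>2 / (2 * (1 - s)) = a * ((norm (Z - X))\<^sup>2 / 2)" by (simp add: a_def)
      have "\<zeta> \<le> (inner X p - ((1 - s) / 2 * (norm p)\<^sup>2 + s * v)) + inner p (Z - X) + a * ((norm (Z - X))\<^sup>2 / 2)"
        using b(3)[OF Z] unfolding \<zeta> a by simp
      moreover have "a * ((norm Z)\<^sup>2 / 2) = a * ((norm X)\<^sup>2 / 2) + a * inner X (Z - X) + a * ((norm (Z - X))\<^sup>2 / 2)"
        unfolding half_norm_sq_expand[of Z X] by (simp add: distrib_left)
      ultimately have "a * ((norm X)\<^sup>2 / 2) - (inner X p - ((1 - s) / 2 * (norm p)\<^sup>2 + s * v))
          + (a * inner X (Z - X) - inner p (Z - X)) \<le> a * ((norm Z)\<^sup>2 / 2) - \<zeta>"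
        by linarith
      then show "k s A X + ereal (inner ?y (Z - X)) \<le> k s A Z"
        unfolding k_def b(1) \<zeta> q1_def a_def[symmetric] by (simp add: inner_diff_left[of "a *\<^sub>R X"])
    qed
    then show "\<bar>k s A X\<bar> \<noteq> \<infinity> \<and> subdiff (tuples A) (k s A) X \<noteq> {}"
      unfolding k_def b(1) by (auto simp: q1_def)
  qed
qed

text \<open>The candidate is \<open>(t / s) X + ((s - t) / s) p\<close>, the formal gradient of the
  expression in \<open>interp_pos\<close>; two-sided control of \<open>g s\<close> around
  \<open>X\<close> shows that it is the gradient even when the coefficient of \<open>g s\<close> is
  negative.\<close>

lemma subdiff_interp_eq:
  assumes A: "A \<in> W" and s: "0 < s" "s < 1" and t: "0 \<le> t" "t \<le> 1" and r: "resolves A p z v"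
  shows "subdiff (tuples A) (F t s A) ((1 - s) *\<^sub>R p + s *\<^sub>R z) = {(1 - t) *\<^sub>R p + t *\<^sub>R z}"
proof -
  let ?X = "(1 - s) *\<^sub>R p + s *\<^sub>R z"
  let ?Y = "(1 - t) *\<^sub>R p + t *\<^sub>R z"
  have T: "?X \<in> tuples A" "?Y \<in> tuples A"
    using subspace_tuples[OF A] resolves_in[OF r] by (auto intro!: subspace_add subspace_scale)
  note b = g_bounds[OF A s r refl]
  note val = interp_pos[OF A _ s(1) less_imp_le[OF s(2)] t(1)]
  obtain \<gamma> where \<gamma>: "g s A ?X = ereal \<gamma>" using b(1) by blast
  define c where "c = (s - t) / s"
  have Y: "inner ?Y D = t / s * inner ?X D + c * inner p D" for D
  proof -
    define q where "q = t / s"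
    have "q * (1 - s) + c = 1 - t" "q * s = t" using s by (simp_all add: c_def q_def field_simps)
    then show ?thesis unfolding inner_add_left inner_scaleR_left q_def[symmetric] by algebra
  qed
  define m where "m = 1 / (2 * (1 - s))"
  have m: "m > 0" using s by (simp add: m_def)
  show ?thesis
  \<comment> \<open>A crude second-order constant: any positive one that dominates the remainder
    will do.\<close>
  proof (rule subdiff_eq_singleton[OF subspace_tuples[OF A] T, where b = "2 * (t / s + \<bar>c\<bar> * m) + 1"])
    show "F t s A ?X = ereal (t / s * ((norm ?X)\<^sup>2 / 2) + c * \<gamma>)" by (simp add: val[OF T(1)] \<gamma> c_def)
    show "2 * (t / s + \<bar>c\<bar> * m) + 1 > 0" using s t m by (simp add: add_nonneg_pos)
    fix Z :: "ell2 ^ 'n" assume Z: "Z \<in> tuples A"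
    obtain \<zeta> where \<zeta>: "g s A Z = ereal \<zeta>" using g_finite[OF A s Z] by auto
    define N where "N = (norm (Z - ?X))\<^sup>2"
    have N: "N \<ge> 0" by (simp add: N_def)
    define \<delta> where "\<delta> = \<zeta> - \<gamma> - inner p (Z - ?X)"
    have "N / (2 * (1 - s)) = m * N" by (simp add: m_def)
    then have \<delta>: "0 \<le> \<delta>" "\<delta> \<le> m * N"
      using b(2)[OF Z] b(3)[OF Z] \<gamma> unfolding b(1) \<zeta> by (simp_all add: \<delta>_def N_def)
    have "t / s * ((norm Z)\<^sup>2 / 2) + c * \<zeta>
        = (t / s * ((norm ?X)\<^sup>2 / 2) + c * \<gamma>) + inner ?Y (Z - ?X) + (t / s * (N / 2) + c * \<delta>)"
      unfolding half_norm_sq_expand[of Z ?X] Y \<delta>_def N_def by (simp only: algebra_simps)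
    \<comment> \<open>For \<open>t > s\<close> the coefficient \<open>c\<close> is negative and the
      worst case is \<open>\<delta> = m * N\<close>; even then the nonnegative quantity
      \<open>(1 - t) / (1 - s) * (N / 2)\<close> is left.\<close>
    moreover have "0 \<le> t / s * (N / 2) + c * \<delta>"
    proof (cases "t \<le> s")
      case True
      then show ?thesis using s t N \<delta> by (simp add: c_def)
    next
      case False
      then have c: "c \<le> 0" using s by (simp add: c_def divide_nonpos_pos)
      have "c * (m * N) \<le> c * \<delta>" using \<delta>(2) c by (rule mult_left_mono_neg)
      moreover have "t / s * (N / 2) + c * (m * N) = (1 - t) / (1 - s) * (N / 2)"
        using s unfolding c_def m_def by (simp add: divide_simps) (simp add: algebra_simps)
      moreover have "0 \<le> (1 - t) / (1 - s) * (N / 2)" using s t N by simp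
      ultimately show ?thesis by linarith
    qed
    moreover have "t / s * (N / 2) + c * \<delta> \<le> (2 * (t / s + \<bar>c\<bar> * m) + 1) / 2 * N"
    proof -
      have "c * \<delta> \<le> \<bar>c\<bar> * \<delta>" using \<delta>(1) by (intro mult_right_mono) auto
      also have "\<dots> \<le> \<bar>c\<bar> * (m * N)" using \<delta>(2) by (intro mult_left_mono) auto
      finally have "c * \<delta> \<le> \<bar>c\<bar> * m * N" by simp
      moreover have "t / s * (N / 2) \<le> t / s * N" using s t N by (intro mult_left_mono) auto
      moreover have "(2 * (q + \<bar>c\<bar> * m) + 1) / 2 * N = q * N + \<bar>c\<bar> * m * N + N / 2" for q
        by (simp add: algebra_simps)
      ultimately show ?thesis using N by (metis add_increasing2 add_mono divide_nonneg_nonneg zero_le_numeral)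
    qed
    ultimately show "\<exists>w. F t s A Z = ereal w \<and>
        t / s * ((norm ?X)\<^sup>2 / 2) + c * \<gamma> + inner ?Y (Z - ?X) \<le> w \<and>
        w \<le> t / s * ((norm ?X)\<^sup>2 / 2) + c * \<gamma> + inner ?Y (Z - ?X)
          + (2 * (t / s + \<bar>c\<bar> * m) + 1) / 2 * (norm (Z - ?X))\<^sup>2"
      by (intro exI[of _ "t / s * ((norm Z)\<^sup>2 / 2) + c * \<zeta>"]) (simp add: val[OF Z] \<zeta> c_def[symmetric] N_def)
  qed
qed

lemmas grad_interp_eq = grad_eqI[OF subdiff_interp_eq]

lemma ex1_subdiff_interp:
  assumes A: "A \<in> W" and s: "0 < s" "s < 1" and t: "0 \<le> t" "t \<le> 1" and X: "X \<in> tuples A"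
  shows "\<exists>!Y. Y \<in> subdiff (tuples A) (F t s A) X"
proof -
  obtain p z v where r: "resolves A p z v" and Xeq: "X = (1 - s) *\<^sub>R p + s *\<^sub>R z" using resolvent[OF A s X] .
  show ?thesis unfolding Xeq subdiff_interp_eq[OF A s t r] by simp
qed

text \<open>Monotonicity of the subdifferential makes the cross term in the square of
  \<open>X - X'\<close> nonnegative. Hence \<open>p\<close> and \<open>z\<close> depend on
  \<open>X\<close> with Lipschitz constants \<open>1 / (1 - s)\<close> and \<open>1 / s\<close>, and
  the gradient weighs them by \<open>1 - t\<close> and \<open>t\<close>.\<close>

lemma lipschitz_grad_interp:
  assumes A: "A \<in> W" and s: "0 < s" "s < 1" and t: "0 \<le> t" "t \<le> 1"
  shows "((1 - t) / (1 - s) + t / s)-lipschitz_on (tuples A) (grad (tuples A) (F t s A))"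
proof (rule lipschitz_onI)
  show "0 \<le> (1 - t) / (1 - s) + t / s" using s t by simp
  fix X X' :: "ell2 ^ 'n" assume X: "X \<in> tuples A" and X': "X' \<in> tuples A"
  obtain p z v where r: "resolves A p z v" and Xeq: "X = (1 - s) *\<^sub>R p + s *\<^sub>R z" using resolvent[OF A s X] .
  obtain p' z' v' where r': "resolves A p' z' v'" and Xeq': "X' = (1 - s) *\<^sub>R p' + s *\<^sub>R z'" using resolvent[OF A s X'] .
  let ?p = "p - p'" and ?z = "z - z'"
  have mono: "0 \<le> inner ?z ?p" using r r' subdiff_monotone unfolding resolves_def by blast
  have D: "X - X' = (1 - s) *\<^sub>R ?p + s *\<^sub>R ?z" unfolding Xeq Xeq' by (simp add: algebra_simps)
  have sq: "(norm (X - X'))\<^sup>2 = (norm ((1 - s) *\<^sub>R ?p))\<^sup>2 + 2 * ((1 - s) * s * inner ?z ?p) + (norm (s *\<^sub>R ?z))\<^sup>2"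
    unfolding D power2_norm_eq_inner
    unfolding inner_add_left inner_add_right inner_scaleR_left inner_scaleR_right inner_commute[of ?p ?z] by algebra
  have "0 \<le> (1 - s) * s * inner ?z ?p" using s mono by simp
  then have "(norm ((1 - s) *\<^sub>R ?p))\<^sup>2 \<le> (norm (X - X'))\<^sup>2" "(norm (s *\<^sub>R ?z))\<^sup>2 \<le> (norm (X - X'))\<^sup>2"
    unfolding sq by simp_all
  then have "\<bar>1 - s\<bar> * norm ?p \<le> norm (X - X')" "\<bar>s\<bar> * norm ?z \<le> norm (X - X')"
    unfolding norm_scaleR[symmetric] by (simp_all only: power2_le_iff_abs_le norm_ge_zero abs_norm_cancel)
  then have p: "norm ?p \<le> norm (X - X') / (1 - s)" and z: "norm ?z \<le> norm (X - X') / s"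
    using s by (simp_all add: pos_le_divide_eq mult.commute)
  have "((1 - t) *\<^sub>R p + t *\<^sub>R z) - ((1 - t) *\<^sub>R p' + t *\<^sub>R z') = (1 - t) *\<^sub>R ?p + t *\<^sub>R ?z"
    by (simp add: algebra_simps)
  then have "dist ((1 - t) *\<^sub>R p + t *\<^sub>R z) ((1 - t) *\<^sub>R p' + t *\<^sub>R z') \<le> norm ((1 - t) *\<^sub>R ?p) + norm (t *\<^sub>R ?z)"
    by (simp only: dist_norm norm_triangle_ineq)
  also have "\<dots> \<le> (1 - t) * (norm (X - X') / (1 - s)) + t * (norm (X - X') / s)"
    using t p z by (simp only: norm_scaleR) (intro add_mono mult_mono, auto)
  also have "\<dots> = ((1 - t) / (1 - s) + t / s) * dist X X'" by (simp add: dist_norm algebra_simps)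
  finally show "dist (grad (tuples A) (F t s A) X) (grad (tuples A) (F t s A) X')
      \<le> ((1 - t) / (1 - s) + t / s) * dist X X'"
    unfolding Xeq Xeq' grad_interp_eq[OF A s t r] grad_interp_eq[OF A s t r'] .
qed

lemma grad_interp_compose:
  assumes A: "A \<in> W" and s: "0 < s" "s < 1" and t: "0 < t" "t < 1" and u: "0 < u" "u < 1" and X: "X \<in> tuples A"
  shows "grad (tuples A) (F u t A) (grad (tuples A) (F t s A) X) = grad (tuples A) (F u s A) X"
proof -
  obtain p z v where r: "resolves A p z v" and Xeq: "X = (1 - s) *\<^sub>R p + s *\<^sub>R z" using resolvent[OF A s X] .
  show ?thesis
    unfolding Xeq using grad_interp_eq[OF A _ _ _ _ r] s t u by simp
qed

end

section \<open>The claims for arbitrary \<open>f\<close>, infinite constants included\<close>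

context interpolation
begin

lemma E_convex_k:
  assumes s: "0 < s" "s < 1"
  shows "E_convex W (k s)"
  using f
proof (cases rule: E_convex_cases)
  case minus
  have "g s A X = \<infinity>" if "A \<in> W" for A and X :: "ell2 ^ 'n"
    using fenchel_infinite[OF that, of "interp_zero f s A" "-\<infinity>" X] minus[OF that] s
    by (simp add: g_def interp_zero_def q1_def)
  then show ?thesis by (intro E_convex_infinite[of _ "-\<infinity>"]) (simp_all add: k_def q1_def)
next
  case plus
  have "g s A X = -\<infinity>" if "A \<in> W" for A and X :: "ell2 ^ 'n"
    using fenchel_infinite[OF that, of "interp_zero f s A" \<infinity> X] plus[OF that] s
    by (simp add: g_def interp_zero_def q1_def)
  then show ?thesis by (intro E_convex_infinite[of _ \<infinity>]) (simp_all add: k_def q1_def)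
next
  case proper
  then interpret proper_interpolation W f by unfold_locales
  show ?thesis by (rule E_convex_k_proper[OF s])
qed

text \<open>Trading \<open>g s\<close> for \<open>k s\<close> changes the coefficient of
  \<open>q1\<close> from \<open>t / s\<close> to \<open>(1 - t) / (1 - s)\<close> and reverses the
  sign of the other coefficient. So for each order of \<open>s\<close> and \<open>t\<close>, one of
  the two forms gives a lower and the other an upper convexity bound.\<close>

lemma interp_k:
  assumes A: "A \<in> W" and X: "X \<in> tuples A" and s: "0 < s" "s < 1" and t: "0 \<le> t"
  shows "F t s A X = ereal ((1 - t) / (1 - s)) * q1 A X + ereal ((t - s) / s) * k s A X"
proof -
  define m where "m = 1 / (1 - s)"
  define d where "d = (t - s) / s"
  have e: "(1 - t) / (1 - s) + d * m = t / s" "(s - t) / s = - d"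
    using s by (simp_all add: d_def m_def divide_simps) (simp_all add: algebra_simps)
  have e': "(1 - t) / (1 - s) = t / s - d * m" using e(1) by simp
  have id: "q * n + - d * v = (q - d * m) * n + d * (m * n - v)" for q n v :: real
    by (simp add: algebra_simps)
  show ?thesis
    unfolding interp_pos[OF A X s(1) less_imp_le[OF s(2)] t] k_def q1_def e' e(2) d_def[symmetric] m_def[symmetric]
  proof (cases "g s A X")
    case (real v)
    then show "ereal (t / s * ((norm X)\<^sup>2 / 2)) + ereal (- d) * g s A X
      = ereal (t / s - d * m) * ereal ((norm X)\<^sup>2 / 2) + ereal d * (ereal m * ereal ((norm X)\<^sup>2 / 2) - g s A X)"
      by (simp only: times_ereal.simps plus_ereal.simps ereal_minus(1) id)
  qed (cases d "0 :: real" rule: linorder_cases; simp)+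
qed

lemma E_convex_interp_minus_left:
  assumes s: "0 < s" "s \<le> 1" and t: "0 \<le> t" "t \<le> s"
  shows "E_convex W (\<lambda>A X. F t s A X - ereal (t / s) * q1 A X)"
proof (rule E_convex_cong)
  show "E_convex W (\<lambda>A X. ereal ((s - t) / s) * g s A X)"
    by (rule E_convex_scale[OF E_convex_g]) (use s t in auto)
  fix A and X :: "ell2 ^ 'n" assume "A \<in> W" "X \<in> tuples A"
  from interp_pos[OF this s t(1)]
  show "ereal ((s - t) / s) * g s A X = F t s A X - ereal (t / s) * q1 A X"
    by (simp add: q1_def ereal_add_minus_cancel)
qed

lemma E_convex_left_minus_interp:
  assumes s: "0 < s" "s \<le> t" and t: "t \<le> 1"
  shows "E_convex W (\<lambda>A X. ereal (t / s) * q1 A X - F t s A X)"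
proof (rule E_convex_cong)
  show "E_convex W (\<lambda>A X. ereal ((t - s) / s) * g s A X)"
    by (rule E_convex_scale[OF E_convex_g]) (use s t in auto)
  fix A and X :: "ell2 ^ 'n" assume AX: "A \<in> W" "X \<in> tuples A"
  have F: "F t s A X = ereal (t / s * ((norm X)\<^sup>2 / 2)) + ereal ((s - t) / s) * g s A X"
    by (rule interp_pos[OF AX]) (use s t in auto)
  have m: "ereal ((s - t) / s) * g s A X = - (ereal ((t - s) / s) * g s A X)"
    by (cases "g s A X") (use s in \<open>simp_all add: diff_divide_distrib left_diff_distrib\<close>)
  show "ereal ((t - s) / s) * g s A X = ereal (t / s) * q1 A X - F t s A X"
    unfolding F m by (simp add: q1_def ereal_minus_add_uminus)
qed

lemma E_convex_interp_minus_right: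
  assumes s: "0 \<le> s" "s < 1" and t: "s \<le> t" "t \<le> 1"
  shows "E_convex W (\<lambda>A X. F t s A X - ereal ((1 - t) / (1 - s)) * q1 A X)"
\<comment> \<open>\<open>interp_k\<close> requires \<open>s > 0\<close>; at \<open>s = 0\<close> the
  difference is simply \<open>t f\<close>.\<close>
proof (cases "s = 0")
  case True
  show ?thesis
  proof (rule E_convex_cong)
    show "E_convex W (\<lambda>A X. ereal t * f A X)" by (rule E_convex_scale[OF f]) (use s t in auto)
    fix A and X :: "ell2 ^ 'n"
    show "ereal t * f A X = F t s A X - ereal ((1 - t) / (1 - s)) * q1 A X"
      by (simp add: True interp_zero_right interp_zero_def q1_def ereal_add_minus_cancel)
  qed
next
  case False
  then have s0: "s > 0" using s by simp
  show ?thesis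
  proof (rule E_convex_cong)
    show "E_convex W (\<lambda>A X. ereal ((t - s) / s) * k s A X)"
      by (rule E_convex_scale[OF E_convex_k]) (use s s0 t in auto)
    fix A and X :: "ell2 ^ 'n" assume AX: "A \<in> W" "X \<in> tuples A"
    show "ereal ((t - s) / s) * k s A X = F t s A X - ereal ((1 - t) / (1 - s)) * q1 A X"
      unfolding interp_k[OF AX s0 s(2) order_trans[OF s(1) t(1)]]
      by (simp add: q1_def ereal_add_minus_cancel)
  qed
qed

lemma E_convex_right_minus_interp:
  assumes s: "0 \<le> s" "s < 1" and t: "0 \<le> t" "t \<le> s"
  shows "E_convex W (\<lambda>A X. ereal ((1 - t) / (1 - s)) * q1 A X - F t s A X)"
proof (cases "s = 0")
  case True
  \<comment> \<open>Both indices vanish, so the difference is the zero function, presented as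
    \<open>0 * q1\<close>.\<close>
  then have "t = 0" using t by simp
  show ?thesis
  proof (rule E_convex_cong)
    show "E_convex W (\<lambda>A X. ereal 0 * q1 A (X :: ell2 ^ 'n))" by (rule E_convex_scale[OF E_convex_q1]) simp
    fix A and X :: "ell2 ^ 'n"
    show "ereal 0 * q1 A X = ereal ((1 - t) / (1 - s)) * q1 A X - F t s A X"
      by (simp add: True \<open>t = 0\<close> interp_zero_right interp_zero_def q1_def zero_ereal_def[symmetric] one_ereal_def[symmetric])
  qed
next
  case False
  then have s0: "s > 0" using s by simp
  show ?thesis
  proof (rule E_convex_cong)
    show "E_convex W (\<lambda>A X. ereal ((s - t) / s) * k s A X)"
      by (rule E_convex_scale[OF E_convex_k]) (use s s0 t in auto)
    fix A and X :: "ell2 ^ 'n" assume AX: "A \<in> W" "X \<in> tuples A"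
    have m: "ereal ((t - s) / s) * k s A X = - (ereal ((s - t) / s) * k s A X)"
      by (cases "k s A X") (use s in \<open>simp_all add: diff_divide_distrib left_diff_distrib\<close>)
    show "ereal ((s - t) / s) * k s A X = ereal ((1 - t) / (1 - s)) * q1 A X - F t s A X"
      unfolding interp_k[OF AX s0 s(2) t(1)] m by (simp add: q1_def ereal_minus_add_uminus)
  qed
qed

text \<open>The multiple of \<open>q1\<close> that was subtracted is added back. The form with
  \<open>g s\<close> serves \<open>t \<le> s\<close>, where \<open>s = 1\<close> is possible; for
  \<open>s < t\<close> one has \<open>s < 1\<close> and the form with \<open>k s\<close>
  applies.\<close>

lemma E_convex_interp:
  assumes s: "0 \<le> s" "s \<le> 1" and t: "0 \<le> t" "t \<le> 1"
  shows "E_convex W (F t s)"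
proof -
  have add_back: "E_convex W G" if "E_convex W (\<lambda>A X. G A X - ereal c * q1 A X)" "c \<ge> 0" for G :: "'n wfun" and c
  proof (rule E_convex_cong[OF _ E_convex_combination[OF that(1) zero_le_one that(2)]])
    fix A and X :: "ell2 ^ 'n"
    show "ereal c * q1 A X + ereal 1 * (G A X - ereal c * q1 A X) = G A X"
      by (cases "G A X") (simp_all add: q1_def)
  qed
  consider "s = 0" | "0 < s" "t \<le> s" | "0 < s" "s < t" using s by linarith
  then show ?thesis
  proof cases
    case 1
    then show ?thesis using E_convex_zero[OF t] by (simp add: interp_zero_right)
  next
    case 2
    show ?thesis by (rule add_back[OF E_convex_interp_minus_left[OF 2(1) s(2) t(1) 2(2)]]) (use 2 t in simp)
  next
    case 3
    show ?thesis by (rule add_back[OF E_convex_interp_minus_right, of s t]) (use 3 t in simp_all)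
  qed
qed

lemma legendre_interp:
  assumes s: "0 \<le> s" "s \<le> 1" and t: "0 \<le> t" "t \<le> 1"
  shows "wfun_eq W (F s t) (legendre W (F t s))"
proof -
  have pos: "wfun_eq W (F s t) (legendre W (F t s))" if st: "0 < s" "s < t" "t \<le> 1" for s t
    unfolding wfun_eq_def
  proof (intro ballI)
    fix A and X :: "ell2 ^ 'n" assume A: "A \<in> W" and X: "X \<in> tuples A"
    have "E_convex W (F t s)" by (rule E_convex_interp) (use st in auto)
    from legendre_eq[OF E_convex_monotone[OF this] A X]
    have "legendre W (F t s) A X = fenchel (tuples A) (interp_inf f t s A) X"
      using st by (simp add: interp_def)
    also have "\<dots> = F s t A X" unfolding fenchel_interp_inf[OF A X st(1,2)] using st by (simp add: interp_def)
    finally show "F s t A X = legendre W (F t s) A X" by simp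
  qed
  \<comment> \<open>The diagonal is self-duality of \<open>q1\<close> and \<open>s = 0\<close> is
    the definition; of the rest, only \<open>0 < s < t\<close> is computed and the other cases
    follow by symmetry.\<close>
  consider "s = t" | "s = 0" "t \<noteq> 0" | "t = 0" "s \<noteq> 0" | "0 < s" "s < t" | "0 < t" "t < s"
    using s t by linarith
  then show ?thesis
  proof cases
    case 1
    show ?thesis
      unfolding wfun_eq_def
    proof (intro ballI)
      fix A and X :: "ell2 ^ 'n" assume A: "A \<in> W" and X: "X \<in> tuples A"
      have "legendre W (F t t) A X = fenchel (tuples A) (F t t A) X"
        by (rule legendre_eq[OF E_convex_monotone[OF E_convex_interp[OF t t]] A X])
      also have "\<dots> = fenchel (tuples A) (q1 A) X" by (rule fenchel_cong) (rule interp_diag[OF A _ t])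
      also have "\<dots> = F t t A X" by (simp only: fenchel_q1[OF A X] interp_diag[OF A X t])
      finally show "F s t A X = legendre W (F t s) A X" by (simp add: 1)
    qed
  next
    case 2
    then show ?thesis by (simp add: interp_zero_left wfun_eq_def)
  next
    case 3
    then show ?thesis using legendre_sym[OF E_convex_interp[OF t s]] by (simp add: interp_zero_left wfun_eq_def)
  next
    case 4
    then show ?thesis using pos t by blast
  next
    case 5
    then show ?thesis using legendre_sym[OF E_convex_interp[OF t s] pos[OF 5 s(2)]] by simp
  qed
qed

end

text \<open>The gradient claims carry \<open>proper\<close>: if \<open>f\<close> is constantly
  infinite, so is \<open>F t s\<close> for \<open>t \<noteq> s\<close>, and then every vector is a
  subgradient.\<close>

theorem proposition4p12:
  fixes W :: "tracial_algebra set" and f :: "('n::finite) wfun"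
  assumes W: "representatives W"
    and f: "E_convex W f"
  shows
    "(let F = interp W f; proper = (\<not> wfun_eq W f (\<lambda>_ _. \<infinity>) \<and> \<not> wfun_eq W f (\<lambda>_ _. -\<infinity>)) in
    \<comment> \<open>the clauses defining f_{t,s} agree where they overlap\<close>
    (\<forall>t\<in>{0..1}.
       wfun_eq W (F t 0) (interp_zero f t) \<and>
       wfun_eq W (F 0 t) (legendre W (F t 0)) \<and>
       wfun_eq W (F t t) q1) \<and>
    (\<forall>t\<in>{0..1}. \<forall>s\<in>{0<..1}.
       (s \<le> t \<longrightarrow> wfun_eq W (F t s) (interp_inf f t s)) \<and>
       (t \<le> s \<longrightarrow> wfun_eq W (F t s) (interp_sup f t s))) \<and>
    \<comment> \<open>(1)\<close>
    (\<forall>t\<in>{0..1}. \<forall>s\<in>{0..1}. E_convex W (F t s) \<and> wfun_eq W (F s t) (legendre W (F t s))) \<and>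
    \<comment> \<open>(2)\<close>
    (\<forall>t\<in>{0..1}. \<forall>s\<in>{0..1}. s \<le> t \<longrightarrow>
       (s < 1 \<longrightarrow> E_convex W (\<lambda>A X. F t s A X - ereal ((1 - t) / (1 - s)) * q1 A X)) \<and>
       (s > 0 \<longrightarrow> E_convex W (\<lambda>A X. ereal (t / s) * q1 A X - F t s A X))) \<and>
    \<comment> \<open>(3)\<close>
    (\<forall>t\<in>{0..1}. \<forall>s\<in>{0..1}. t \<le> s \<longrightarrow>
       (s > 0 \<longrightarrow> E_convex W (\<lambda>A X. F t s A X - ereal (t / s) * q1 A X)) \<and>
       (s < 1 \<longrightarrow> E_convex W (\<lambda>A X. ereal ((1 - t) / (1 - s)) * q1 A X - F t s A X))) \<and>
    \<comment> \<open>(4)\<close>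
    (proper \<longrightarrow> (\<forall>t\<in>{0..1}. \<forall>s\<in>{0<..<1}. \<forall>A\<in>W.
       (\<forall>X\<in>tuples A. \<exists>!Y. Y \<in> subdiff (tuples A) (F t s A) X) \<and>
       (\<exists>L. L-lipschitz_on (tuples A) (grad (tuples A) (F t s A))))) \<and>
    \<comment> \<open>(5)\<close>
    (\<forall>s t u. 0 \<le> s \<and> s < u \<and> u < t \<and> t \<le> 1 \<longrightarrow>
       wfun_eq W (F u s)
         (\<lambda>A X. ereal ((t - u) / (t - s)) * q1 A X + ereal ((u - s) / (t - s)) * F t s A X) \<and>
       wfun_eq W (F t u)
         (inf_convolution W
           (\<lambda>A X. ereal ((t - s) / (u - s)) * q1 A X)
           (\<lambda>A X. ereal ((t - u) / (t - s)) * F t s A (((t - s) / (t - u)) *\<^sub>R X)))) \<and>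
    \<comment> \<open>(6)\<close>
    (\<forall>s t. 0 \<le> s \<and> s < t \<and> t \<le> 1 \<longrightarrow>
       (\<forall>A\<in>W. \<forall>X\<in>tuples A. \<forall>Y\<in>tuples A. Y \<in> subdiff (tuples A) (F t s A) X \<longrightarrow>
         (\<forall>u\<in>{s..t}.
            let X\<^sub>u = ((t - u) / (t - s)) *\<^sub>R X + ((u - s) / (t - s)) *\<^sub>R Y
            in X\<^sub>u \<in> subdiff (tuples A) (F u s A) X \<and>
               Y \<in> subdiff (tuples A) (F t u A) X\<^sub>u))) \<and>
    \<comment> \<open>(7)\<close>
    (proper \<longrightarrow> (\<forall>s\<in>{0<..<1}. \<forall>t\<in>{0<..<1}. \<forall>u\<in>{0<..<1}. \<forall>A\<in>W. \<forall>X\<in>tuples A.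
       grad (tuples A) (F u t A) (grad (tuples A) (F t s A) X) = grad (tuples A) (F u s A) X)))"
proof -
  have "representing W" using W by (rule representing.intro)
  then interpret interpolation W f using f by (intro interpolation.intro interpolation_axioms.intro)
  \<comment> \<open>Properness of the tuple as a whole yields a point in every algebra where
    \<open>f\<close> is not \<open>\<infinity>\<close>; this is where the scalars enter.\<close>
  have proper: "proper_interpolation W f" if "\<not> wfun_eq W f (\<lambda>_ _. \<infinity>) \<and> \<not> wfun_eq W f (\<lambda>_ _. -\<infinity>)"
  proof -
    have "(\<forall>A\<in>W. closed_convex_on (tuples A) (f A)) \<and> (\<forall>A\<in>W. \<exists>X\<in>tuples A. f A X \<noteq> \<infinity>)"
      using f
    proof (cases rule: E_convex_cases)
      case minus then show ?thesis using that by (simp add: wfun_eq_def)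
    next
      case plus then show ?thesis using that by (simp add: wfun_eq_def)
    next
      case proper then show ?thesis by blast
    qed
    then show ?thesis by unfold_locales auto
  qed
  show ?thesis
    unfolding Let_def
  proof (intro conjI ballI allI impI; (elim conjE)?)
    fix t :: real assume t: "t \<in> {0..1}"
    show "wfun_eq W (F t 0) (interp_zero f t)" by (simp add: interp_zero_right wfun_eq_def)
    show "wfun_eq W (F 0 t) (legendre W (F t 0))" by (rule legendre_interp) (use t in auto)
    show "wfun_eq W (F t t) q1" unfolding wfun_eq_def using interp_diag t by simp
  next
    fix t s :: real assume ts: "t \<in> {0..1}" "s \<in> {0<..1}"
    show "wfun_eq W (F t s) (interp_inf f t s)" if "s \<le> t"
      unfolding wfun_eq_def using interp_pos interp_inf_eq ts that by simp
    show "wfun_eq W (F t s) (interp_sup f t s)" if "t \<le> s"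
      unfolding wfun_eq_def using interp_pos interp_sup_eq ts that by simp
  next
    fix t s :: real assume ts: "t \<in> {0..1}" "s \<in> {0..1}"
    show "E_convex W (F t s)" by (rule E_convex_interp) (use ts in auto)
    show "wfun_eq W (F s t) (legendre W (F t s))" by (rule legendre_interp) (use ts in auto)
  next
    fix t s :: real assume ts: "t \<in> {0..1}" "s \<in> {0..1}" "s \<le> t"
    show "E_convex W (\<lambda>A X. F t s A X - ereal ((1 - t) / (1 - s)) * q1 A X)" if "s < 1"
      by (rule E_convex_interp_minus_right) (use ts that in auto)
    show "E_convex W (\<lambda>A X. ereal (t / s) * q1 A X - F t s A X)" if "0 < s"
      by (rule E_convex_left_minus_interp) (use ts that in auto)
  next
    fix t s :: real assume ts: "t \<in> {0..1}" "s \<in> {0..1}" "t \<le> s"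
    show "E_convex W (\<lambda>A X. F t s A X - ereal (t / s) * q1 A X)" if "0 < s"
      by (rule E_convex_interp_minus_left) (use ts that in auto)
    show "E_convex W (\<lambda>A X. ereal ((1 - t) / (1 - s)) * q1 A X - F t s A X)" if "s < 1"
      by (rule E_convex_right_minus_interp) (use ts that in auto)
  next
    fix t s :: real and A
    assume p: "\<not> wfun_eq W f (\<lambda>_ _. \<infinity>)" "\<not> wfun_eq W f (\<lambda>_ _. -\<infinity>)"
      and ts: "t \<in> {0..1}" "s \<in> {0<..<1}" and A: "A \<in> W"
    interpret proper_interpolation W f using p by (intro proper conjI)
    show "\<exists>!Y. Y \<in> subdiff (tuples A) (F t s A) X" if "X \<in> tuples A" for X
      using ex1_subdiff_interp A that ts by simp
    show "\<exists>L. L-lipschitz_on (tuples A) (grad (tuples A) (F t s A))"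
      using lipschitz_grad_interp[OF A, of s t] ts by auto
  next
    fix s t u :: real assume su: "0 \<le> s" "s < u" "u < t" "t \<le> 1"
    show "wfun_eq W (F u s)
         (\<lambda>A X. ereal ((t - u) / (t - s)) * q1 A X + ereal ((u - s) / (t - s)) * F t s A X)"
      unfolding wfun_eq_def using interp_affine su by blast
    have "E_convex W (F t s)" by (rule E_convex_interp) (use su in auto)
    then show "wfun_eq W (F t u)
         (inf_convolution W
           (\<lambda>A X. ereal ((t - s) / (u - s)) * q1 A X)
           (\<lambda>A X. ereal ((t - u) / (t - s)) * F t s A (((t - s) / (t - u)) *\<^sub>R X)))"
      unfolding wfun_eq_def using interp_inf_convolution su by blast
  next
    fix s t u :: real and A and X Y :: "ell2 ^ 'n"
    assume a: "0 \<le> s" "s < t" "t \<le> 1" "A \<in> W" "X \<in> tuples A" "Y \<in> tuples A"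
      "Y \<in> subdiff (tuples A) (F t s A) X" "u \<in> {s..t}"
    show "((t - u) / (t - s)) *\<^sub>R X + ((u - s) / (t - s)) *\<^sub>R Y \<in> subdiff (tuples A) (F u s A) X"
      by (rule subdiff_interp(1)[OF a(4-6,1-3,7)]) (use a in auto)
    show "Y \<in> subdiff (tuples A) (F t u A) (((t - u) / (t - s)) *\<^sub>R X + ((u - s) / (t - s)) *\<^sub>R Y)"
      by (rule subdiff_interp(2)[OF a(4-6,1-3,7)]) (use a in auto)
  next
    fix s t u :: real and A and X :: "ell2 ^ 'n"
    assume p: "\<not> wfun_eq W f (\<lambda>_ _. \<infinity>)" "\<not> wfun_eq W f (\<lambda>_ _. -\<infinity>)"
      and stu: "s \<in> {0<..<1}" "t \<in> {0<..<1}" "u \<in> {0<..<1}" and AX: "A \<in> W" "X \<in> tuples A"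
    interpret proper_interpolation W f using p by (intro proper conjI)
    show "grad (tuples A) (F u t A) (grad (tuples A) (F t s A) X) = grad (tuples A) (F u s A) X"
      using grad_interp_compose AX stu by simp
  qed
qed

end
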